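(* Assume that $V$ satisfies (V1) and (V2) below, let $n\in\mathbb N$, $\varphi\in\mathcal S(\mathbb R^d)$ and $\delta>0$. (i) If $2n\le n_V$, then there exists a constant $C_0>0$ such that \[ \big|\langle f, e^{-\mathrm i tT}\varphi_x\rangle\big|^2\le C_0\,\langle t\rangle^{1+2\delta}\int_{\mathbb R^d}\Big(1\wedge\frac{\langle t\rangle}{|x-y|}\Big)^{n}|f(y)|^2\,\mathrm dy \] for all $x\in\mathbb R^d$, $f\in L^2(\mathbb R^d)$ and $t\in\mathbb R$. (ii) If $2n+2\le n_V$, then there exists a constant $C_1>0$ such that \[ \big|\langle f, (e^{-\mathrm i tT}-\mathbf 1)\varphi_x\rangle\big|^2\le C_1\,|t|^2\langle t\rangle^{1+2\delta}\int_{\mathbb R^d}\Big(1\wedge\frac{\langle t\rangle}{|x-y|}\Big)^{n}|f(y)|^2\,\mathrm dy \] for all $x\in\mathbb R^d$, $f\in L^2(\mathbb R^d)$ and $t\in\mathbb R$. Moreover, if $\varphi=\varphi^\sigma$ is the Gaussian with $\sigma\le 1$, the constants can be chosen with $C_j\le K\,\sigma^{-d}\sigma^{-4(n(n+\delta)/(2\delta)+j)}$, $j\in\{0,1\}$, for a constant $K$ independent of $\sigma$.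
   Context: Standing hypotheses on the potential $V:\mathbb R^d\to\mathbb R$: (V1) $V\in L^2_{\mathrm{loc}}(\mathbb R^d)$ is $\Delta$-bounded with bound $<1$, i.e. there are $a\in[0,1)$, $b\ge0$ with $\|Vf\|\le a\|\Delta f\|+b\|f\|$ for all $f\in H^2(\mathbb R^d)$; (V2) $V$ is $n_V\ge 2$ times differentiable with essentially bounded derivatives. $T:=-\tfrac12\Delta+V$ is the self-adjoint operator on $H^2(\mathbb R^d)$. For a function $\varphi$ and $x\in\mathbb R^d$, $\varphi_x:=\varphi(\cdot-x)$. $\langle t\rangle:=(1+t^2)^{1/2}$, $a\wedge b=\min\{a,b\}$. $\mathcal S(\mathbb R^d)$ is the Schwartz space. The Gaussian is $\varphi^\sigma(y):=(\pi\sigma^2)^{-d/2}\exp(-y^2/(2\sigma^2))$ for $\sigma>0$. *)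

theory Defs
  imports "HOL-Analysis.Analysis"
begin

definition dderiv :: "'a::real_normed_vector \<Rightarrow> ('a \<Rightarrow> 'b::real_normed_vector) \<Rightarrow> 'a \<Rightarrow> 'b" where
  "dderiv e f x = vector_derivative (\<lambda>h::real. f (x + h *\<^sub>R e)) (at 0)"

fun iterdiff :: "'a::real_normed_vector list \<Rightarrow> ('a \<Rightarrow> 'b::real_normed_vector) \<Rightarrow> 'a \<Rightarrow> 'b" where
  "iterdiff [] f = f"
| "iterdiff (e # es) f = dderiv e (iterdiff es f)"

definition smooth_fun :: "('a::euclidean_space \<Rightarrow> 'b::real_normed_vector) \<Rightarrow> bool" where
  "smooth_fun f \<longleftrightarrow> (\<forall>ds \<in> lists Basis. \<forall>x. iterdiff ds f differentiable (at x))"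

definition test_fun :: "('a::euclidean_space \<Rightarrow> real) \<Rightarrow> bool" where
  "test_fun \<phi> \<longleftrightarrow> smooth_fun \<phi> \<and> bounded {x. \<phi> x \<noteq> 0}"

definition schwartz :: "('a::euclidean_space \<Rightarrow> complex) \<Rightarrow> bool" where
  "schwartz \<phi> \<longleftrightarrow> smooth_fun \<phi> \<and>
     (\<forall>ds \<in> lists Basis. \<forall>k::nat. \<exists>B. \<forall>x. norm x ^ k * norm (iterdiff ds \<phi> x) \<le> B)"

definition L2 :: "('a::euclidean_space \<Rightarrow> complex) \<Rightarrow> bool" where
  "L2 f \<longleftrightarrow> f \<in> borel_measurable lebesgue \<and> integrable lebesgue (\<lambda>x. (norm (f x))\<^sup>2)"

definition L2norm :: "('a::euclidean_space \<Rightarrow> complex) \<Rightarrow> real" where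
  "L2norm f = sqrt (\<integral>x. (norm (f x))\<^sup>2 \<partial>lebesgue)"

definition inner_L2 :: "('a::euclidean_space \<Rightarrow> complex) \<Rightarrow> ('a \<Rightarrow> complex) \<Rightarrow> complex" where
  "inner_L2 f g = (\<integral>x. cnj (f x) * g x \<partial>lebesgue)"

definition weak_deriv :: "'a::euclidean_space list \<Rightarrow> ('a \<Rightarrow> complex) \<Rightarrow> ('a \<Rightarrow> complex) \<Rightarrow> bool" where
  "weak_deriv ds f g \<longleftrightarrow> (\<forall>\<phi>. test_fun \<phi> \<longrightarrow>
      (\<integral>x. f x * complex_of_real (iterdiff ds \<phi> x) \<partial>lebesgue)
      = (-1) ^ length ds * (\<integral>x. g x * complex_of_real (\<phi> x) \<partial>lebesgue))"

definition H2 :: "('a::euclidean_space \<Rightarrow> complex) \<Rightarrow> bool" where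
  "H2 f \<longleftrightarrow> L2 f \<and> (\<forall>ds \<in> lists Basis. length ds \<le> 2 \<longrightarrow> (\<exists>g. L2 g \<and> weak_deriv ds f g))"

text \<open>Weak Laplacian (a representative of its a.e. class).\<close>
definition lap :: "('a::euclidean_space \<Rightarrow> complex) \<Rightarrow> 'a \<Rightarrow> complex" where
  "lap f = (\<lambda>x. \<Sum>i\<in>Basis. (SOME g. L2 g \<and> weak_deriv [i, i] f g) x)"

definition schr_op :: "('a::euclidean_space \<Rightarrow> real) \<Rightarrow> ('a \<Rightarrow> complex) \<Rightarrow> 'a \<Rightarrow> complex" where
  "schr_op V f = (\<lambda>x. - (1/2) * lap f x + complex_of_real (V x) * f x)"

definition V1 :: "('a::euclidean_space \<Rightarrow> real) \<Rightarrow> bool" where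
  "V1 V \<longleftrightarrow> V \<in> borel_measurable lebesgue \<and>
     (\<forall>K. compact K \<longrightarrow> set_integrable lebesgue K (\<lambda>x. (V x)\<^sup>2)) \<and>
     (\<exists>a b. 0 \<le> a \<and> a < 1 \<and> 0 \<le> b \<and>
        (\<forall>f. H2 f \<longrightarrow> L2 (\<lambda>x. complex_of_real (V x) * f x) \<and>
             L2norm (\<lambda>x. complex_of_real (V x) * f x) \<le> a * L2norm (lap f) + b * L2norm f))"

definition V2 :: "('a::euclidean_space \<Rightarrow> real) \<Rightarrow> nat \<Rightarrow> bool" where
  "V2 V nV \<longleftrightarrow>
     (\<forall>ds \<in> lists Basis. length ds < nV \<longrightarrow> (\<forall>x. iterdiff ds V differentiable (at x))) \<and>
     (\<forall>ds \<in> lists Basis. 1 \<le> length ds \<and> length ds \<le> nV \<longrightarrow>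
        (\<exists>B. AE x in lebesgue. \<bar>iterdiff ds V x\<bar> \<le> B))"

text \<open>U is the unitary group e^{-itT}: linear isometries of L^2, U 0 = id, and for
  psi in H^2 = D(T), t \<mapsto> U t psi stays in H^2 and solves i d/dt u = T u in L^2.
  (These properties determine U uniquely, by symmetry of T on H^2, isometry and density.)\<close>
definition propagator :: "('a::euclidean_space \<Rightarrow> real) \<Rightarrow> (real \<Rightarrow> ('a \<Rightarrow> complex) \<Rightarrow> 'a \<Rightarrow> complex) \<Rightarrow> bool" where
  "propagator V U \<longleftrightarrow>
     (\<forall>t f. L2 f \<longrightarrow> L2 (U t f)) \<and>
     (\<forall>t f g (c::complex). L2 f \<longrightarrow> L2 g \<longrightarrow>
        (AE x in lebesgue. U t (\<lambda>y. f y + c * g y) x = U t f x + c * U t g x)) \<and>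
     (\<forall>t f. L2 f \<longrightarrow> L2norm (U t f) = L2norm f) \<and>
     (\<forall>f. L2 f \<longrightarrow> (AE x in lebesgue. U 0 f x = f x)) \<and>
     (\<forall>\<psi> t. H2 \<psi> \<longrightarrow> H2 (U t \<psi>) \<and>
        ((\<lambda>h. L2norm (\<lambda>x. (U (t + h) \<psi> x - U t \<psi> x) / complex_of_real h
                           + \<i> * schr_op V (U t \<psi>) x)) \<longlongrightarrow> 0) (at 0))"

definition jbr :: "real \<Rightarrow> real" where
  "jbr t = sqrt (1 + t\<^sup>2)"

definition transl :: "('a::real_normed_vector \<Rightarrow> 'b) \<Rightarrow> 'a \<Rightarrow> 'a \<Rightarrow> 'b" where
  "transl \<phi> x = (\<lambda>y. \<phi> (y - x))"

definition gauss :: "real \<Rightarrow> 'a::euclidean_space \<Rightarrow> complex" where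
  "gauss \<sigma> y = complex_of_real ((pi * \<sigma>\<^sup>2) powr (- real DIM('a) / 2) * exp (- (norm y)\<^sup>2 / (2 * \<sigma>\<^sup>2)))"

definition weight_int :: "real \<Rightarrow> nat \<Rightarrow> 'a::euclidean_space \<Rightarrow> ('a \<Rightarrow> complex) \<Rightarrow> real" where
  "weight_int t n x f = (\<integral>y. (min 1 (jbr t / norm (x - y))) ^ n * (norm (f y))\<^sup>2 \<partial>lebesgue)"

end

theory Submission
  imports Defs
begin

text \<open>By Cauchy--Schwarz it suffices to bound the moment \<open>\<integral> (1 + |y - x|\<^sup>2)\<^sup>n |u|\<^sup>2\<close> of
  \<open>u = e\<^sup>-\<^sup>i\<^sup>t\<^sup>T \<phi>\<^sub>x\<close> by a multiple of \<open>\<langle>t\<rangle>\<^sup>2\<^sup>n\<close>; no loss \<open>\<langle>t\<rangle>\<^sup>1\<^sup>+\<^sup>2\<^sup>\<delta>\<close> is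
  needed. Let \<open>r\<^sup>2 = 1 + |y - x|\<^sup>2\<close> and \<open>u\<^sub>m = e\<^sup>-\<^sup>i\<^sup>t\<^sup>T T\<^sup>m \<phi>\<^sub>x\<close>. The time derivative of
  \<open>\<parallel>r\<^sup>k\<^sup>+\<^sup>1 u\<^sub>m\<parallel>\<close> is at most a multiple of \<open>\<parallel>r\<^sup>k \<nabla>u\<^sub>m\<parallel>\<close>, and since \<open>V\<close> is bounded, integration by
  parts bounds \<open>\<parallel>r\<^sup>k \<nabla>u\<^sub>m\<parallel>\<^sup>2\<close> by \<open>\<parallel>r\<^sup>k u\<^sub>m\<parallel> \<parallel>r\<^sup>k u\<^sub>m\<^sub>+\<^sub>1\<parallel> + \<parallel>r\<^sup>k u\<^sub>m\<parallel>\<^sup>2\<close>. Induction on \<open>k\<close>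
  gives \<open>\<parallel>r\<^sup>k u\<^sub>m\<parallel> = O(\<langle>t\<rangle>\<^sup>k)\<close> for \<open>k + m \<le> n\<close>, and each of the \<open>n\<close> applications of \<open>T\<close> costs
  two derivatives of \<open>\<phi>\<close> and of \<open>V\<close>. The second bound follows by integrating the first one,
  for the initial datum \<open>T \<phi>\<^sub>x\<close>, over time.

  All that is used of weak derivatives is that the difference quotients of a function converge weakly
  to them, which turns every integration by parts into translation invariance of the integral.\<close>

section \<open>Square-integrable functions\<close>

text \<open>The moments of u are not known to be finite beforehand, so they cannot be differentiated
  directly. The weight is replaced by the bounded \<open>reg_weight e\<close>, all constants in the
  final moment bound are kept free of e, and Fatou's lemma recovers the true moment. The dependence
  on the Gaussian width comes from one bookkeeping device: data are measured by an amplitude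
  \<open>L\<close> and a length scale \<open>s\<close>, with S = 1/s. An application of T costs S^2,
  and a power of the weight costs S, because the gradient norm is controlled by a geometric mean of
  the norms for m and m + 1. Hence the k-th moment norm of u_m carries S^(2m+k), and the squared
  bound for k = n, m = 0 carries S^(2n), which does not exceed the allowed power with exponent 4 n
  (n + \<delta>) / (2 \<delta>) = 2 n + 2 n^2 / \<delta>. Functions are not identified when equal
  almost everywhere: \<open>lap\<close> picks representatives by \<open>SOME\<close> and
  \<open>U\<close> acts on functions. Compatibility with a.e. equality therefore has to be proved,
  as do the group law and the commutation of \<open>U\<close> with T, which
  \<open>propagator\<close> does not state.\<close>

lemma L2_measurable: "L2 f \<Longrightarrow> f \<in> borel_measurable lebesgue"
  and L2_square_integrable: "L2 f \<Longrightarrow> integrable lebesgue (\<lambda>x. (norm (f x))\<^sup>2)"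
  by (auto simp: L2_def)

lemma L2_bound:
  assumes "L2 g" "f \<in> borel_measurable lebesgue" "AE x in lebesgue. norm (f x) \<le> c * norm (g x)"
  shows "L2 f"
  unfolding L2_def
proof (intro conjI assms(2))
  show "integrable lebesgue (\<lambda>x. (norm (f x))\<^sup>2)"
  proof (rule Bochner_Integration.integrable_bound)
    show "integrable lebesgue (\<lambda>x. c\<^sup>2 * (norm (g x))\<^sup>2)"
      using L2_square_integrable[OF assms(1)] by simp
    show "(\<lambda>x. (norm (f x))\<^sup>2) \<in> borel_measurable lebesgue" using assms(2) by measurable
    show "AE x in lebesgue. norm ((norm (f x))\<^sup>2) \<le> norm (c\<^sup>2 * (norm (g x))\<^sup>2)"
      using assms(3) by eventually_elim (auto simp: power_mult_distrib[symmetric] intro!: power_mono)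
  qed
qed

lemma L2_integrable_mult:
  assumes "L2 f" "L2 g"
  shows "integrable lebesgue (\<lambda>x. f x * g x)"
proof (rule Bochner_Integration.integrable_bound)
  show "integrable lebesgue (\<lambda>x. (norm (f x))\<^sup>2 + (norm (g x))\<^sup>2)"
    using assms by (simp add: L2_square_integrable)
  show "(\<lambda>x. f x * g x) \<in> borel_measurable lebesgue" using assms[THEN L2_measurable] by measurable
  show "AE x in lebesgue. norm (f x * g x) \<le> norm ((norm (f x))\<^sup>2 + (norm (g x))\<^sup>2)"
  proof (rule AE_I2)
    fix x
    have "norm (f x) * norm (g x) \<le> (norm (f x))\<^sup>2 + (norm (g x))\<^sup>2"
      using sum_squares_bound[of "norm (f x)" "norm (g x)"] zero_le_power2[of "norm (f x)"]
        mult_nonneg_nonneg[of "norm (f x)" "norm (g x)", OF norm_ge_zero norm_ge_zero] by linarith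
    then show "norm (f x * g x) \<le> norm ((norm (f x))\<^sup>2 + (norm (g x))\<^sup>2)"
      by (simp add: norm_mult)
  qed
qed

lemma L2_integrable_norm_mult:
  assumes "L2 f" "L2 g"
  shows "integrable lebesgue (\<lambda>x. norm (f x) * norm (g x))"
  using integrable_norm[OF L2_integrable_mult[OF assms]] by (simp add: norm_mult)

lemma L2_cmult: "L2 f \<Longrightarrow> L2 (\<lambda>x. c * f x)"
  by (rule L2_bound[of f _ "norm c"]) (auto simp: norm_mult intro!: borel_measurable_times dest: L2_measurable)

lemma L2_divide: "L2 f \<Longrightarrow> L2 (\<lambda>x. f x / c)"
  using L2_cmult[of f "inverse c"] by (simp add: field_simps)

lemma L2_zero: "L2 (\<lambda>x. 0)"
  by (simp add: L2_def)

lemma L2_uminus: "L2 f \<Longrightarrow> L2 (\<lambda>x. - f x)"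
  using L2_cmult[of f "-1"] by simp

lemma L2_cnj: "L2 f \<Longrightarrow> L2 (\<lambda>x. cnj (f x))"
proof (rule L2_bound[of f _ 1])
  assume "L2 f"
  from L2_measurable[OF this] show "(\<lambda>x. cnj (f x)) \<in> borel_measurable lebesgue"
    by (rule measurable_compose) (simp add: borel_measurable_continuous_onI continuous_on_cnj)
qed auto

lemma L2_add:
  assumes "L2 f" "L2 g"
  shows "L2 (\<lambda>x. f x + g x)"
  unfolding L2_def
proof (intro conjI)
  show m: "(\<lambda>x. f x + g x) \<in> borel_measurable lebesgue" using assms[THEN L2_measurable] by measurable
  show "integrable lebesgue (\<lambda>x. (norm (f x + g x))\<^sup>2)"
  proof (rule Bochner_Integration.integrable_bound)
    show "integrable lebesgue (\<lambda>x. 2 * (norm (f x))\<^sup>2 + 2 * (norm (g x))\<^sup>2)"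
      using assms by (simp add: L2_square_integrable)
    show "(\<lambda>x. (norm (f x + g x))\<^sup>2) \<in> borel_measurable lebesgue" using m by measurable
    show "AE x in lebesgue. norm ((norm (f x + g x))\<^sup>2) \<le> norm (2 * (norm (f x))\<^sup>2 + 2 * (norm (g x))\<^sup>2)"
    proof (rule AE_I2)
      fix x
      have "(norm (f x + g x))\<^sup>2 \<le> (norm (f x) + norm (g x))\<^sup>2"
        by (intro power_mono norm_triangle_ineq) auto
      also have "\<dots> \<le> 2 * (norm (f x))\<^sup>2 + 2 * (norm (g x))\<^sup>2"
        using sum_squares_bound[of "norm (f x)" "norm (g x)"] by (simp add: power2_sum)
      finally show "norm ((norm (f x + g x))\<^sup>2) \<le> norm (2 * (norm (f x))\<^sup>2 + 2 * (norm (g x))\<^sup>2)"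
        by simp
    qed
  qed
qed

lemma L2_diff: "L2 f \<Longrightarrow> L2 g \<Longrightarrow> L2 (\<lambda>x. f x - g x)"
  using L2_add[OF _ L2_uminus, of f g] by simp

lemma L2_sum: "(\<And>i. i \<in> I \<Longrightarrow> L2 (f i)) \<Longrightarrow> L2 (\<lambda>x. \<Sum>i\<in>I. f i x)"
  by (induction I rule: infinite_finite_induct) (auto intro: L2_zero L2_add)

lemma L2_bounded_mult:
  assumes "L2 f" "w \<in> borel_measurable lebesgue" "\<And>x. norm (w x) \<le> B"
  shows "L2 (\<lambda>x. w x * f x)"
  by (rule L2_bound[OF assms(1), of _ B])
     (use assms L2_measurable[OF assms(1)] in \<open>auto simp: norm_mult intro!: mult_right_mono\<close>)

lemma L2_bounded_mult_real:
  assumes "L2 f" "w \<in> borel_measurable lebesgue" "\<And>x. \<bar>w x\<bar> \<le> B"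
  shows "L2 (\<lambda>x. complex_of_real (w x) * f x)"
  using assms by (intro L2_bounded_mult[of f _ B]) auto

lemma L2norm_nonneg [simp]: "L2norm f \<ge> 0"
  by (simp add: L2norm_def)

lemma L2norm_power2: "(L2norm f)\<^sup>2 = (\<integral>x. (norm (f x))\<^sup>2 \<partial>lebesgue)"
  by (simp add: L2norm_def)

lemma L2norm_mono_AE:
  assumes "L2 g" "L2 f" "AE x in lebesgue. norm (f x) \<le> norm (g x)"
  shows "L2norm f \<le> L2norm g"
  unfolding L2norm_def
proof (intro real_sqrt_le_mono integral_mono_AE L2_square_integrable assms)
  show "AE x in lebesgue. (norm (f x))\<^sup>2 \<le> (norm (g x))\<^sup>2"
    using assms(3) by eventually_elim (intro power_mono, auto)
qed

lemma L2norm_mono: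
  assumes "L2 g" "L2 f" "\<And>x. norm (f x) \<le> norm (g x)"
  shows "L2norm f \<le> L2norm g"
  using assms by (intro L2norm_mono_AE) auto

lemma L2norm_cong_AE:
  assumes "L2 f" "L2 g" "AE x in lebesgue. f x = g x"
  shows "L2norm f = L2norm g"
  by (intro antisym L2norm_mono_AE) (use assms in \<open>auto elim: eventually_mono\<close>)

lemma L2norm_cmult: "L2norm (\<lambda>x. c * f x) = norm c * L2norm f"
  by (simp add: L2norm_def norm_mult power_mult_distrib real_sqrt_mult)

lemma L2norm_uminus: "L2norm (\<lambda>x. - f x) = L2norm f"
  by (simp add: L2norm_def)

lemma L2norm_minus_commute: "L2norm (\<lambda>x. f x - g x) = L2norm (\<lambda>x. g x - f x)"
  by (simp add: L2norm_def norm_minus_commute)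

lemma L2norm_cnj: "L2norm (\<lambda>x. cnj (f x)) = L2norm f"
  by (simp add: L2norm_def)

lemma L2norm_eq_0_iff:
  assumes "L2 f"
  shows "L2norm f = 0 \<longleftrightarrow> (AE x in lebesgue. f x = 0)"
  using integral_nonneg_eq_0_iff_AE[OF L2_square_integrable[OF assms]]
  by (simp add: L2norm_def)

text \<open>Cauchy-Schwarz from 2ab <= c a^2 + b^2 / c, integrated, with the free parameter c
  optimised at the end. The optimum is the ratio of the two norms, so the case of a vanishing norm
  is split off.\<close>

lemma integral_norm_mult_le:
  assumes "L2 f" "L2 g"
  shows "(\<integral>x. norm (f x) * norm (g x) \<partial>lebesgue) \<le> L2norm f * L2norm g" (is "?I \<le> ?a * ?b")
proof -
  have int: "integrable lebesgue (\<lambda>x. norm (f x) * norm (g x))"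
    by (rule L2_integrable_norm_mult[OF assms])
  have key: "2 * ?I \<le> c * ?a\<^sup>2 + ?b\<^sup>2 / c" if "c > 0" for c :: real
  proof -
    have "2 * ?I = (\<integral>x. 2 * (norm (f x) * norm (g x)) \<partial>lebesgue)" by simp
    also have "\<dots> \<le> (\<integral>x. c * (norm (f x))\<^sup>2 + (norm (g x))\<^sup>2 / c \<partial>lebesgue)"
    proof (intro integral_mono)
      fix x
      have "0 \<le> (sqrt c * norm (f x) - norm (g x) / sqrt c)\<^sup>2" by simp
      also have "\<dots> = c * (norm (f x))\<^sup>2 + (norm (g x))\<^sup>2 / c - 2 * (norm (f x) * norm (g x))"
        using that by (simp add: power2_diff power_mult_distrib power_divide)
      finally show "2 * (norm (f x) * norm (g x)) \<le> c * (norm (f x))\<^sup>2 + (norm (g x))\<^sup>2 / c" by simp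
    qed (use assms int in \<open>auto simp: L2_square_integrable\<close>)
    also have "\<dots> = c * ?a\<^sup>2 + ?b\<^sup>2 / c"
      using assms by (simp add: L2_square_integrable L2norm_power2)
    finally show ?thesis .
  qed
  show ?thesis
  proof (cases "?a = 0 \<or> ?b = 0")
    case True
    then have "AE x in lebesgue. norm (f x) * norm (g x) = 0"
    proof
      assume "?a = 0"
      then have "AE x in lebesgue. f x = 0" by (simp add: L2norm_eq_0_iff assms)
      then show ?thesis by eventually_elim simp
    next
      assume "?b = 0"
      then have "AE x in lebesgue. g x = 0" by (simp add: L2norm_eq_0_iff assms)
      then show ?thesis by eventually_elim simp
    qed
    then have "?I = 0" by (rule integral_eq_zero_AE)
    then show ?thesis by simp
  next
    case False
    then have "?a > 0" "?b > 0" using L2norm_nonneg[of f] L2norm_nonneg[of g] by linarith+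
    then show ?thesis using key[of "?b / ?a"] by (simp add: power2_eq_square field_simps)
  qed
qed

lemma norm_integral_mult_le:
  assumes "L2 f" "L2 g"
  shows "norm (\<integral>x. f x * g x \<partial>lebesgue) \<le> L2norm f * L2norm g"
proof -
  have "norm (\<integral>x. f x * g x \<partial>lebesgue) \<le> (\<integral>x. norm (f x * g x) \<partial>lebesgue)"
    by (rule integral_norm_bound)
  also have "\<dots> \<le> L2norm f * L2norm g"
    using integral_norm_mult_le[OF assms] by (simp add: norm_mult)
  finally show ?thesis .
qed

text \<open>The root of the weight is put on each factor, which reduces the weighted Cauchy-Schwarz
  inequality to the plain one.\<close>

lemma integral_weight_mult_le:
  fixes f g :: "'a::euclidean_space \<Rightarrow> complex"
  assumes "L2 f" "L2 g" "w \<in> borel_measurable lebesgue" "\<And>x. 0 \<le> w x" "\<And>x. w x \<le> B"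
  shows "integrable lebesgue (\<lambda>x. w x * (norm (f x) * norm (g x)))"
    and "(\<integral>x. w x * (norm (f x) * norm (g x)) \<partial>lebesgue)
      \<le> sqrt (\<integral>x. w x * (norm (f x))\<^sup>2 \<partial>lebesgue) * sqrt (\<integral>x. w x * (norm (g x))\<^sup>2 \<partial>lebesgue)"
proof -
  have L: "L2 (\<lambda>x. complex_of_real (sqrt (w x)) * h x)" if "L2 h" for h :: "'a \<Rightarrow> complex"
    by (rule L2_bounded_mult_real[OF that, of _ "sqrt B"]) (use assms in \<open>auto\<close>)
  have N: "L2norm (\<lambda>x. complex_of_real (sqrt (w x)) * h x) = sqrt (\<integral>x. w x * (norm (h x))\<^sup>2 \<partial>lebesgue)"
    for h :: "'a \<Rightarrow> complex"
    using assms by (simp add: L2norm_def norm_mult power_mult_distrib)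
  have e: "norm (complex_of_real (sqrt (w x)) * f x) * norm (complex_of_real (sqrt (w x)) * g x)
     = w x * (norm (f x) * norm (g x))" for x
    using assms(4)[of x] by (simp add: norm_mult)
  show "integrable lebesgue (\<lambda>x. w x * (norm (f x) * norm (g x)))"
    using L2_integrable_norm_mult[OF L[OF assms(1)] L[OF assms(2)]] by (simp only: e)
  show "(\<integral>x. w x * (norm (f x) * norm (g x)) \<partial>lebesgue)
      \<le> sqrt (\<integral>x. w x * (norm (f x))\<^sup>2 \<partial>lebesgue) * sqrt (\<integral>x. w x * (norm (g x))\<^sup>2 \<partial>lebesgue)"
    using integral_norm_mult_le[OF L[OF assms(1)] L[OF assms(2)]] by (simp only: e N)
qed

lemma L2_integrable_weight:
  assumes "L2 f" "w \<in> borel_measurable lebesgue" "\<And>x. 0 \<le> w x" "\<And>x. w x \<le> (B::real)"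
  shows "integrable lebesgue (\<lambda>x. w x * (norm (f x))\<^sup>2)"
  using integral_weight_mult_le(1)[OF assms(1) assms(1-4)] by (simp add: power2_eq_square)

lemma L2norm_triangle:
  assumes "L2 f" "L2 g"
  shows "L2norm (\<lambda>x. f x + g x) \<le> L2norm f + L2norm g"
proof (rule power2_le_imp_le)
  have "(L2norm (\<lambda>x. f x + g x))\<^sup>2 = (\<integral>x. (norm (f x + g x))\<^sup>2 \<partial>lebesgue)"
    by (simp add: L2norm_power2)
  also have "\<dots> \<le> (\<integral>x. (norm (f x))\<^sup>2 + (norm (g x))\<^sup>2 + 2 * (norm (f x) * norm (g x)) \<partial>lebesgue)"
  proof (intro integral_mono)
    fix x
    have "(norm (f x + g x))\<^sup>2 \<le> (norm (f x) + norm (g x))\<^sup>2"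
      by (intro power_mono norm_triangle_ineq) auto
    then show "(norm (f x + g x))\<^sup>2 \<le> (norm (f x))\<^sup>2 + (norm (g x))\<^sup>2 + 2 * (norm (f x) * norm (g x))"
      by (simp add: power2_sum)
  qed (use assms L2_add[OF assms] in \<open>auto simp: L2_square_integrable L2_integrable_norm_mult\<close>)
  also have "\<dots> = (L2norm f)\<^sup>2 + (L2norm g)\<^sup>2 + 2 * (\<integral>x. norm (f x) * norm (g x) \<partial>lebesgue)"
    using assms by (simp add: L2norm_power2 L2_square_integrable L2_integrable_norm_mult)
  also have "\<dots> \<le> (L2norm f)\<^sup>2 + (L2norm g)\<^sup>2 + 2 * (L2norm f * L2norm g)"
    using integral_norm_mult_le[OF assms] by simp
  also have "\<dots> = (L2norm f + L2norm g)\<^sup>2" by (simp add: power2_sum)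
  finally show "(L2norm (\<lambda>x. f x + g x))\<^sup>2 \<le> (L2norm f + L2norm g)\<^sup>2" .
qed auto

lemma L2norm_triangle_diff:
  assumes "L2 f" "L2 g" "L2 h"
  shows "L2norm (\<lambda>x. f x - h x) \<le> L2norm (\<lambda>x. f x - g x) + L2norm (\<lambda>x. g x - h x)"
  using L2norm_triangle[OF L2_diff[OF assms(1,2)] L2_diff[OF assms(2,3)]] by simp

lemma tendsto_integral_mult:
  assumes "\<And>h. L2 (F h)" "L2 f" "L2 g"
    and "((\<lambda>h. L2norm (\<lambda>x. F h x - f x)) \<longlongrightarrow> 0) net"
  shows "((\<lambda>h. \<integral>x. F h x * g x \<partial>lebesgue) \<longlongrightarrow> (\<integral>x. f x * g x \<partial>lebesgue)) net"
proof (rule LIM_zero_cancel, rule Lim_null_comparison)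
  show "((\<lambda>h. L2norm (\<lambda>x. F h x - f x) * L2norm g) \<longlongrightarrow> 0) net"
    using tendsto_mult_right[OF assms(4), of "L2norm g"] by simp
  have "norm ((\<integral>x. F h x * g x \<partial>lebesgue) - (\<integral>x. f x * g x \<partial>lebesgue))
      \<le> L2norm (\<lambda>x. F h x - f x) * L2norm g" for h
  proof -
    have "(\<integral>x. F h x * g x \<partial>lebesgue) - (\<integral>x. f x * g x \<partial>lebesgue) = (\<integral>x. (F h x - f x) * g x \<partial>lebesgue)"
      by (simp add: left_diff_distrib L2_integrable_mult assms)
    then show ?thesis
      using norm_integral_mult_le[OF L2_diff[OF assms(1)[of h] assms(2)] assms(3)] by simp
  qed
  then show "\<forall>\<^sub>F h in net. norm ((\<integral>x. F h x * g x \<partial>lebesgue) - (\<integral>x. f x * g x \<partial>lebesgue))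
      \<le> L2norm (\<lambda>x. F h x - f x) * L2norm g" by simp
qed

section \<open>Translation invariance of Lebesgue measure\<close>

lemma lebesgue_translate:
  fixes a :: "'a::euclidean_space"
  shows "distr lebesgue lebesgue ((+) a) = lebesgue" and "(+) a \<in> lebesgue \<rightarrow>\<^sub>M lebesgue"
proof -
  \<comment> \<open>Translations are read off from the affine change of variables with all scaling
    factors equal to 1.\<close>
  have e: "(\<lambda>x. a + (\<Sum>j\<in>Basis. (1 * (x \<bullet> j)) *\<^sub>R j)) = (+) a"
    by (auto simp: euclidean_representation)
  show "(+) a \<in> lebesgue \<rightarrow>\<^sub>M lebesgue"
    using lebesgue_affine_measurable[of "\<lambda>_. 1" a] by (simp only: e)
  have "lebesgue = density (distr lebesgue lebesgue ((+) a)) (\<lambda>_. 1)"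
    using lebesgue_affine_euclidean[of "\<lambda>_. 1" a] by (simp only: e) simp
  then show "distr lebesgue lebesgue ((+) a) = lebesgue" by (simp add: density_1)
qed

lemma measurable_translate [measurable (raw)]:
  fixes a :: "'a::euclidean_space"
  shows "f \<in> borel_measurable lebesgue \<Longrightarrow> (\<lambda>x. f (x + a)) \<in> borel_measurable lebesgue"
  using measurable_compose[OF lebesgue_translate(2)[of a], of f] by (simp add: add.commute)

lemma
  fixes a :: "'a::euclidean_space" and f :: "'a \<Rightarrow> 'b::{banach, second_countable_topology}"
  assumes "f \<in> borel_measurable lebesgue"
  shows integral_translate: "(\<integral>x. f (x + a) \<partial>lebesgue) = (\<integral>x. f x \<partial>lebesgue)"
    and integrable_translate: "integrable lebesgue (\<lambda>x. f (x + a)) \<longleftrightarrow> integrable lebesgue f"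
  using integral_distr[OF lebesgue_translate(2)[of a] assms] lebesgue_translate(1)[of a]
    integrable_distr_eq[OF lebesgue_translate(2)[of a] assms]
  by (auto simp: add.commute)

lemma L2_translate: "L2 f \<Longrightarrow> L2 (\<lambda>x. f (x + a))"
  using integrable_translate[of "\<lambda>x. (norm (f x))\<^sup>2" a] by (auto simp: L2_def)

lemma L2norm_translate:
  assumes "L2 f"
  shows "L2norm (\<lambda>x. f (x + a)) = L2norm f"
  using integral_translate[of "\<lambda>x. (norm (f x))\<^sup>2" a] L2_measurable[OF assms]
  by (simp add: L2norm_def)

section \<open>Density of test functions\<close>

lemma dderiv_works:
  fixes f :: "'a::real_normed_vector \<Rightarrow> 'b::real_normed_vector"
  assumes "f differentiable (at (x + s *\<^sub>R e))"
  shows "((\<lambda>h. f (x + h *\<^sub>R e)) has_vector_derivative dderiv e f (x + s *\<^sub>R e)) (at s)"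
proof -
  from assms obtain D where D: "(f has_derivative D) (at (x + s *\<^sub>R e))"
    by (auto simp: differentiable_def)
  have lin: "D (r *\<^sub>R e) = r *\<^sub>R D e" for r
    using D by (simp add: has_derivative_def bounded_linear.linear linear_cmul)
  \<comment> \<open>The same line is needed with two base points: x + s e with parameter 0
    identifies D e with \<open>dderiv\<close>, and x with parameter s gives the claim.\<close>
  have *: "((\<lambda>h. f (y + h *\<^sub>R e)) has_vector_derivative D e) (at r)"
    if "y + r *\<^sub>R e = x + s *\<^sub>R e" for y r
    unfolding has_vector_derivative_def
    by (rule has_derivative_compose[of "\<lambda>h. y + h *\<^sub>R e" "\<lambda>h. h *\<^sub>R e" r UNIV f D, unfolded lin])
       (auto intro!: derivative_eq_intros simp: that D)
  from *[of "x + s *\<^sub>R e" 0] have "dderiv e f (x + s *\<^sub>R e) = D e"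
    unfolding dderiv_def by (simp add: vector_derivative_at)
  with *[of x s] show ?thesis by simp
qed

lemma dderiv_eqI:
  assumes "(f has_derivative D) (at x)"
  shows "dderiv e f x = D e"
proof -
  have lin: "D (r *\<^sub>R e) = r *\<^sub>R D e" for r
    using assms by (simp add: has_derivative_def bounded_linear.linear linear_cmul)
  have "((\<lambda>h. f (x + h *\<^sub>R e)) has_vector_derivative D e) (at 0)"
    unfolding has_vector_derivative_def
    by (rule has_derivative_compose[of "\<lambda>h. x + h *\<^sub>R e" "\<lambda>h. h *\<^sub>R e" 0 UNIV f D, unfolded lin])
       (auto intro!: derivative_eq_intros simp: assms)
  then show ?thesis unfolding dderiv_def by (simp add: vector_derivative_at)
qed

lemma frechet_dderiv:
  "f differentiable (at x) \<Longrightarrow> (f has_derivative frechet_derivative f (at x)) (at x)"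
  "f differentiable (at x) \<Longrightarrow> dderiv e f x = frechet_derivative f (at x) e"
  by (auto simp: frechet_derivative_works intro: dderiv_eqI)

lemma dderiv_add:
  assumes "f differentiable (at x)" "g differentiable (at x)"
  shows "dderiv e (\<lambda>x. f x + g x) x = dderiv e f x + dderiv e g x"
  using dderiv_eqI[OF has_derivative_add[OF assms[THEN frechet_dderiv(1)]]]
  by (simp add: frechet_dderiv(2) assms)

lemma dderiv_mult:
  fixes f g :: "'a::real_normed_vector \<Rightarrow> 'b::real_normed_algebra"
  assumes "f differentiable (at x)" "g differentiable (at x)"
  shows "dderiv e (\<lambda>x. f x * g x) x = f x * dderiv e g x + dderiv e f x * g x"
  using dderiv_eqI[OF has_derivative_mult[OF assms[THEN frechet_dderiv(1)]]]
  by (simp add: frechet_dderiv(2) assms)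

lemma dderiv_const: "dderiv e (\<lambda>x. c) = (\<lambda>x. 0)"
  by (rule ext, rule dderiv_eqI) (rule has_derivative_const)

section \<open>Smooth bump functions on boxes\<close>

text \<open>The powers of \<open>1/x\<close> make the family closed under differentiation.\<close>
definition flat_bump :: "nat \<Rightarrow> real \<Rightarrow> real" where
  "flat_bump k x = (if x > 0 then (1 / x) ^ k * exp (- (1 / x)) else 0)"

lemma flat_bump_nonneg: "0 \<le> flat_bump k x"
  by (simp add: flat_bump_def)

lemma exp_ge_power: "0 \<le> (y::real) \<Longrightarrow> y ^ n \<le> fact n * exp y"
proof -
  assume y: "0 \<le> y"
  have "(\<Sum>i\<in>{n}. y ^ i /\<^sub>R fact i) \<le> exp y"
    unfolding exp_def by (rule sum_le_suminf[OF summable_exp_generic]) (use y in auto)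
  then show ?thesis by (simp add: divide_simps mult.commute)
qed

text \<open>With y = 1/x this is y^(k+2) <= (k+2)! e^y. A quadratic bound is what forces derivative
  0 at the origin.\<close>

lemma flat_bump_le_square: "flat_bump k x \<le> fact (k + 2) * x\<^sup>2"
proof (cases "x > 0")
  case True
  define y where "y = 1 / x"
  have y: "y > 0" using True by (simp add: y_def)
  have "y ^ (k + 2) \<le> fact (k + 2) * exp y"
    using y by (intro exp_ge_power) simp
  then have "y ^ (k + 2) * (exp (- y) * x\<^sup>2) \<le> (fact (k + 2) * exp y) * (exp (- y) * x\<^sup>2)"
    by (intro mult_right_mono) auto
  moreover have "y ^ (k + 2) * x\<^sup>2 = y ^ k"
    using True by (simp add: y_def power_divide power_add power2_eq_square)
  then have "y ^ (k + 2) * (exp (- y) * x\<^sup>2) = y ^ k * exp (- y)"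
    by (metis mult.assoc mult.commute)
  moreover have "(fact (k + 2) * exp y) * (exp (- y) * x\<^sup>2) = fact (k + 2) * x\<^sup>2"
    by (simp add: exp_minus del: fact_Suc)
  ultimately have "y ^ k * exp (- y) \<le> fact (k + 2) * x\<^sup>2" by argo
  then show ?thesis using True by (simp add: flat_bump_def y_def del: fact_Suc)
qed (simp add: flat_bump_def)

text \<open>Away from 0 the function agrees locally with an elementary expression; at 0 the
  difference quotient is squeezed to 0 by the quadratic bound.\<close>

lemma flat_bump_has_derivative:
  "(flat_bump k has_real_derivative (flat_bump (k + 2) x - real k * flat_bump (k + 1) x)) (at x)"
proof -
  consider "x > 0" | "x < 0" | "x = 0" by linarith
  then show ?thesis
  proof cases
    case 1
    have "((\<lambda>x. (1 / x) ^ k * exp (- (1 / x))) has_real_derivative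
       (real k * (1 / x) ^ (k - 1) * (- ((1 / x)\<^sup>2))) * exp (- (1 / x))
        + (exp (- (1 / x)) * (1 / x)\<^sup>2) * (1 / x) ^ k) (at x)"
      using 1 by (intro DERIV_mult) (auto intro!: derivative_eq_intros simp: power2_eq_square)
    also have "(real k * (1 / x) ^ (k - 1) * (- ((1 / x)\<^sup>2))) * exp (- (1 / x))
        + (exp (- (1 / x)) * (1 / x)\<^sup>2) * (1 / x) ^ k = flat_bump (k + 2) x - real k * flat_bump (k + 1) x"
      using 1 by (cases k) (simp_all add: flat_bump_def power2_eq_square mult_ac)
    finally have "((\<lambda>x. (1 / x) ^ k * exp (- (1 / x))) has_real_derivative
       (flat_bump (k + 2) x - real k * flat_bump (k + 1) x)) (at x)" .
    then show ?thesis
      by (rule DERIV_cong_ev[THEN iffD1, rotated -1])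
         (use 1 in \<open>auto simp: flat_bump_def eventually_nhds intro!: exI[of _ "{0<..}"]\<close>)
  next
    case 2
    have "((\<lambda>x. 0) has_real_derivative (flat_bump (k + 2) x - real k * flat_bump (k + 1) x)) (at x)"
      using 2 by (simp add: flat_bump_def)
    then show ?thesis
      by (rule DERIV_cong_ev[THEN iffD1, rotated -1])
         (use 2 in \<open>auto simp: flat_bump_def eventually_nhds intro!: exI[of _ "{..<0}"]\<close>)
  next
    case 3
    have "((\<lambda>h. (flat_bump k (0 + h) - flat_bump k 0) / h) \<longlongrightarrow> 0) (at 0)"
    proof (rule Lim_null_comparison)
      have "norm ((flat_bump k (0 + h) - flat_bump k 0) / h) \<le> fact (k + 2) * \<bar>h\<bar>" if "h \<noteq> 0" for h
        using flat_bump_le_square[of k h] flat_bump_nonneg[of k h] that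
        by (auto simp: flat_bump_def[of _ 0] divide_le_eq power2_eq_square abs_mult mult.assoc simp del: fact_Suc)
      then show "\<forall>\<^sub>F h in at 0. norm ((flat_bump k (0 + h) - flat_bump k 0) / h) \<le> fact (k + 2) * \<bar>h\<bar>"
        by (auto simp: eventually_at_filter)
      show "((\<lambda>h::real. fact (k + 2) * \<bar>h\<bar>) \<longlongrightarrow> 0) (at 0)"
        by (rule tendsto_eq_intros refl | simp)+
    qed
    then show ?thesis using 3 by (simp add: DERIV_def flat_bump_def[of _ 0])
  qed
qed

lemma flat_bump_0_tendsto: "((\<lambda>n. flat_bump 0 (real n * z)) \<longlongrightarrow> (if z > 0 then 1 else 0)) sequentially"
proof (cases "z > 0")
  case True
  have "(\<lambda>n. exp (- (1 / (real n * z)))) \<longlonglongrightarrow> exp (- 0)"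
    by (intro tendsto_intros) (use True in real_asymp)
  moreover have "\<forall>\<^sub>F n in sequentially. exp (- (1 / (real n * z))) = flat_bump 0 (real n * z)"
    using eventually_gt_at_top[of 0] by eventually_elim (use True in \<open>simp add: flat_bump_def\<close>)
  ultimately show ?thesis using True by (simp add: tendsto_cong)
next
  case False
  then have "flat_bump 0 (real n * z) = 0" for n
    by (auto simp: flat_bump_def zero_less_mult_iff)
  then show ?thesis using False by simp
qed

text \<open>Closure under coordinate derivatives makes every member smooth at once, without a
  formula for higher derivatives of the products built from \<open>flat_bump\<close>.\<close>

inductive ridge_alg :: "('a::euclidean_space \<Rightarrow> real) \<Rightarrow> bool" where
  ridge: "i \<in> Basis \<Longrightarrow> ridge_alg (\<lambda>x. flat_bump k (a + b * (x \<bullet> i)))"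
| const: "ridge_alg (\<lambda>x. c)"
| add: "ridge_alg f \<Longrightarrow> ridge_alg g \<Longrightarrow> ridge_alg (\<lambda>x. f x + g x)"
| mult: "ridge_alg f \<Longrightarrow> ridge_alg g \<Longrightarrow> ridge_alg (\<lambda>x. f x * g x)"

lemma ridge_alg_dderiv:
  assumes "ridge_alg f"
  shows "(\<forall>x. f differentiable (at x)) \<and> (\<forall>j\<in>Basis. ridge_alg (dderiv j f))"
  using assms
proof induction
  case (ridge i k a b)
  let ?f = "\<lambda>x::'a. flat_bump k (a + b * (x \<bullet> i))"
  let ?d = "\<lambda>z. flat_bump (k + 2) z + (- real k) * flat_bump (k + 1) z"
  have d: "(?f has_derivative (\<lambda>v. b * (v \<bullet> i) * ?d (a + b * (x \<bullet> i)))) (at x)" for x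
    using flat_bump_has_derivative[of k "a + b * (x \<bullet> i)", unfolded has_field_derivative_def]
    by (rule has_derivative_compose[rotated, THEN has_derivative_eq_rhs])
       (auto intro!: derivative_eq_intros)
  have "ridge_alg (dderiv j ?f)" for j :: 'a
  proof -
    have "dderiv j ?f = (\<lambda>x. (b * (j \<bullet> i)) * (flat_bump (k + 2) (a + b * (x \<bullet> i))
         + (- real k) * flat_bump (k + 1) (a + b * (x \<bullet> i))))"
      by (rule ext, rule dderiv_eqI[OF d])
    then show ?thesis using ridge by (simp only:) (intro ridge_alg.intros)
  qed
  with d show ?case by (auto simp: differentiable_def)
next
  case (const c)
  then show ?case by (auto simp: dderiv_const intro: ridge_alg.intros)
next
  case (add f g)
  then have "dderiv j (\<lambda>x. f x + g x) = (\<lambda>x. dderiv j f x + dderiv j g x)" for j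
    by (intro ext dderiv_add) auto
  with add show ?case by (auto intro!: ridge_alg.add ridge_alg.mult)
next
  case (mult f g)
  then have "dderiv j (\<lambda>x. f x * g x) = (\<lambda>x. f x * dderiv j g x + dderiv j f x * g x)" for j
    by (intro ext dderiv_mult) auto
  with mult show ?case by (auto intro!: ridge_alg.add ridge_alg.mult)
qed

lemma ridge_alg_smooth:
  assumes "ridge_alg f"
  shows "smooth_fun f"
proof -
  have "ridge_alg (iterdiff ds f)" if "ds \<in> lists Basis" for ds
    using that by induction (auto simp: assms ridge_alg_dderiv)
  then show ?thesis by (simp add: smooth_fun_def ridge_alg_dderiv)
qed

lemma ridge_alg_prod: "finite I \<Longrightarrow> (\<And>i. i \<in> I \<Longrightarrow> ridge_alg (f i)) \<Longrightarrow> ridge_alg (\<lambda>x. \<Prod>i\<in>I. f i x)"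
  by (induction I rule: finite_induct) (auto intro: ridge_alg.intros)

text \<open>Scaling the arguments by n keeps the support inside the box and lets the values tend to
  1 there, so the indicator of the box is both the limit and an integrable majorant.\<close>

definition box_bump :: "'a::euclidean_space \<Rightarrow> 'a \<Rightarrow> nat \<Rightarrow> 'a \<Rightarrow> real" where
  "box_bump l u n x = (\<Prod>i\<in>Basis. flat_bump 0 (real n * (x \<bullet> i - l \<bullet> i)) * flat_bump 0 (real n * (u \<bullet> i - x \<bullet> i)))"

lemma box_bump_eq_0:
  assumes "x \<notin> box l u"
  shows "box_bump l u n x = 0"
proof -
  from assms obtain i where i: "i \<in> Basis" "\<not> (l \<bullet> i < x \<bullet> i \<and> x \<bullet> i < u \<bullet> i)"
    by (auto simp: mem_box)
  then have "flat_bump 0 (real n * (x \<bullet> i - l \<bullet> i)) * flat_bump 0 (real n * (u \<bullet> i - x \<bullet> i)) = 0"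
    by (auto simp: flat_bump_def zero_less_mult_iff)
  then show ?thesis unfolding box_bump_def by (intro prod_zero bexI[OF _ i(1)]) auto
qed

lemma box_bump_bounds: "0 \<le> box_bump l u n x \<and> box_bump l u n x \<le> 1"
proof -
  have "0 \<le> flat_bump 0 z \<and> flat_bump 0 z \<le> 1" for z
    by (auto simp: flat_bump_def)
  then show ?thesis unfolding box_bump_def
    by (auto intro!: prod_nonneg prod_le_1 mult_nonneg_nonneg mult_le_one)
qed

lemma test_fun_box_bump: "test_fun (box_bump l u n)"
proof -
  have "ridge_alg (box_bump l u n)"
  proof -
    have "ridge_alg (\<lambda>x::'a. flat_bump 0 (real n * (x \<bullet> i - l \<bullet> i)))"
      "ridge_alg (\<lambda>x::'a. flat_bump 0 (real n * (u \<bullet> i - x \<bullet> i)))" if "i \<in> Basis" for i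
      using ridge_alg.ridge[OF that, of 0 "- real n * (l \<bullet> i)" "real n"]
        ridge_alg.ridge[OF that, of 0 "real n * (u \<bullet> i)" "- real n"]
      by (simp_all add: algebra_simps)
    then show ?thesis unfolding box_bump_def[abs_def]
      by (intro ridge_alg_prod ridge_alg.mult) auto
  qed
  moreover have "bounded {x. box_bump l u n x \<noteq> 0}"
    by (rule bounded_subset[OF bounded_box[of l u]]) (use box_bump_eq_0 in blast)
  ultimately show ?thesis by (simp add: test_fun_def ridge_alg_smooth)
qed

lemma box_bump_tendsto: "(\<lambda>n. box_bump l u n x) \<longlonglongrightarrow> indicator (box l u) x"
proof -
  have "(\<lambda>n. box_bump l u n x) \<longlonglongrightarrow>
     (\<Prod>i\<in>Basis. (if x \<bullet> i - l \<bullet> i > 0 then 1 else 0) * (if u \<bullet> i - x \<bullet> i > 0 then 1 else 0))"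
    unfolding box_bump_def by (intro tendsto_intros flat_bump_0_tendsto)
  also have "(\<Prod>i\<in>Basis. (if x \<bullet> i - l \<bullet> i > 0 then 1 else 0) * (if u \<bullet> i - x \<bullet> i > 0 then 1 else 0))
     = (indicator (box l u) x :: real)"
  proof (cases "x \<in> box l u")
    case True
    then show ?thesis by (auto simp: mem_box intro!: prod.neutral)
  next
    case False
    then obtain i where "i \<in> Basis" "\<not> (l \<bullet> i < x \<bullet> i \<and> x \<bullet> i < u \<bullet> i)" by (auto simp: mem_box)
    then have "(\<Prod>i\<in>Basis. (if x \<bullet> i - l \<bullet> i > 0 then 1 else 0) * (if u \<bullet> i - x \<bullet> i > 0 then 1 else (0::real))) = 0"
      by (intro prod_zero bexI[of _ i]) auto
    then show ?thesis using False by simp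
  qed
  finally show ?thesis .
qed

lemma test_fun_differentiable: "test_fun \<phi> \<Longrightarrow> \<phi> differentiable (at x)"
  by (auto simp: test_fun_def smooth_fun_def dest!: bspec[of _ _ "[]"])

lemma test_fun_continuous: "test_fun \<phi> \<Longrightarrow> continuous_on A \<phi>"
  by (metis test_fun_differentiable differentiable_imp_continuous_within continuous_at_imp_continuous_on)

lemma test_fun_measurable: "test_fun \<phi> \<Longrightarrow> \<phi> \<in> borel_measurable lebesgue"
  by (rule measurable_completion) (simp add: borel_measurable_continuous_onI test_fun_continuous)

lemma iterdiff_append: "iterdiff (ds @ es) f = iterdiff ds (iterdiff es f)"
  by (induction ds) auto

lemma test_fun_dderiv:
  assumes "test_fun \<phi>" "e \<in> Basis"
  shows "test_fun (dderiv e \<phi>)"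
proof -
  have "smooth_fun (dderiv e \<phi>)"
    unfolding smooth_fun_def
  proof (intro ballI allI)
    fix ds :: "'a list" and x assume "ds \<in> lists Basis"
    then have "ds @ [e] \<in> lists Basis" using assms by auto
    then show "iterdiff ds (dderiv e \<phi>) differentiable (at x)"
      using assms(1) iterdiff_append[of ds "[e]" \<phi>] by (metis iterdiff.simps smooth_fun_def test_fun_def)
  qed
  moreover have "bounded {x. dderiv e \<phi> x \<noteq> 0}"
  proof (rule bounded_subset)
    show "bounded (closure {x. \<phi> x \<noteq> 0})" using assms(1) by (simp add: test_fun_def bounded_closure)
    \<comment> \<open>Off the closure of the support the function vanishes in a whole neighbourhood,
      so its derivative vanishes as well.\<close>
    show "{x. dderiv e \<phi> x \<noteq> 0} \<subseteq> closure {x. \<phi> x \<noteq> 0}"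
    proof (rule ccontr)
      assume "\<not> ?thesis"
      then obtain x where x: "dderiv e \<phi> x \<noteq> 0" "x \<notin> closure {x. \<phi> x \<noteq> 0}" by auto
      have "(\<phi> has_derivative (\<lambda>_. 0)) (at x)"
      proof (rule has_derivative_transform_within_open[OF has_derivative_const[of 0]])
        show "open (- closure {x. \<phi> x \<noteq> 0})" by auto
        show "0 = \<phi> y" if "y \<in> - closure {x. \<phi> x \<noteq> 0}" for y
          using that closure_subset[of "{x. \<phi> x \<noteq> 0}"] by auto
      qed (use x in auto)
      then show False using x dderiv_eqI[of \<phi> "\<lambda>_. 0" x e] by simp
    qed
  qed
  ultimately show ?thesis by (simp add: test_fun_def)
qed

lemma test_fun_bounded:
  assumes "test_fun \<phi>"
  obtains B where "B > 0" "\<And>x. \<bar>\<phi> x\<bar> \<le> B"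
proof -
  let ?S = "closure {x. \<phi> x \<noteq> 0}"
  have "compact (\<phi> ` ?S)"
    using assms by (intro compact_continuous_image test_fun_continuous) (auto simp: test_fun_def compact_closure)
  then obtain B where B: "B > 0" "\<And>x. x \<in> ?S \<Longrightarrow> \<bar>\<phi> x\<bar> \<le> B"
    using compact_imp_bounded bounded_pos[of "\<phi> ` ?S"] by auto
  show thesis
  proof (rule that[OF B(1)])
    show "\<bar>\<phi> x\<bar> \<le> B" for x
      using B closure_subset[of "{x. \<phi> x \<noteq> 0}"] by (cases "\<phi> x = 0") auto
  qed
qed

lemma L2_bounded_support:
  fixes f :: "'a::euclidean_space \<Rightarrow> complex"
  assumes "f \<in> borel_measurable lebesgue" "\<And>x. x \<notin> cball 0 R \<Longrightarrow> f x = 0" "\<And>x. norm (f x) \<le> B"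
  shows "L2 f" and "L2norm f \<le> B * sqrt (measure lebesgue (cball (0::'a) R))"
proof -
  have B: "B \<ge> 0" using assms(3)[of 0] norm_ge_zero order_trans by blast
  have int: "integrable lebesgue (indicator (cball 0 R) :: 'a \<Rightarrow> real)"
    using lmeasurable_cball lmeasurable_iff_integrable by blast
  have le: "(norm (f x))\<^sup>2 \<le> B\<^sup>2 * indicator (cball 0 R) x" for x
    using assms(2)[of x] assms(3)[of x] by (auto simp: indicator_def intro!: power_mono)
  have sq: "integrable lebesgue (\<lambda>x. (norm (f x))\<^sup>2)"
  proof (rule Bochner_Integration.integrable_bound[OF integrable_mult_right[OF int, of "B\<^sup>2"]])
    show "(\<lambda>x. (norm (f x))\<^sup>2) \<in> borel_measurable lebesgue" using assms(1) by measurable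
  qed (use le in auto)
  with assms(1) show "L2 f" by (simp add: L2_def)
  have "(\<integral>x. (norm (f x))\<^sup>2 \<partial>lebesgue) \<le> (\<integral>x. B\<^sup>2 * indicator (cball (0::'a) R) x \<partial>lebesgue)"
    by (intro integral_mono sq le) (use int in simp)
  also have "\<dots> = B\<^sup>2 * measure lebesgue (cball (0::'a) R)" by simp
  finally show "L2norm f \<le> B * sqrt (measure lebesgue (cball (0::'a) R))"
    unfolding L2norm_def using B by (metis real_sqrt_le_mono real_sqrt_mult real_sqrt_abs abs_of_nonneg)
qed

lemma test_fun_L2:
  assumes "test_fun \<phi>"
  shows "L2 (\<lambda>x. complex_of_real (\<phi> x))"
proof -
  obtain B where B: "\<And>x. \<bar>\<phi> x\<bar> \<le> B" using test_fun_bounded[OF assms] by blast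
  obtain R where R: "\<And>x. \<phi> x \<noteq> 0 \<Longrightarrow> norm x \<le> R"
    using assms unfolding test_fun_def bounded_iff by auto
  show ?thesis
  proof (rule L2_bounded_support)
    show "(\<lambda>x. complex_of_real (\<phi> x)) \<in> borel_measurable lebesgue"
      using test_fun_measurable[OF assms] by measurable
  qed (use B R in auto)
qed

text \<open>Dominated convergence in norm: the limit inherits the majorant, so the squared
  difference is at most 4 |g|^2.\<close>

lemma L2norm_dominated:
  fixes s :: "nat \<Rightarrow> 'a::euclidean_space \<Rightarrow> complex"
  assumes s: "\<And>n. s n \<in> borel_measurable lebesgue" and f: "f \<in> borel_measurable lebesgue" and g: "L2 g"
    and lim: "\<And>x. (\<lambda>n. s n x) \<longlonglongrightarrow> f x"
    and dom: "\<And>n x. norm (s n x) \<le> norm (g x)"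
  shows "(\<lambda>n. L2norm (\<lambda>x. f x - s n x)) \<longlonglongrightarrow> 0"
proof -
  have fg: "norm (f x) \<le> norm (g x)" for x
    by (rule LIMSEQ_le_const2[OF tendsto_norm[OF lim]]) (use dom in auto)
  have "(\<lambda>n. \<integral>x. (norm (f x - s n x))\<^sup>2 \<partial>lebesgue) \<longlonglongrightarrow> integral\<^sup>L lebesgue (\<lambda>x::'a. 0::real)"
  proof (rule integral_dominated_convergence)
    show "integrable lebesgue (\<lambda>x. 4 * (norm (g x))\<^sup>2)" using L2_square_integrable[OF g] by simp
    show "(\<lambda>x. (norm (f x - s n x))\<^sup>2) \<in> borel_measurable lebesgue" for n
      using s[of n] f by measurable
    have "(\<lambda>n. (norm (f x - s n x))\<^sup>2) \<longlonglongrightarrow> (norm (f x - f x))\<^sup>2" for x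
      by (intro tendsto_intros lim)
    then show "AE x in lebesgue. (\<lambda>n. (norm (f x - s n x))\<^sup>2) \<longlonglongrightarrow> 0" by simp
    have "(norm (f x - s n x))\<^sup>2 \<le> (2 * norm (g x))\<^sup>2" for n x
      using norm_triangle_ineq4[of "f x" "s n x"] fg[of x] dom[of n x] by (intro power_mono) auto
    then show "AE x in lebesgue. norm ((norm (f x - s n x))\<^sup>2) \<le> 4 * (norm (g x))\<^sup>2" for n
      by (simp add: power_mult_distrib)
  qed auto
  from tendsto_real_sqrt[OF this] show ?thesis by (simp add: L2norm_def)
qed

section \<open>Approximation in norm, from boxes to all of L2\<close>

inductive test_span :: "('a::euclidean_space \<Rightarrow> complex) \<Rightarrow> bool" where
  test: "test_fun \<phi> \<Longrightarrow> test_span (\<lambda>x. complex_of_real (\<phi> x))"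
| scale: "test_span f \<Longrightarrow> test_span (\<lambda>x. c * f x)"
| add: "test_span f \<Longrightarrow> test_span g \<Longrightarrow> test_span (\<lambda>x. f x + g x)"

lemma test_span_L2: "test_span f \<Longrightarrow> L2 f"
  by (induction rule: test_span.induct) (auto intro: test_fun_L2 L2_cmult L2_add)

text \<open>Membership in the closure of \<open>test_span\<close>, whose complex scalars compensate
  for test functions being real. As a predicate it can be carried through the measure-theoretic
  induction over boxes, Borel sets, Lebesgue sets, simple functions and their limits.\<close>

definition test_approx :: "('a::euclidean_space \<Rightarrow> complex) \<Rightarrow> bool" where
  "test_approx f \<longleftrightarrow> L2 f \<and> (\<forall>\<epsilon>>0. \<exists>\<psi>. test_span \<psi> \<and> L2norm (\<lambda>x. f x - \<psi> x) < \<epsilon>)"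

lemma test_approx_add:
  assumes "test_approx f" "test_approx g"
  shows "test_approx (\<lambda>x. f x + g x)"
  unfolding test_approx_def
proof (intro conjI allI impI)
  show "L2 (\<lambda>x. f x + g x)" using assms by (auto simp: test_approx_def intro: L2_add)
  fix \<epsilon> :: real assume "\<epsilon> > 0"
  then obtain a b where a: "test_span a" "L2norm (\<lambda>x. f x - a x) < \<epsilon> / 2"
    and b: "test_span b" "L2norm (\<lambda>x. g x - b x) < \<epsilon> / 2"
    using assms unfolding test_approx_def by (meson half_gt_zero)
  have "L2norm (\<lambda>x. (f x - a x) + (g x - b x)) < \<epsilon>"
    using L2norm_triangle[OF L2_diff[OF _ test_span_L2[OF a(1)], of f] L2_diff[OF _ test_span_L2[OF b(1)], of g]]
      a b assms by (simp add: test_approx_def)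
  then show "\<exists>\<psi>. test_span \<psi> \<and> L2norm (\<lambda>x. f x + g x - \<psi> x) < \<epsilon>"
    using a b by (intro exI[of _ "\<lambda>x. a x + b x"]) (auto simp: algebra_simps intro: test_span.add)
qed

lemma test_approx_scale:
  assumes "test_approx f"
  shows "test_approx (\<lambda>x. c * f x)"
  unfolding test_approx_def
proof (intro conjI allI impI)
  show "L2 (\<lambda>x. c * f x)" using assms by (auto simp: test_approx_def intro: L2_cmult)
  fix \<epsilon> :: real assume "\<epsilon> > 0"
  then have "\<epsilon> / (norm c + 1) > 0" by (simp add: add_nonneg_pos)
  then obtain a where a: "test_span a" "L2norm (\<lambda>x. f x - a x) < \<epsilon> / (norm c + 1)"
    using assms unfolding test_approx_def by meson
  have "L2norm (\<lambda>x. c * (f x - a x)) = norm c * L2norm (\<lambda>x. f x - a x)"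
    by (rule L2norm_cmult)
  also have "\<dots> \<le> (norm c + 1) * L2norm (\<lambda>x. f x - a x)" by (simp add: algebra_simps)
  also have "\<dots> < \<epsilon>" using a(2) by (simp add: pos_less_divide_eq add_nonneg_pos mult.commute)
  finally show "\<exists>\<psi>. test_span \<psi> \<and> L2norm (\<lambda>x. c * f x - \<psi> x) < \<epsilon>"
    using a by (intro exI[of _ "\<lambda>x. c * a x"]) (auto simp: algebra_simps intro: test_span.scale)
qed

lemma test_approx_limit:
  assumes "L2 f" "\<And>n. test_approx (s n)" "(\<lambda>n. L2norm (\<lambda>x. f x - s n x)) \<longlonglongrightarrow> 0"
  shows "test_approx f"
  unfolding test_approx_def
proof (intro conjI allI impI assms(1))
  fix \<epsilon> :: real assume "\<epsilon> > 0"
  then have "\<forall>\<^sub>F n in sequentially. L2norm (\<lambda>x. f x - s n x) < \<epsilon> / 2"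
    by (intro order_tendstoD(2)[OF assms(3)]) auto
  then obtain n where n: "L2norm (\<lambda>x. f x - s n x) < \<epsilon> / 2"
    by (auto simp: eventually_sequentially)
  obtain a where a: "test_span a" "L2norm (\<lambda>x. s n x - a x) < \<epsilon> / 2"
    using assms(2)[of n] \<open>\<epsilon> > 0\<close> unfolding test_approx_def by (meson half_gt_zero)
  have "L2norm (\<lambda>x. f x - a x) < \<epsilon>"
    using L2norm_triangle_diff[OF assms(1) _ test_span_L2[OF a(1)], of "s n"] n a assms(2)[of n]
    by (auto simp: test_approx_def)
  with a show "\<exists>\<psi>. test_span \<psi> \<and> L2norm (\<lambda>x. f x - \<psi> x) < \<epsilon>" by blast
qed

text \<open>The limit principle behind most steps of the induction: the majorant gives both that the
  limit is square-integrable and that the convergence holds in norm.\<close>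

lemma test_approx_dominated:
  assumes "\<And>n. test_approx (s n)" "f \<in> borel_measurable lebesgue" "L2 g"
    "\<And>x. (\<lambda>n. s n x) \<longlonglongrightarrow> f x" "\<And>n x. norm (s n x) \<le> norm (g x)"
  shows "test_approx f"
proof (rule test_approx_limit[OF _ assms(1)])
  have fg: "norm (f x) \<le> norm (g x)" for x
    by (rule LIMSEQ_le_const2[OF tendsto_norm[OF assms(4)]]) (use assms(5) in auto)
  then show "L2 f" by (intro L2_bound[OF assms(3,2), of 1]) auto
  show "(\<lambda>n. L2norm (\<lambda>x. f x - s n x)) \<longlonglongrightarrow> 0"
    by (rule L2norm_dominated[OF _ assms(2-5)])
       (use assms(1) in \<open>auto simp: test_approx_def L2_measurable\<close>)
qed

lemma test_approx_span: "test_span f \<Longrightarrow> test_approx f"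
  unfolding test_approx_def
  by (auto simp: test_span_L2 L2norm_def intro!: exI[of _ f])

lemma test_approx_zero: "test_approx (\<lambda>x::'a::euclidean_space. 0)"
  using test_approx_scale[OF test_approx_span[OF test_span.test[OF test_fun_box_bump]], of 0] by simp

lemma test_approx_sum:
  "(\<And>i. i \<in> I \<Longrightarrow> test_approx (f i)) \<Longrightarrow> test_approx (\<lambda>x. \<Sum>i\<in>I. f i x)"
  by (induction I rule: infinite_finite_induct) (auto intro: test_approx_add test_approx_zero)

lemma indicator_L2:
  assumes "A \<in> sets lebesgue" "emeasure lebesgue A < \<infinity>"
  shows "L2 (\<lambda>x. complex_of_real (indicator A x))"
proof -
  have e: "(norm (complex_of_real (indicator A x)))\<^sup>2 = indicator A x" for x
    by (simp add: indicator_def)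
  show ?thesis unfolding L2_def e
    using assms by (auto intro!: integrable_real_indicator)
qed

lemma L2_indicator_cball: "L2 (\<lambda>x. complex_of_real (B * indicator (cball a r) x))"
proof -
  have "emeasure lebesgue (cball a r) < \<infinity>"
    using fmeasurableD2[OF lmeasurable_cball] by (simp add: less_top)
  then have "L2 (\<lambda>x. complex_of_real B * complex_of_real (indicator (cball a r) x))"
    by (intro L2_cmult indicator_L2) auto
  then show ?thesis by simp
qed

lemma test_approx_box: "test_approx (\<lambda>x. complex_of_real (indicator (box l u) x))"
proof (rule test_approx_dominated[where s = "\<lambda>n x. complex_of_real (box_bump l u n x)"])
  show "test_approx (\<lambda>x. complex_of_real (box_bump l u n x))" for n
    by (intro test_approx_span test_span.test test_fun_box_bump)
  show L: "L2 (\<lambda>x. complex_of_real (indicator (box l u) x))"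
    by (rule indicator_L2) (use emeasure_lborel_box_finite[of l u] in auto)
  from L2_measurable[OF L] show "(\<lambda>x. complex_of_real (indicator (box l u) x)) \<in> borel_measurable lebesgue" .
  show "(\<lambda>n. complex_of_real (box_bump l u n x)) \<longlonglongrightarrow> complex_of_real (indicator (box l u) x)" for x
    by (intro tendsto_of_real box_bump_tendsto)
  show "norm (complex_of_real (box_bump l u n x)) \<le> norm (complex_of_real (indicator (box l u) x))" for n x
    using box_bump_bounds[of l u n x] box_bump_eq_0[of x l u n] by (auto simp: indicator_def)
qed

text \<open>Dynkin's argument over the intersection-stable family of boxes. Cutting with a fixed box
  keeps complements of finite measure and supplies the majorant for countable disjoint
  unions.\<close>

lemma test_approx_borel_inter_box:
  fixes A :: "'a::euclidean_space set"
  assumes "A \<in> sets borel"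
  shows "test_approx (\<lambda>x. complex_of_real (indicator (A \<inter> box l u) x))"
proof -
  let ?G = "range (\<lambda>(a, b). box a b :: 'a set)"
  have "Int_stable ?G" by (auto simp: Int_stable_def box_Int_box)
  moreover have "?G \<subseteq> Pow UNIV" by simp
  moreover have "A \<in> sigma_sets UNIV ?G"
    using assms by (simp add: borel_eq_box sets_measure_of)
  ultimately show ?thesis
  proof (induction A rule: sigma_sets_induct_disjoint[consumes 3])
    case (basic A)
    then show ?case by (auto simp: box_Int_box intro: test_approx_box)
  next
    case empty
    then show ?case by (simp add: test_approx_zero)
  next
    case (compl A)
    have "complex_of_real (indicator ((UNIV - A) \<inter> box l u) x)
      = complex_of_real (indicator (box l u) x) + (-1) * complex_of_real (indicator (A \<inter> box l u) x)" for x
      by (simp add: indicator_def)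
    then show ?case
      using test_approx_add[OF test_approx_box test_approx_scale[OF compl(2), of "-1"]] by simp
  next
    case (union A)
    have m: "A i \<in> sets borel" for i
      using union by (auto simp: borel_eq_box sets_measure_of)
    show ?case
    proof (rule test_approx_dominated[where s = "\<lambda>n x. \<Sum>i<n. complex_of_real (indicator (A i \<inter> box l u) x)"])
      show "test_approx (\<lambda>x. \<Sum>i<n. complex_of_real (indicator (A i \<inter> box l u) x))" for n
        by (intro test_approx_sum union)
      show "L2 (\<lambda>x. complex_of_real (indicator (box l u) x))"
        using test_approx_box[of l u] by (simp add: test_approx_def)
      have "(\<lambda>x. indicator ((\<Union>i. A i) \<inter> box l u) x :: real) \<in> borel_measurable lebesgue"
        using m by (intro borel_measurable_indicator) auto
      then show "(\<lambda>x. complex_of_real (indicator ((\<Union>i. A i) \<inter> box l u) x)) \<in> borel_measurable lebesgue"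
        by measurable
      \<comment> \<open>Disjointness turns the sum of indicators into the indicator of a partial
        union, so it stays below the indicator of the box.\<close>
      have e: "(\<Sum>i<n. complex_of_real (indicator (A i \<inter> box l u) x))
          = complex_of_real (indicator ((\<Union>i<n. A i) \<inter> box l u) x)" for n x
      proof -
        have "(\<Sum>i<n. indicator (A i \<inter> box l u) x) = (indicator (\<Union>i<n. A i \<inter> box l u) x :: real)"
          using union(1) by (intro indicator_UN_disjoint[symmetric]) (auto simp: disjoint_family_on_def)
        also have "(\<Union>i<n. A i \<inter> box l u) = (\<Union>i<n. A i) \<inter> box l u" by auto
        finally show ?thesis by (simp flip: of_real_sum)
      qed
      show "norm (\<Sum>i<n. complex_of_real (indicator (A i \<inter> box l u) x))
        \<le> norm (complex_of_real (indicator (box l u) x))" for n x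
        unfolding e by (simp add: indicator_def)
      show "(\<lambda>n. \<Sum>i<n. complex_of_real (indicator (A i \<inter> box l u) x))
         \<longlonglongrightarrow> complex_of_real (indicator ((\<Union>i. A i) \<inter> box l u) x)" for x
      proof -
        have "(\<lambda>n. indicator ((\<Union>i<n. A i) \<inter> box l u) x :: real) \<longlonglongrightarrow> indicator (\<Union>n. (\<Union>i<n. A i) \<inter> box l u) x"
          by (intro LIMSEQ_indicator_incseq) (force simp: incseq_def)
        moreover have "(\<Union>n. (\<Union>i<n. A i) \<inter> box l u) = (\<Union>i. A i) \<inter> box l u" by auto
        ultimately show ?thesis unfolding e by (simp add: tendsto_of_real)
      qed
    qed
  qed
qed

lemma test_approx_indicator:
  fixes A :: "'a::euclidean_space set"
  assumes A: "A \<in> sets lebesgue" "emeasure lebesgue A < \<infinity>"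
  shows "test_approx (\<lambda>x. complex_of_real (indicator A x))"
proof -
  \<comment> \<open>A Lebesgue set is a Borel set up to a null set. The Borel part is exhausted by
    growing boxes, and the null part does not affect the norm.\<close>
  from A(1) obtain S N N' where SN: "A = S \<union> N" "N \<subseteq> N'" "N' \<in> null_sets lborel" "S \<in> sets lborel"
    by (rule sets_completionE)
  have fin: "emeasure lebesgue S < \<infinity>"
    using A SN by (metis Un_upper1 emeasure_mono order_le_less_trans)
  have bm: "S \<in> sets lebesgue" using SN by simp
  have "test_approx (\<lambda>x. complex_of_real (indicator S x))"
  proof (rule test_approx_dominated[where s = "\<lambda>n x. complex_of_real (indicator (S \<inter> box (- real n *\<^sub>R One) (real n *\<^sub>R One)) x)"])
    show "test_approx (\<lambda>x. complex_of_real (indicator (S \<inter> box (- real n *\<^sub>R One) (real n *\<^sub>R One)) x))" for n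
      using SN by (intro test_approx_borel_inter_box) simp
    show L: "L2 (\<lambda>x. complex_of_real (indicator S x))" by (rule indicator_L2[OF bm fin])
    from L2_measurable[OF L] show "(\<lambda>x. complex_of_real (indicator S x)) \<in> borel_measurable lebesgue" .
    fix x :: 'a
    show "norm (complex_of_real (indicator (S \<inter> box (- real n *\<^sub>R One) (real n *\<^sub>R One)) x))
       \<le> norm (complex_of_real (indicator S x))" for n by (simp add: indicator_def)
    obtain m :: nat where m: "norm x < real m" using reals_Archimedean2 by blast
    have "x \<in> box (- real n *\<^sub>R One) (real n *\<^sub>R One)" if "n \<ge> m" for n
      using m that Basis_le_norm[of _ x] by (force simp: mem_box abs_le_iff)
    then have "\<forall>\<^sub>F n in sequentially. complex_of_real (indicator (S \<inter> box (- real n *\<^sub>R One) (real n *\<^sub>R One)) x)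
        = complex_of_real (indicator S x)"
      by (auto simp: eventually_sequentially indicator_def)
    then show "(\<lambda>n. complex_of_real (indicator (S \<inter> box (- real n *\<^sub>R One) (real n *\<^sub>R One)) x))
        \<longlonglongrightarrow> complex_of_real (indicator S x)"
      by (rule tendsto_eventually)
  qed
  then show ?thesis
  proof (rule test_approx_limit[OF indicator_L2[OF A]])
    have "AE x in lebesgue. x \<notin> N'" using SN(3) by (intro AE_not_in) (simp add: null_sets_completionI)
    then have "AE x in lebesgue. complex_of_real (indicator A x) - complex_of_real (indicator S x) = 0"
      by eventually_elim (use SN in \<open>auto simp: indicator_def\<close>)
    then have "L2norm (\<lambda>x. complex_of_real (indicator A x) - complex_of_real (indicator S x)) = 0"
      using L2norm_eq_0_iff[OF L2_diff[OF indicator_L2[OF A] indicator_L2[OF bm fin]]] by blast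
    then show "(\<lambda>n. L2norm (\<lambda>x. complex_of_real (indicator A x) - complex_of_real (indicator S x))) \<longlonglongrightarrow> 0"
      by simp
  qed
qed

lemma L2_test_approx:
  assumes "L2 f"
  shows "test_approx f"
proof -
  obtain s where s: "\<And>i. simple_function lebesgue (s i)" "\<And>x. (\<lambda>i. s i x) \<longlonglongrightarrow> f x"
    "\<And>i x. norm (s i x) \<le> 2 * norm (f x)"
    using borel_measurable_implies_sequence_metric[OF L2_measurable[OF assms], of 0] by auto
  have Ls: "L2 (s i)" for i
    by (rule L2_bound[OF assms borel_measurable_simple_function[OF s(1)], of i 2]) (use s in auto)
  show ?thesis
  proof (rule test_approx_dominated[where s = s, OF _ L2_measurable[OF assms] L2_cmult[OF assms, of 2]])
    show "(\<lambda>n. s n x) \<longlonglongrightarrow> f x" for x by (rule s)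
    show "norm (s n x) \<le> norm (2 * f x)" for n x using s(3)[of n x] by (simp add: norm_mult)
    fix n
    have rep: "s n x = (\<Sum>y\<in>range (s n). y * complex_of_real (indicator (s n -` {y}) x))" for x
    proof -
      have "(\<Sum>y\<in>range (s n). y * complex_of_real (indicator (s n -` {y}) x))
        = (\<Sum>y\<in>range (s n). if y = s n x then y else 0)"
        by (intro sum.cong) (auto simp: indicator_def)
      then show ?thesis using simple_functionD(1)[OF s(1)[of n]] by simp
    qed
    \<comment> \<open>The level set of a nonzero value has finite measure by Chebyshev's inequality;
      the level set of 0 may have infinite measure but contributes nothing to the sum.\<close>
    have "test_approx (\<lambda>x. y * complex_of_real (indicator (s n -` {y}) x))" for y
    proof (cases "y = 0")
      case True
      then show ?thesis by (simp add: test_approx_zero)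
    next
      case False
      have m: "s n -` {y} \<in> sets lebesgue" using simple_functionD(2)[OF s(1)[of n], of "{y}"] by simp
      have "integrable lebesgue (\<lambda>x. indicator (s n -` {y}) x :: real)"
      proof (rule Bochner_Integration.integrable_bound)
        show "integrable lebesgue (\<lambda>x. (norm (s n x))\<^sup>2 / (norm y)\<^sup>2)"
          using L2_square_integrable[OF Ls[of n]] by simp
        show "AE x in lebesgue. norm (indicator (s n -` {y}) x :: real) \<le> norm ((norm (s n x))\<^sup>2 / (norm y)\<^sup>2)"
          using False by (auto simp: indicator_def)
      qed (use m in auto)
      then have "emeasure lebesgue (s n -` {y}) < \<infinity>" using m by (simp add: integrable_indicator_iff)
      from test_approx_scale[OF test_approx_indicator[OF m this]] show ?thesis .
    qed
    then have "test_approx (\<lambda>x. \<Sum>y\<in>range (s n). y * complex_of_real (indicator (s n -` {y}) x))"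
      by (rule test_approx_sum)
    then show "test_approx (s n)" unfolding rep[symmetric] by simp
  qed
qed

lemma L2_test_span_dense:
  assumes "L2 f" "\<epsilon> > 0"
  obtains \<psi> where "test_span \<psi>" "L2norm (\<lambda>x. f x - \<psi> x) < \<epsilon>"
  using L2_test_approx[OF assms(1)] assms(2) unfolding test_approx_def by blast

section \<open>Weak derivatives and integration by parts\<close>

lemma has_vector_derivative_bound:
  fixes f :: "real \<Rightarrow> 'b::real_normed_vector"
  assumes "\<And>s. s \<in> closed_segment a b \<Longrightarrow> (f has_vector_derivative f' s) (at s)"
    and "\<And>s. s \<in> closed_segment a b \<Longrightarrow> norm (f' s) \<le> B"
  shows "norm (f b - f a) \<le> B * \<bar>b - a\<bar>"
proof -
  have "norm (f b - f a) \<le> B * norm (b - a)"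
  proof (rule differentiable_bound[of "closed_segment a b" f "\<lambda>s h. h *\<^sub>R f' s"])
    show "(f has_derivative (\<lambda>h. h *\<^sub>R f' s)) (at s within closed_segment a b)"
      if "s \<in> closed_segment a b" for s
      using assms(1)[OF that] by (auto simp: has_vector_derivative_def intro: has_derivative_at_withinI)
    show "onorm (\<lambda>h. h *\<^sub>R f' s) \<le> B" if "s \<in> closed_segment a b" for s
      using onorm_scaleR_left[of "\<lambda>h::real. h" "f' s"] assms(2)[OF that] by (simp add: onorm_id)
  qed auto
  then show ?thesis by simp
qed

lemma has_vector_derivative_quotient_iff:
  fixes f :: "real \<Rightarrow> 'b::real_normed_vector"
  shows "(f has_vector_derivative D) (at s) \<longleftrightarrow> ((\<lambda>h. (f (s + h) - f s) /\<^sub>R h) \<longlongrightarrow> D) (at 0)"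
proof -
  have "norm (f (s + h) - f s - h *\<^sub>R D) / norm h = norm ((f (s + h) - f s) /\<^sub>R h - D)" if "h \<noteq> 0" for h
  proof -
    have "(f (s + h) - f s) /\<^sub>R h - D = (f (s + h) - f s - h *\<^sub>R D) /\<^sub>R h"
      using that by (simp add: scaleR_diff_right)
    then show ?thesis by (simp add: divide_inverse mult.commute)
  qed
  then have "((\<lambda>h. norm (f (s + h) - f s - h *\<^sub>R D) / norm h) \<longlongrightarrow> 0) (at 0)
    \<longleftrightarrow> ((\<lambda>h. norm ((f (s + h) - f s) /\<^sub>R h - D)) \<longlongrightarrow> 0) (at 0)"
    by (intro tendsto_cong) (auto simp: eventually_at_filter)
  then show ?thesis
    by (simp add: has_vector_derivative_def has_derivative_at bounded_linear_scaleR_left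
      tendsto_norm_zero_iff LIM_zero_iff)
qed

lemma directional_lipschitz:
  fixes F :: "'a::real_normed_vector \<Rightarrow> 'b::real_normed_vector"
  assumes d: "\<And>x. ((\<lambda>h. F (x + h *\<^sub>R e)) has_vector_derivative F' x) (at 0)"
    and b: "\<And>x. norm (F' x) \<le> B"
  shows "norm (F (x + h *\<^sub>R e) - F x) \<le> B * \<bar>h\<bar>"
proof -
  have "((\<lambda>h. F (x + h *\<^sub>R e)) has_vector_derivative F' (x + s *\<^sub>R e)) (at s)" for s
  proof -
    \<comment> \<open>The hypothesis differentiates at h = 0 only, but from every base point;
      re-basing at x + s e yields the derivative at s.\<close>
    have "((\<lambda>h. F ((x + s *\<^sub>R e) + h *\<^sub>R e)) has_vector_derivative F' (x + s *\<^sub>R e)) (at (s - s))"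
      using d[of "x + s *\<^sub>R e"] by simp
    then have "((\<lambda>h. F ((x + s *\<^sub>R e) + (h - s) *\<^sub>R e)) has_vector_derivative 1 *\<^sub>R F' (x + s *\<^sub>R e)) (at s)"
      by (intro vector_diff_chain_at[of "\<lambda>h. h - s" 1 s, unfolded o_def])
         (auto intro!: derivative_eq_intros)
    then show ?thesis by (simp add: algebra_simps)
  qed
  from has_vector_derivative_bound[of 0 h, OF this b] show ?thesis by simp
qed

section \<open>Difference quotients of test functions\<close>

lemma test_fun_translate:
  assumes "test_fun \<phi>"
  shows "iterdiff ds (\<lambda>x. \<phi> (x + a)) = (\<lambda>x. iterdiff ds \<phi> (x + a))" and "test_fun (\<lambda>x. \<phi> (x + a))"
proof -
  have dd: "dderiv e (\<lambda>x. f (x + a)) = (\<lambda>x. dderiv e f (x + a))" for e and f :: "'a \<Rightarrow> real"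
    by (rule ext) (simp add: dderiv_def add_ac)
  show it: "iterdiff ds (\<lambda>x. \<phi> (x + a)) = (\<lambda>x. iterdiff ds \<phi> (x + a))" for ds
    by (induction ds) (auto simp: dd)
  have "smooth_fun (\<lambda>x. \<phi> (x + a))"
    unfolding smooth_fun_def it
  proof (intro ballI allI)
    fix ds :: "'a list" and x assume "ds \<in> lists Basis"
    then have "iterdiff ds \<phi> differentiable (at (x + a))"
      using assms by (auto simp: test_fun_def smooth_fun_def)
    then show "(\<lambda>x. iterdiff ds \<phi> (x + a)) differentiable (at x)"
      by (intro differentiable_compose[of "iterdiff ds \<phi>" "\<lambda>x. x + a" x UNIV]) auto
  qed
  moreover have "{x. \<phi> (x + a) \<noteq> 0} = (\<lambda>x. x - a) ` {x. \<phi> x \<noteq> 0}"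
    by (force simp: image_iff)
  then have "bounded {x. \<phi> (x + a) \<noteq> 0}"
    using assms by (simp add: test_fun_def bounded_translation_minus)
  ultimately show "test_fun (\<lambda>x. \<phi> (x + a))" by (simp add: test_fun_def)
qed

lemma test_fun_directional:
  assumes "test_fun \<phi>"
  shows "((\<lambda>h. \<phi> (x + h *\<^sub>R e)) has_vector_derivative dderiv e \<phi> x) (at 0)"
  using dderiv_works[of \<phi> x 0 e] test_fun_differentiable[OF assms] by simp

lemma test_fun_support:
  assumes "test_fun \<phi>"
  obtains R where "\<And>x. \<phi> x \<noteq> 0 \<Longrightarrow> norm x \<le> R"
proof -
  from assms obtain R where "\<forall>x\<in>{x. \<phi> x \<noteq> 0}. norm x \<le> R"
    unfolding test_fun_def bounded_iff by blast
  then show thesis by (intro that[of R]) blast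
qed

lemma difference_quotient_tendsto:
  fixes F :: "'a::real_normed_vector \<Rightarrow> real"
  assumes "((\<lambda>h. F (x + h *\<^sub>R e)) has_vector_derivative D) (at 0)"
  shows "((\<lambda>h. (F (x + h *\<^sub>R e) - F x) / h) \<longlongrightarrow> D) (at 0)"
  using assms by (simp add: has_real_derivative_iff_has_vector_derivative[symmetric] DERIV_def)

lemma test_fun_quotient_L2:
  fixes \<phi> :: "'a::euclidean_space \<Rightarrow> real"
  assumes \<phi>: "test_fun \<phi>" and e: "e \<in> Basis"
  shows "((\<lambda>h. L2norm (\<lambda>x. complex_of_real ((\<phi> (x + h *\<^sub>R e) - \<phi> x) / h) - complex_of_real (dderiv e \<phi> x)))
     \<longlongrightarrow> 0) (at 0)"
  unfolding tendsto_at_iff_sequentially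
proof (intro allI impI)
  fix X :: "nat \<Rightarrow> real" assume X: "\<forall>i. X i \<in> UNIV - {0}" "X \<longlonglongrightarrow> 0"
  obtain M where M: "\<And>n. \<bar>X n\<bar> \<le> M"
    using convergent_imp_Bseq[OF convergentI[OF X(2)]] by (auto simp: Bseq_def)
  obtain R where R: "\<And>x. \<phi> x \<noteq> 0 \<Longrightarrow> norm x \<le> R" using test_fun_support[OF \<phi>] by metis
  obtain B where B: "\<And>x. \<bar>dderiv e \<phi> x\<bar> \<le> B"
    using test_fun_bounded[OF test_fun_dderiv[OF \<phi> e]] by blast
  let ?q = "\<lambda>n x. complex_of_real ((\<phi> (x + X n *\<^sub>R e) - \<phi> x) / X n)"
  \<comment> \<open>A step of length at most M enlarges the support by at most M, so every quotient
    lives in this ball, where B bounds it by the mean value theorem.\<close>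
  let ?g = "\<lambda>x::'a. complex_of_real (B * indicator (cball 0 (R + M)) x)"
  have B0: "B \<ge> 0" using B[of 0] by linarith
  have "(\<lambda>n. L2norm (\<lambda>x. complex_of_real (dderiv e \<phi> x) - ?q n x)) \<longlonglongrightarrow> 0"
  proof (rule L2norm_dominated[of _ _ ?g])
    show "?q n \<in> borel_measurable lebesgue" for n
      using test_fun_measurable[OF \<phi>] test_fun_measurable[OF test_fun_translate(2)[OF \<phi>]] by measurable
    show "(\<lambda>x. complex_of_real (dderiv e \<phi> x)) \<in> borel_measurable lebesgue"
      using test_fun_measurable[OF test_fun_dderiv[OF \<phi> e]] by measurable
    show "L2 ?g"
      by (rule L2_indicator_cball)
    show "(\<lambda>n. ?q n x) \<longlonglongrightarrow> complex_of_real (dderiv e \<phi> x)" for x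
      using difference_quotient_tendsto[OF test_fun_directional[OF \<phi>], of x e] X
      by (intro tendsto_of_real) (auto simp: tendsto_at_iff_sequentially o_def)
    show "norm (?q n x) \<le> norm (?g x)" for n x
    proof (cases "norm x \<le> R + M")
      case True
      have "\<bar>\<phi> (x + X n *\<^sub>R e) - \<phi> x\<bar> \<le> B * \<bar>X n\<bar>"
        using directional_lipschitz[OF test_fun_directional[OF \<phi>], of e B x "X n"] B by simp
      then have "\<bar>(\<phi> (x + X n *\<^sub>R e) - \<phi> x) / X n\<bar> \<le> B"
        using X(1) by (auto simp: abs_divide divide_le_eq)
      then show ?thesis using True B0 by (simp del: of_real_divide of_real_diff)
    next
      case False
      have "norm x \<le> norm (x + X n *\<^sub>R e) + norm (X n *\<^sub>R e)"
        using norm_triangle_ineq4[of "x + X n *\<^sub>R e" "X n *\<^sub>R e"] by simp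
      then have "norm x \<le> norm (x + X n *\<^sub>R e) + M" using M[of n] e by simp
      then have "\<phi> x = 0 \<and> \<phi> (x + X n *\<^sub>R e) = 0"
        using R[of x] R[of "x + X n *\<^sub>R e"] False M[of n] by fastforce
      then show ?thesis by simp
    qed
  qed
  then show "((\<lambda>h. L2norm (\<lambda>x. complex_of_real ((\<phi> (x + h *\<^sub>R e) - \<phi> x) / h) - complex_of_real (dderiv e \<phi> x))) \<circ> X)
     \<longlonglongrightarrow> 0"
    by (simp add: o_def L2norm_minus_commute)
qed

section \<open>Difference quotients of weakly differentiable functions\<close>

lemma weak_deriv_translate:
  assumes "weak_deriv ds f g" "L2 f" "L2 g" "ds \<in> lists Basis"
  shows "weak_deriv ds (\<lambda>x. f (x + a)) (\<lambda>x. g (x + a))"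
  unfolding weak_deriv_def
proof (intro allI impI)
  fix \<phi> :: "'a \<Rightarrow> real" assume \<phi>: "test_fun \<phi>"
  note \<phi>' = test_fun_translate[OF \<phi>, where a = "-a"]
  have it: "test_fun (iterdiff ds \<phi>)"
    using assms(4) by induction (auto simp: \<phi> test_fun_dderiv)
  have "(\<integral>x. f (x + a) * complex_of_real (iterdiff ds \<phi> (x + a + - a)) \<partial>lebesgue)
    = (\<integral>x. f x * complex_of_real (iterdiff ds \<phi> (x + - a)) \<partial>lebesgue)"
    by (rule integral_translate)
       (use L2_measurable[OF assms(2)] test_fun_measurable[OF test_fun_translate(2)[OF it]] in measurable)
  also have "\<dots> = (-1) ^ length ds * (\<integral>x. g x * complex_of_real (\<phi> (x + -a)) \<partial>lebesgue)"
    using assms(1) \<phi>' unfolding weak_deriv_def by metis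
  also have "(\<integral>x. g x * complex_of_real (\<phi> (x + -a)) \<partial>lebesgue)
     = (\<integral>x. g (x + a) * complex_of_real (\<phi> (x + a + -a)) \<partial>lebesgue)"
    by (rule integral_translate[symmetric])
       (use L2_measurable[OF assms(3)] test_fun_measurable[OF \<phi>'(2)] in measurable)
  finally show "(\<integral>x. f (x + a) * complex_of_real (iterdiff ds \<phi> x) \<partial>lebesgue)
    = (-1) ^ length ds * (\<integral>x. g (x + a) * complex_of_real (\<phi> x) \<partial>lebesgue)" by simp
qed

text \<open>The translation is moved onto the test function, whose difference quotients converge in
  norm; the definition of the weak derivative is then applied to the translated pair.\<close>

lemma weak_deriv_integral_derivative:
  fixes f g \<psi> :: "'a::euclidean_space \<Rightarrow> complex"
  assumes wd: "weak_deriv [e] f g" and f: "L2 f" and g: "L2 g" and e: "e \<in> Basis" and \<psi>: "test_span \<psi>"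
  shows "((\<lambda>s. \<integral>x. f (x + s *\<^sub>R e) * \<psi> x \<partial>lebesgue) has_vector_derivative
      (\<integral>x. g (x + s *\<^sub>R e) * \<psi> x \<partial>lebesgue)) (at s)"
  using \<psi>
proof induction
  case (test \<phi>)
  let ?G = "\<lambda>s. \<integral>x. f (x + s *\<^sub>R e) * complex_of_real (\<phi> x) \<partial>lebesgue"
  let ?q = "\<lambda>h x. complex_of_real ((\<phi> (x + h *\<^sub>R e) - \<phi> x) / h)"
  have Lq: "L2 (?q h)" for h
    using L2_divide[OF L2_diff[OF test_fun_L2[OF test_fun_translate(2)[OF test]] test_fun_L2[OF test]], of "h *\<^sub>R e" "complex_of_real h"]
    by simp
  have Ld: "L2 (\<lambda>x. complex_of_real (dderiv e \<phi> x))" by (intro test_fun_L2 test_fun_dderiv test e)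
  have Lf: "L2 (\<lambda>x. f (x + s *\<^sub>R e))" by (rule L2_translate[OF f])
  \<comment> \<open>Shifting \<open>f\<close> by h amounts to shifting the test function by -h,
    hence the sign and the quotient at -h. At h = 0 both sides are 0 by the convention for
    division.\<close>
  have eq: "(?G (s + h) - ?G s) /\<^sub>R h = - (\<integral>x. ?q (- h) x * f (x + s *\<^sub>R e) \<partial>lebesgue)" for h
  proof (cases "h = 0")
    case h: False
    have "?G (s + h) = (\<integral>x. f (x + h *\<^sub>R e + s *\<^sub>R e) * complex_of_real (\<phi> (x + h *\<^sub>R e + - (h *\<^sub>R e))) \<partial>lebesgue)"
      by (simp add: algebra_simps)
    also have "\<dots> = (\<integral>x. f (x + s *\<^sub>R e) * complex_of_real (\<phi> (x + - (h *\<^sub>R e))) \<partial>lebesgue)"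
      by (rule integral_translate)
         (use L2_measurable[OF Lf] test_fun_measurable[OF test_fun_translate(2)[OF test]] in measurable)
    finally have "?G (s + h) - ?G s
       = (\<integral>x. f (x + s *\<^sub>R e) * complex_of_real (\<phi> (x + - (h *\<^sub>R e)))
            - f (x + s *\<^sub>R e) * complex_of_real (\<phi> x) \<partial>lebesgue)"
      by (simp add: Bochner_Integration.integral_diff L2_integrable_mult[OF Lf] test_fun_L2 test test_fun_translate(2)[OF test, of "- (h *\<^sub>R e)"] del: add_uminus_conv_diff)
    also have "\<dots> = (\<integral>x. complex_of_real (- h) * (?q (- h) x * f (x + s *\<^sub>R e)) \<partial>lebesgue)"
      using h by (intro Bochner_Integration.integral_cong) (auto simp: field_simps)
    also have "\<dots> = complex_of_real (- h) * (\<integral>x. ?q (- h) x * f (x + s *\<^sub>R e) \<partial>lebesgue)"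
      by simp
    finally show ?thesis using h
      by (simp add: scaleR_conv_of_real field_simps)
  qed simp
  have "((\<lambda>h. \<integral>x. ?q h x * f (x + s *\<^sub>R e) \<partial>lebesgue) \<longlongrightarrow>
      (\<integral>x. complex_of_real (dderiv e \<phi> x) * f (x + s *\<^sub>R e) \<partial>lebesgue)) (at 0)"
    by (rule tendsto_integral_mult[OF Lq Ld Lf test_fun_quotient_L2[OF test e]])
  moreover have "LIM h at (0::real). - h :> at 0"
    by (auto simp: filterlim_at eventually_at_filter intro!: tendsto_eq_intros)
  ultimately have "((\<lambda>h. \<integral>x. ?q (- h) x * f (x + s *\<^sub>R e) \<partial>lebesgue) \<longlongrightarrow>
      (\<integral>x. complex_of_real (dderiv e \<phi> x) * f (x + s *\<^sub>R e) \<partial>lebesgue)) (at 0)"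
    by (rule filterlim_compose)
  then have "((\<lambda>h. (?G (s + h) - ?G s) /\<^sub>R h) \<longlongrightarrow>
     - (\<integral>x. complex_of_real (dderiv e \<phi> x) * f (x + s *\<^sub>R e) \<partial>lebesgue)) (at 0)"
    unfolding eq by (rule tendsto_minus)
  also have "- (\<integral>x. complex_of_real (dderiv e \<phi> x) * f (x + s *\<^sub>R e) \<partial>lebesgue)
      = (\<integral>x. g (x + s *\<^sub>R e) * complex_of_real (\<phi> x) \<partial>lebesgue)"
    using weak_deriv_translate[OF wd f g, of "s *\<^sub>R e"] e test
    by (simp add: weak_deriv_def mult.commute)
  finally show ?case
    unfolding has_vector_derivative_quotient_iff .
next
  case (scale \<psi> c)
  have "(\<integral>x. h x * (c * \<psi> x) \<partial>lebesgue) = c * (\<integral>x. h x * \<psi> x \<partial>lebesgue)" for h :: "'a \<Rightarrow> complex"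
    by (simp add: mult.left_commute)
  then show ?case using has_vector_derivative_mult_right[OF scale(2), of c] by simp
next
  case (add \<psi>1 \<psi>2)
  have "(\<integral>x. h (x + s *\<^sub>R e) * (\<psi>1 x + \<psi>2 x) \<partial>lebesgue)
    = (\<integral>x. h (x + s *\<^sub>R e) * \<psi>1 x \<partial>lebesgue) + (\<integral>x. h (x + s *\<^sub>R e) * \<psi>2 x \<partial>lebesgue)"
    if "L2 h" for h :: "'a \<Rightarrow> complex" and s
    using L2_integrable_mult[OF L2_translate[OF that] test_span_L2[OF add(1)]]
      L2_integrable_mult[OF L2_translate[OF that] test_span_L2[OF add(2)]]
    by (simp add: distrib_left)
  from this[OF f] this[OF g] show ?case using has_vector_derivative_add[OF add(3,4)] by simp
qed

text \<open>Converse of Cauchy-Schwarz by duality: the pairing of \<open>f\<close> with its own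
  conjugate is the squared norm, and by density a member of \<open>test_span\<close> comes
  arbitrarily close to that conjugate.\<close>

lemma test_span_pairing_bound:
  assumes f: "L2 f" and b: "\<And>\<psi>. test_span \<psi> \<Longrightarrow> norm (\<integral>x. f x * \<psi> x \<partial>lebesgue) \<le> C * L2norm \<psi>"
    and C: "C \<ge> 0"
  shows "L2norm f \<le> C"
proof -
  let ?\<xi> = "\<lambda>x. cnj (f x)"
  note \<xi> = L2_cnj[OF f]
  have "(L2norm f)\<^sup>2 \<le> C * L2norm f + \<epsilon>" if "\<epsilon> > 0" for \<epsilon>
  proof -
    \<comment> \<open>Chosen so that the two errors, C \<eta> and \<eta> times the norm of
      \<open>f\<close>, add up to at most \<epsilon>; the summand 1 keeps the denominator
      positive.\<close>
    define \<eta> where "\<eta> = \<epsilon> / (L2norm f + C + 1)"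
    have pos: "L2norm f + C + 1 > 0" using C by (simp add: add_nonneg_pos)
    then have "\<eta> > 0" using that by (simp add: \<eta>_def)
    then obtain \<psi> where \<psi>: "test_span \<psi>" "L2norm (\<lambda>x. ?\<xi> x - \<psi> x) < \<eta>"
      using L2_test_span_dense[OF \<xi>] by blast
    note L\<psi> = test_span_L2[OF \<psi>(1)]
    have "L2norm (\<lambda>x. ?\<xi> x + - (?\<xi> x - \<psi> x)) \<le> L2norm ?\<xi> + L2norm (\<lambda>x. - (?\<xi> x - \<psi> x))"
      by (intro L2norm_triangle L2_uminus L2_diff \<xi> L\<psi>)
    then have n\<psi>: "L2norm \<psi> \<le> L2norm f + \<eta>"
      unfolding L2norm_uminus L2norm_cnj using \<psi>(2) by simp
    have "(L2norm f)\<^sup>2 = norm (\<integral>x. f x * ?\<xi> x \<partial>lebesgue)"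
    proof -
      have "(\<integral>x. f x * ?\<xi> x \<partial>lebesgue) = (\<integral>x. complex_of_real ((norm (f x))\<^sup>2) \<partial>lebesgue)"
        by (intro Bochner_Integration.integral_cong) (simp_all only: complex_norm_square)
      also have "\<dots> = complex_of_real ((L2norm f)\<^sup>2)" by (simp only: integral_complex_of_real L2norm_power2)
      finally show ?thesis by (simp add: norm_power)
    qed
    also have "(\<integral>x. f x * ?\<xi> x \<partial>lebesgue) = (\<integral>x. f x * \<psi> x + f x * (?\<xi> x - \<psi> x) \<partial>lebesgue)"
      by (intro Bochner_Integration.integral_cong) (auto simp: algebra_simps)
    also have "\<dots> = (\<integral>x. f x * \<psi> x \<partial>lebesgue) + (\<integral>x. f x * (?\<xi> x - \<psi> x) \<partial>lebesgue)"
      by (intro Bochner_Integration.integral_add L2_integrable_mult f L\<psi> L2_diff \<xi>)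
    also have "norm \<dots> \<le> C * L2norm \<psi> + L2norm f * L2norm (\<lambda>x. ?\<xi> x - \<psi> x)"
      by (intro norm_triangle_le add_mono b \<psi> norm_integral_mult_le f L2_diff \<xi> L\<psi>)
    also have "\<dots> \<le> C * (L2norm f + \<eta>) + L2norm f * \<eta>"
      using n\<psi> \<psi>(2) C by (intro add_mono mult_left_mono) auto
    also have "\<dots> \<le> C * L2norm f + \<eta> * (L2norm f + C + 1)"
      using \<open>\<eta> > 0\<close> by (simp add: algebra_simps)
    also have "\<eta> * (L2norm f + C + 1) = \<epsilon>" using pos by (simp add: \<eta>_def)
    finally show ?thesis .
  qed
  then have "(L2norm f)\<^sup>2 \<le> C * L2norm f" by (rule field_le_epsilon)
  then show ?thesis using C L2norm_nonneg[of f]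
    by (cases "L2norm f = 0") (auto simp: power2_eq_square)
qed

text \<open>Paired with a test function, the shift becomes a scalar function whose derivative is
  bounded by Cauchy-Schwarz. The mean value theorem and duality then remove the test
  function.\<close>

lemma L2_translate_lipschitz:
  assumes wd: "weak_deriv [e] f g" and f: "L2 f" and g: "L2 g" and e: "e \<in> Basis"
  shows "L2norm (\<lambda>x. f (x + h *\<^sub>R e) - f x) \<le> \<bar>h\<bar> * L2norm g"
proof (rule test_span_pairing_bound)
  show "L2 (\<lambda>x. f (x + h *\<^sub>R e) - f x)" by (intro L2_diff L2_translate f)
  fix \<psi> :: "'a \<Rightarrow> complex" assume \<psi>: "test_span \<psi>"
  note L\<psi> = test_span_L2[OF \<psi>]
  let ?G = "\<lambda>s. \<integral>x. f (x + s *\<^sub>R e) * \<psi> x \<partial>lebesgue"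
  have "norm (?G h - ?G 0) \<le> (L2norm g * L2norm \<psi>) * \<bar>h - 0\<bar>"
  proof (rule has_vector_derivative_bound)
    show "(?G has_vector_derivative (\<integral>x. g (x + s *\<^sub>R e) * \<psi> x \<partial>lebesgue)) (at s)" for s
      by (rule weak_deriv_integral_derivative[OF wd f g e \<psi>])
    show "norm (\<integral>x. g (x + s *\<^sub>R e) * \<psi> x \<partial>lebesgue) \<le> L2norm g * L2norm \<psi>" for s
      using norm_integral_mult_le[OF L2_translate[OF g] L\<psi>, of "s *\<^sub>R e"] by (simp add: L2norm_translate[OF g])
  qed
  also have "?G h - ?G 0 = (\<integral>x. (f (x + h *\<^sub>R e) - f x) * \<psi> x \<partial>lebesgue)"
    using L2_integrable_mult[OF L2_translate[OF f, of "h *\<^sub>R e"] L\<psi>] L2_integrable_mult[OF f L\<psi>]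
    by (simp add: left_diff_distrib)
  finally show "norm (\<integral>x. (f (x + h *\<^sub>R e) - f x) * \<psi> x \<partial>lebesgue) \<le> \<bar>h\<bar> * L2norm g * L2norm \<psi>"
    by (simp add: mult_ac)
qed auto

text \<open>Weak convergence follows from convergence on a dense set and a uniform norm bound. The
  first is the derivative of the pairing, the second the Lipschitz estimate for
  translations.\<close>

lemma weak_deriv_quotient_tendsto:
  assumes wd: "weak_deriv [e] f g" and f: "L2 f" and g: "L2 g" and e: "e \<in> Basis" and \<xi>: "L2 \<xi>"
  shows "((\<lambda>h. \<integral>x. (f (x + h *\<^sub>R e) - f x) / complex_of_real h * \<xi> x \<partial>lebesgue)
     \<longlongrightarrow> (\<integral>x. g x * \<xi> x \<partial>lebesgue)) (at 0)"
proof (rule tendstoI)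
  fix \<epsilon> :: real assume "\<epsilon> > 0"
  let ?q = "\<lambda>h x. (f (x + h *\<^sub>R e) - f x) / complex_of_real h"
  have Lq: "L2 (?q h)" for h by (intro L2_divide L2_diff L2_translate f)
  \<comment> \<open>At h = 0 the quotient is 0 by the convention for division, so the bound holds
    for every h.\<close>
  have nq: "L2norm (?q h) \<le> L2norm g" for h
  proof (cases "h = 0")
    case False
    have "L2norm (?q h) = L2norm (\<lambda>x. f (x + h *\<^sub>R e) - f x) / \<bar>h\<bar>"
      using L2norm_cmult[of "inverse (complex_of_real h)" "\<lambda>x. f (x + h *\<^sub>R e) - f x"]
      by (simp add: norm_divide divide_inverse norm_inverse mult.commute)
    then show ?thesis using L2_translate_lipschitz[OF wd f g e, of h] False
      by (simp add: divide_le_eq mult.commute)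
  qed (simp add: L2norm_def)
  \<comment> \<open>The two pairings with \<xi> - \<psi> cost at most \<eta> times the norm of
    \<open>g\<close> each, together at most \<epsilon>/2.\<close>
  define \<eta> where "\<eta> = \<epsilon> / (2 * (2 * L2norm g + 1))"
  have pos: "2 * L2norm g + 1 > 0" by (simp add: add_nonneg_pos)
  then have \<eta>: "\<eta> > 0" using \<open>\<epsilon> > 0\<close> by (simp add: \<eta>_def)
  then obtain \<psi> where \<psi>: "test_span \<psi>" "L2norm (\<lambda>x. \<xi> x - \<psi> x) < \<eta>"
    using L2_test_span_dense[OF \<xi>] by blast
  note L\<psi> = test_span_L2[OF \<psi>(1)]
  have "((\<lambda>h. \<integral>x. ?q h x * \<psi> x \<partial>lebesgue) \<longlongrightarrow> (\<integral>x. g x * \<psi> x \<partial>lebesgue)) (at 0)"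
  proof -
    let ?G = "\<lambda>s. \<integral>x. f (x + s *\<^sub>R e) * \<psi> x \<partial>lebesgue"
    have "((\<lambda>h. (?G (0 + h) - ?G 0) /\<^sub>R h) \<longlongrightarrow> (\<integral>x. g x * \<psi> x \<partial>lebesgue)) (at 0)"
      using weak_deriv_integral_derivative[OF wd f g e \<psi>(1), of 0]
      unfolding has_vector_derivative_quotient_iff by simp
    moreover have "(?G (0 + h) - ?G 0) /\<^sub>R h = (\<integral>x. ?q h x * \<psi> x \<partial>lebesgue)" for h
    proof -
      have "?G h - ?G 0 = (\<integral>x. (f (x + h *\<^sub>R e) - f x) * \<psi> x \<partial>lebesgue)"
        using L2_integrable_mult[OF L2_translate[OF f, of "h *\<^sub>R e"] L\<psi>] L2_integrable_mult[OF f L\<psi>]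
        by (simp add: left_diff_distrib)
      then show ?thesis by (simp add: scaleR_conv_of_real field_simps)
    qed
    ultimately show ?thesis by simp
  qed
  then have "\<forall>\<^sub>F h in at 0. dist (\<integral>x. ?q h x * \<psi> x \<partial>lebesgue) (\<integral>x. g x * \<psi> x \<partial>lebesgue) < \<epsilon> / 2"
    using \<open>\<epsilon> > 0\<close> by (intro tendstoD) auto
  then show "\<forall>\<^sub>F h in at 0. dist (\<integral>x. ?q h x * \<xi> x \<partial>lebesgue) (\<integral>x. g x * \<xi> x \<partial>lebesgue) < \<epsilon>"
  proof eventually_elim
    case (elim h)
    have split: "(\<integral>x. k x * \<xi> x \<partial>lebesgue)
        = (\<integral>x. k x * \<psi> x \<partial>lebesgue) + (\<integral>x. k x * (\<xi> x - \<psi> x) \<partial>lebesgue)" if "L2 k" for k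
      using L2_integrable_mult[OF that L\<psi>] L2_integrable_mult[OF that \<xi>]
      by (simp add: right_diff_distrib)
    have small: "norm (\<integral>x. k x * (\<xi> x - \<psi> x) \<partial>lebesgue) \<le> L2norm g * \<eta>"
      if "L2 k" "L2norm k \<le> L2norm g" for k
    proof -
      have "norm (\<integral>x. k x * (\<xi> x - \<psi> x) \<partial>lebesgue) \<le> L2norm k * L2norm (\<lambda>x. \<xi> x - \<psi> x)"
        by (intro norm_integral_mult_le that L2_diff \<xi> L\<psi>)
      also have "\<dots> \<le> L2norm g * \<eta>" using that \<psi>(2) by (intro mult_mono) auto
      finally show ?thesis .
    qed
    have "dist (\<integral>x. ?q h x * \<xi> x \<partial>lebesgue) (\<integral>x. g x * \<xi> x \<partial>lebesgue)
      = norm (((\<integral>x. ?q h x * \<psi> x \<partial>lebesgue) - (\<integral>x. g x * \<psi> x \<partial>lebesgue))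
        + ((\<integral>x. ?q h x * (\<xi> x - \<psi> x) \<partial>lebesgue) - (\<integral>x. g x * (\<xi> x - \<psi> x) \<partial>lebesgue)))"
      unfolding split[OF Lq] split[OF g] dist_norm by (simp add: algebra_simps)
    also have "\<dots> \<le> norm ((\<integral>x. ?q h x * \<psi> x \<partial>lebesgue) - (\<integral>x. g x * \<psi> x \<partial>lebesgue))
       + (norm (\<integral>x. ?q h x * (\<xi> x - \<psi> x) \<partial>lebesgue) + norm (\<integral>x. g x * (\<xi> x - \<psi> x) \<partial>lebesgue))"
      by (intro norm_triangle_le add_left_mono norm_triangle_ineq4)
    also have "\<dots> < \<epsilon> / 2 + (L2norm g * \<eta> + L2norm g * \<eta>)"
      using elim small[OF Lq nq] small[OF g] by (intro add_less_le_mono add_mono) (auto simp: dist_norm)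
    also have "\<dots> \<le> \<epsilon> / 2 + \<eta> * (2 * L2norm g + 1)" using \<eta> by (simp add: algebra_simps)
    also have "\<dots> = \<epsilon>" using pos by (simp add: \<eta>_def del: distrib_left_numeral)
    finally show ?case .
  qed
qed

text \<open>Duality with the bound 0, after the hypothesis is extended to \<open>test_span\<close>
  by linearity.\<close>

lemma L2_eq_0_test:
  assumes f: "L2 f" and z: "\<And>\<phi>. test_fun \<phi> \<Longrightarrow> (\<integral>x. f x * complex_of_real (\<phi> x) \<partial>lebesgue) = 0"
  shows "AE x in lebesgue. f x = 0"
proof -
  have "(\<integral>x. f x * \<psi> x \<partial>lebesgue) = 0" if "test_span \<psi>" for \<psi>
    using that
  proof induction
    case (scale \<psi> c)
    have "(\<integral>x. f x * (c * \<psi> x) \<partial>lebesgue) = (\<integral>x. c * (f x * \<psi> x) \<partial>lebesgue)"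
      by (simp add: mult_ac)
    then show ?case using scale by simp
  next
    case (add a b)
    then show ?case
      using L2_integrable_mult[OF f test_span_L2[OF add(1)]] L2_integrable_mult[OF f test_span_L2[OF add(2)]]
      by (simp add: distrib_left)
  qed (rule z)
  then have "L2norm f \<le> 0" by (intro test_span_pairing_bound f) auto
  then show ?thesis using L2norm_nonneg[of f] L2norm_eq_0_iff[OF f] by linarith
qed

lemma weak_deriv_unique:
  assumes "weak_deriv ds f g" "weak_deriv ds f g'" "L2 g" "L2 g'"
  shows "AE x in lebesgue. g x = g' x"
proof -
  have "AE x in lebesgue. g x - g' x = 0"
  proof (rule L2_eq_0_test[OF L2_diff[OF assms(3,4)]])
    fix \<phi> :: "'a \<Rightarrow> real" assume \<phi>: "test_fun \<phi>"
    have "(\<integral>x. g x * complex_of_real (\<phi> x) \<partial>lebesgue) = (\<integral>x. g' x * complex_of_real (\<phi> x) \<partial>lebesgue)"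
      using assms(1,2) \<phi> unfolding weak_deriv_def by simp
    then show "(\<integral>x. (g x - g' x) * complex_of_real (\<phi> x) \<partial>lebesgue) = 0"
      using L2_integrable_mult[OF assms(3) test_fun_L2[OF \<phi>]] L2_integrable_mult[OF assms(4) test_fun_L2[OF \<phi>]]
      by (simp add: left_diff_distrib)
  qed
  then show ?thesis by simp
qed

text \<open>Summation by parts for difference quotients: translation invariance turns a backward
  quotient of \<open>g\<close> into a forward quotient of the product of \<open>w\<close> and
  \<open>f\<close>, and only then is the limit taken. The identity is bilinear; conjugates are
  inserted by its users.\<close>

lemma weak_integration_by_parts:
  fixes f f' g g' :: "'a::euclidean_space \<Rightarrow> complex" and w w' :: "'a \<Rightarrow> real"
  assumes wf: "weak_deriv [e] f f'" "L2 f" "L2 f'" and wg: "weak_deriv [e] g g'" "L2 g" "L2 g'"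
    and e: "e \<in> Basis"
    and w: "\<And>x. ((\<lambda>h. w (x + h *\<^sub>R e)) has_vector_derivative w' x) (at 0)"
    and wm: "w \<in> borel_measurable lebesgue" "w' \<in> borel_measurable lebesgue"
    and wb: "\<And>x. \<bar>w x\<bar> \<le> B" "\<And>x. \<bar>w' x\<bar> \<le> B"
  shows "(\<integral>x. w x * f x * g' x \<partial>lebesgue) = - (\<integral>x. (w x * f' x + w' x * f x) * g x \<partial>lebesgue)"
proof -
  \<comment> \<open>A sequence of steps instead of the filter at 0, because the dominated
    convergence result \<open>L2norm_dominated\<close> is sequential.\<close>
  define k where "k = (\<lambda>n. 1 / real (Suc n))"
  have k: "k n > 0" for n by (simp add: k_def)
  have k0: "k \<longlonglongrightarrow> 0" unfolding k_def by (rule LIMSEQ_inverse_real_of_nat[unfolded inverse_eq_divide])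
  have kf: "filterlim k (at 0) sequentially"
    using k0 k by (auto simp: filterlim_at intro!: always_eventually) (metis less_irrefl)
  have kf': "filterlim (\<lambda>n. - k n) (at 0) sequentially"
    using tendsto_minus[OF k0] k by (auto simp: filterlim_at intro!: always_eventually) (metis less_irrefl)
  let ?D = "\<lambda>(f :: 'a \<Rightarrow> complex) h x. (f (x + h *\<^sub>R e) - f x) / complex_of_real h"
  let ?Dw = "\<lambda>n x. complex_of_real ((w (x + k n *\<^sub>R e) - w x) / k n)"
  have Lw: "L2 (\<lambda>x. complex_of_real (w x) * h x)" if "L2 h" for h
    by (rule L2_bounded_mult_real[OF that wm(1) wb(1)])
  have Dw_bound: "\<bar>(w (x + k n *\<^sub>R e) - w x) / k n\<bar> \<le> B" for n x
    using directional_lipschitz[OF w, of B x "k n"] wb(2) k[of n] by (simp add: abs_divide divide_le_eq)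
  have Dw_m: "(\<lambda>x. (w (x + k n *\<^sub>R e) - w x) / k n) \<in> borel_measurable lebesgue" for n
    using wm(1) by measurable
  have LDw: "L2 (\<lambda>x. ?Dw n x * h x)" if "L2 h" for h n
    by (rule L2_bounded_mult_real[OF that Dw_m Dw_bound])
  have Ldw: "L2 (\<lambda>x. complex_of_real (w' x) * h x)" if "L2 h" for h
    by (rule L2_bounded_mult_real[OF that wm(2) wb(2)])
  have B0: "B \<ge> 0" using wb(1)[of 0] by linarith
  \<comment> \<open>The discrete product rule, split so that the product of the two differences
    stands alone. That term is O(k n) and vanishes in the limit; the other three converge to the
    terms of the claim.\<close>
  have eq: "(\<integral>x. ?D g (- k n) x * (w x * f x) \<partial>lebesgue)
     = - (\<integral>x. ?D f (k n) x * (w x * g x) \<partial>lebesgue)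
       - (\<integral>x. ?Dw n x * g x * (f (x + k n *\<^sub>R e) - f x) \<partial>lebesgue)
       - (\<integral>x. ?Dw n x * g x * f x \<partial>lebesgue)" for n
  proof -
    let ?h = "k n *\<^sub>R e"
    have m: "(\<lambda>x. g (x + - ?h) * (w x * f x)) \<in> borel_measurable lebesgue"
      using wf(2)[THEN L2_measurable] wg(2)[THEN L2_measurable] wm by measurable
    have i1: "integrable lebesgue (\<lambda>x. g (x + - ?h) * (w x * f x))"
      by (intro L2_integrable_mult L2_translate wg Lw wf)
    have i2: "integrable lebesgue (\<lambda>x. g x * (w x * f x))"
      by (intro L2_integrable_mult wg Lw wf)
    have "(\<integral>x. ?D g (- k n) x * (w x * f x) \<partial>lebesgue)
       = (\<integral>x. (g (x + - ?h) * (w x * f x) - g x * (w x * f x)) / (- complex_of_real (k n)) \<partial>lebesgue)"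
      by (intro Bochner_Integration.integral_cong) (auto simp: diff_divide_distrib algebra_simps)
    also have "\<dots> = ((\<integral>x. g (x + - ?h) * (w x * f x) \<partial>lebesgue) - (\<integral>x. g x * (w x * f x) \<partial>lebesgue))
        / (- complex_of_real (k n))"
      by (simp only: integral_divide_zero Bochner_Integration.integral_diff[OF i1 i2])
    also have "(\<integral>x. g (x + - ?h) * (w x * f x) \<partial>lebesgue)
        = (\<integral>x. g (x + ?h + - ?h) * (w (x + ?h) * f (x + ?h)) \<partial>lebesgue)"
      by (rule integral_translate[OF m, symmetric])
    also have "\<dots> = (\<integral>x. g x * (w x * f x) + complex_of_real (k n) * (?D f (k n) x * (w x * g x)
         + ?Dw n x * g x * (f (x + ?h) - f x) + ?Dw n x * g x * f x) \<partial>lebesgue)"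
      using k[of n] by (intro Bochner_Integration.integral_cong) (auto simp: field_simps)
    also have "\<dots> = (\<integral>x. g x * (w x * f x) \<partial>lebesgue) + complex_of_real (k n) *
        ((\<integral>x. ?D f (k n) x * (w x * g x) \<partial>lebesgue) + (\<integral>x. ?Dw n x * g x * (f (x + ?h) - f x) \<partial>lebesgue)
          + (\<integral>x. ?Dw n x * g x * f x \<partial>lebesgue))"
    proof -
      have j: "integrable lebesgue (\<lambda>x. ?D f (k n) x * (w x * g x))"
         "integrable lebesgue (\<lambda>x. ?Dw n x * g x * (f (x + ?h) - f x))"
         "integrable lebesgue (\<lambda>x. ?Dw n x * g x * f x)"
        by (intro L2_integrable_mult L2_translate L2_diff L2_divide wg Lw wf LDw)+
      show ?thesis
        by (simp only: Bochner_Integration.integral_add[OF i2 integrable_mult_right[OF Bochner_Integration.integrable_add[OF Bochner_Integration.integrable_add[OF j(1,2)] j(3)]]]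
           integral_mult_right_zero Bochner_Integration.integral_add[OF Bochner_Integration.integrable_add[OF j(1,2)] j(3)]
           Bochner_Integration.integral_add[OF j(1,2)])
    qed
    finally show ?thesis using k[of n] by (simp add: field_simps)
  qed
  have l1: "(\<lambda>n. \<integral>x. ?D g (- k n) x * (w x * f x) \<partial>lebesgue) \<longlonglongrightarrow> (\<integral>x. g' x * (w x * f x) \<partial>lebesgue)"
    by (rule filterlim_compose[OF weak_deriv_quotient_tendsto[OF wg e Lw[OF wf(2)]] kf'])
  have l2: "(\<lambda>n. \<integral>x. ?D f (k n) x * (w x * g x) \<partial>lebesgue) \<longlonglongrightarrow> (\<integral>x. f' x * (w x * g x) \<partial>lebesgue)"
    by (rule filterlim_compose[OF weak_deriv_quotient_tendsto[OF wf e Lw[OF wg(2)]] kf])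
  have l3: "(\<lambda>n. \<integral>x. ?Dw n x * g x * (f (x + k n *\<^sub>R e) - f x) \<partial>lebesgue) \<longlonglongrightarrow> 0"
  proof (rule Lim_null_comparison)
    show "(\<lambda>n. (B * L2norm g) * (k n * L2norm f')) \<longlonglongrightarrow> 0"
      using tendsto_mult_right[OF tendsto_mult_left[OF k0], of "B * L2norm g" "L2norm f'"] by (simp add: mult_ac)
    have "norm (\<integral>x. ?Dw n x * g x * (f (x + k n *\<^sub>R e) - f x) \<partial>lebesgue)
      \<le> (B * L2norm g) * (k n * L2norm f')" for n
    proof -
      have "norm (\<integral>x. ?Dw n x * g x * (f (x + k n *\<^sub>R e) - f x) \<partial>lebesgue)
        \<le> L2norm (\<lambda>x. ?Dw n x * g x) * L2norm (\<lambda>x. f (x + k n *\<^sub>R e) - f x)"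
        by (intro norm_integral_mult_le LDw wg L2_diff L2_translate wf)
      also have "\<dots> \<le> (B * L2norm g) * (k n * L2norm f')"
      proof (rule mult_mono)
        have "L2norm (\<lambda>x. ?Dw n x * g x) \<le> L2norm (\<lambda>x. complex_of_real B * g x)"
          by (intro L2norm_mono L2_cmult LDw wg) (use Dw_bound[of _ n] B0 in \<open>auto simp only: norm_mult norm_of_real abs_of_nonneg intro!: mult_right_mono norm_ge_zero\<close>)
        then show "L2norm (\<lambda>x. ?Dw n x * g x) \<le> B * L2norm g" using B0 by (simp add: L2norm_cmult)
        show "L2norm (\<lambda>x. f (x + k n *\<^sub>R e) - f x) \<le> k n * L2norm f'"
          using L2_translate_lipschitz[OF wf e, of "k n"] k[of n] by simp
      qed (use B0 in auto)
      finally show ?thesis .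
    qed
    then show "\<forall>\<^sub>F n in sequentially. norm (\<integral>x. ?Dw n x * g x * (f (x + k n *\<^sub>R e) - f x) \<partial>lebesgue)
      \<le> (B * L2norm g) * (k n * L2norm f')" by simp
  qed
  have l4: "(\<lambda>n. \<integral>x. ?Dw n x * g x * f x \<partial>lebesgue) \<longlonglongrightarrow> (\<integral>x. complex_of_real (w' x) * g x * f x \<partial>lebesgue)"
  proof (rule tendsto_integral_mult[OF LDw[OF wg(2)] Ldw[OF wg(2)] wf(2)])
    have "(\<lambda>n. L2norm (\<lambda>x. complex_of_real (w' x) * g x - ?Dw n x * g x)) \<longlonglongrightarrow> 0"
    proof (rule L2norm_dominated[OF _ _ L2_cmult[OF wg(2), of "complex_of_real B"]])
      have "(\<lambda>n. (w (x + k n *\<^sub>R e) - w x) / k n) \<longlonglongrightarrow> w' x" for x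
        by (rule filterlim_compose[OF difference_quotient_tendsto[OF w] kf])
      then show "(\<lambda>n. ?Dw n x * g x) \<longlonglongrightarrow> complex_of_real (w' x) * g x" for x
        by (intro tendsto_mult tendsto_of_real tendsto_const)
      show "norm (?Dw n x * g x) \<le> norm (complex_of_real B * g x)" for n x
        using Dw_bound[of x n] B0 by (auto simp only: norm_mult norm_of_real abs_of_nonneg intro!: mult_right_mono norm_ge_zero)
    qed (use L2_measurable[OF LDw[OF wg(2)]] L2_measurable[OF Ldw[OF wg(2)]] in auto)
    then show "(\<lambda>n. L2norm (\<lambda>x. ?Dw n x * g x - complex_of_real (w' x) * g x)) \<longlonglongrightarrow> 0"
      by (simp add: L2norm_minus_commute)
  qed
  have "(\<integral>x. g' x * (w x * f x) \<partial>lebesgue)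
     = - (\<integral>x. f' x * (w x * g x) \<partial>lebesgue) - 0 - (\<integral>x. complex_of_real (w' x) * g x * f x \<partial>lebesgue)"
  proof (rule LIMSEQ_unique[OF l1])
    show "(\<lambda>n. \<integral>x. ?D g (- k n) x * (w x * f x) \<partial>lebesgue) \<longlonglongrightarrow>
      - (\<integral>x. f' x * (w x * g x) \<partial>lebesgue) - 0 - (\<integral>x. complex_of_real (w' x) * g x * f x \<partial>lebesgue)"
      by (rule Lim_transform_eventually[OF tendsto_diff[OF tendsto_diff[OF tendsto_minus[OF l2] l3] l4]])
         (rule always_eventually, rule allI, rule eq[symmetric])
  qed
  moreover have "(\<integral>x. (w x * f' x + w' x * f x) * g x \<partial>lebesgue)
     = (\<integral>x. f' x * (w x * g x) \<partial>lebesgue) + (\<integral>x. complex_of_real (w' x) * g x * f x \<partial>lebesgue)"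
  proof -
    have "(\<integral>x. (w x * f' x + w' x * f x) * g x \<partial>lebesgue)
       = (\<integral>x. f' x * (w x * g x) + complex_of_real (w' x) * g x * f x \<partial>lebesgue)"
      by (simp add: algebra_simps)
    also have "\<dots> = (\<integral>x. f' x * (w x * g x) \<partial>lebesgue) + (\<integral>x. complex_of_real (w' x) * g x * f x \<partial>lebesgue)"
      by (intro Bochner_Integration.integral_add L2_integrable_mult wf Lw Ldw wg)
    finally show ?thesis .
  qed
  ultimately show ?thesis by (simp add: mult_ac)
qed

section \<open>Decaying functions\<close>

lemma integrable_lebesgue_affine:
  fixes f :: "'a::euclidean_space \<Rightarrow> real"
  assumes s: "s > 0" and f: "f \<in> borel_measurable lebesgue" and i: "integrable lebesgue (\<lambda>z. f (x + s *\<^sub>R z))"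
  shows "integrable lebesgue f" and "(\<integral>y. f y \<partial>lebesgue) = s ^ DIM('a) * (\<integral>z. f (x + s *\<^sub>R z) \<partial>lebesgue)"
proof -
  have e: "(\<lambda>z. x + (\<Sum>j\<in>Basis. (s * (z \<bullet> j)) *\<^sub>R j)) = (\<lambda>z. x + s *\<^sub>R z)"
    by (simp add: scaleR_scaleR[symmetric] scaleR_sum_right[symmetric] euclidean_representation del: scaleR_scaleR)
  have T: "(\<lambda>z. x + s *\<^sub>R z) \<in> lebesgue \<rightarrow>\<^sub>M lebesgue"
    using lebesgue_affine_measurable[of "\<lambda>_. s" x] s by (simp add: e)
  have L: "lebesgue = density (distr lebesgue lebesgue (\<lambda>z. x + s *\<^sub>R z)) (\<lambda>_. ennreal (s ^ DIM('a)))"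
    using lebesgue_affine_euclidean[of "\<lambda>_. s" x] s by (simp add: e)
  have fd: "f \<in> borel_measurable (distr lebesgue lebesgue (\<lambda>z. x + s *\<^sub>R z))" using f by simp
  have "integrable (density (distr lebesgue lebesgue (\<lambda>z. x + s *\<^sub>R z)) (\<lambda>_. ennreal (s ^ DIM('a)))) f"
    using s i by (subst integrable_density) (auto simp: fd f integrable_distr_eq[OF T f])
  then show "integrable lebesgue f" by (subst L)
  have "integral\<^sup>L (density (distr lebesgue lebesgue (\<lambda>z. x + s *\<^sub>R z)) (\<lambda>_. ennreal (s ^ DIM('a)))) f
     = s ^ DIM('a) * (\<integral>z. f (x + s *\<^sub>R z) \<partial>lebesgue)"
    using s by (subst integral_density) (auto simp: fd f integral_distr[OF T f])
  then show "(\<integral>y. f y \<partial>lebesgue) = s ^ DIM('a) * (\<integral>z. f (x + s *\<^sub>R z) \<partial>lebesgue)"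
    using L by metis
qed

text \<open>Reflection reduces the line to a half-line, on which the primitive arctan is
  bounded.\<close>

lemma nn_integral_inverse_one_plus_square: "(\<integral>\<^sup>+x. ennreal (1 / (1 + x\<^sup>2)) \<partial>lborel) < \<infinity>"
proof -
  have A: "(\<integral>\<^sup>+x. ennreal (1 / (1 + x\<^sup>2)) * indicator {0..} x \<partial>lborel) = ennreal (pi / 2 - arctan 0)"
    by (rule nn_integral_FTC_atLeast[OF _ _ _ tendsto_arctan_at_top])
       (auto intro!: derivative_eq_intros simp: divide_inverse)
  have "(\<integral>\<^sup>+x. ennreal (1 / (1 + x\<^sup>2)) * indicator {..0} x \<partial>lborel)
    = (\<integral>\<^sup>+x. ennreal (1 / (1 + x\<^sup>2)) * indicator {0..} x \<partial>lborel)"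
    by (subst nn_integral_real_affine[of _ "-1" 0])
       (auto simp: indicator_def intro!: nn_integral_cong)
  then have B: "(\<integral>\<^sup>+x. ennreal (1 / (1 + x\<^sup>2)) * indicator {..0} x \<partial>lborel) = ennreal (pi / 2 - arctan 0)"
    using A by simp
  have "(\<integral>\<^sup>+x. ennreal (1 / (1 + x\<^sup>2)) \<partial>lborel)
    \<le> (\<integral>\<^sup>+x. ennreal (1 / (1 + x\<^sup>2)) * indicator {0..} x + ennreal (1 / (1 + x\<^sup>2)) * indicator {..0} x \<partial>lborel)"
    by (intro nn_integral_mono) (auto simp: indicator_def)
  also have "\<dots> = ennreal (pi / 2 - arctan 0) + ennreal (pi / 2 - arctan 0)"
    unfolding A[symmetric] by (subst nn_integral_add) (auto simp: A B)
  also have "\<dots> < \<infinity>" by simp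
  finally show ?thesis .
qed

text \<open>The product over the coordinates of 1 + z_b^2 is at most (1 + |z|^2)^d, so Tonelli's
  theorem reduces the claim to one variable.\<close>

lemma integrable_japanese_bracket:
  "integrable lebesgue (\<lambda>z::'a::euclidean_space. 1 / (1 + (norm z)\<^sup>2) ^ DIM('a))"
proof -
  have "(\<integral>\<^sup>+z. ennreal (norm (1 / (1 + (norm (z::'a))\<^sup>2) ^ DIM('a))) \<partial>lborel)
    \<le> (\<integral>\<^sup>+z. (\<Prod>b\<in>Basis. ennreal (1 / (1 + ((z::'a) \<bullet> b)\<^sup>2))) \<partial>lborel)"
  proof (intro nn_integral_mono)
    fix z :: 'a
    have "(\<Prod>b\<in>(Basis::'a set). 1 + (z \<bullet> b)\<^sup>2) \<le> (\<Prod>b\<in>(Basis::'a set). 1 + (norm z)\<^sup>2)"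
      by (intro prod_mono conjI add_left_mono) (auto simp: add_nonneg_nonneg abs_le_square_iff[symmetric] Basis_le_norm)
    then have "1 / (1 + (norm z)\<^sup>2) ^ DIM('a) \<le> 1 / (\<Prod>b\<in>(Basis::'a set). 1 + (z \<bullet> b)\<^sup>2)"
      by (intro divide_left_mono mult_pos_pos zero_less_power prod_pos) (auto simp: add_pos_nonneg)
    also have "\<dots> = (\<Prod>b\<in>(Basis::'a set). 1 / (1 + (z \<bullet> b)\<^sup>2))" by (simp add: prod_dividef)
    finally show "ennreal (norm (1 / (1 + (norm z)\<^sup>2) ^ DIM('a))) \<le> (\<Prod>b\<in>Basis. ennreal (1 / (1 + (z \<bullet> b)\<^sup>2)))"
      by (subst prod_ennreal) (auto intro!: ennreal_leI simp: add_nonneg_nonneg)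
  qed
  also have "\<dots> = (\<Prod>b\<in>(Basis::'a set). \<integral>\<^sup>+x. ennreal (1 / (1 + x\<^sup>2)) \<partial>lborel)"
    by (rule nn_integral_lborel_prod) auto
  also have "\<dots> < \<infinity>"
    using nn_integral_inverse_one_plus_square by (simp add: power_less_top_ennreal)
  finally have "integrable lborel (\<lambda>z::'a. 1 / (1 + (norm z)\<^sup>2) ^ DIM('a))"
    by (intro integrableI_bounded) auto
  then show ?thesis by (simp add: integrable_completion)
qed

section \<open>Quantitative classes of functions and their calculus\<close>

primrec bounded_derivs :: "nat \<Rightarrow> real \<Rightarrow> ('a::euclidean_space \<Rightarrow> real) \<Rightarrow> bool" where
  "bounded_derivs 0 B v \<longleftrightarrow> continuous_on UNIV v \<and> (\<forall>y. \<bar>v y\<bar> \<le> B)"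
| "bounded_derivs (Suc j) B v \<longleftrightarrow> (\<forall>y. v differentiable (at y)) \<and> (\<forall>y. \<bar>v y\<bar> \<le> B)
     \<and> (\<forall>i\<in>Basis. bounded_derivs j B (dderiv i v))"

text \<open>\<open>L\<close> is the amplitude, \<open>s\<close> the length scale and \<open>x\<close> the centre; each derivative costs a factor \<open>1/s\<close>.\<close>
primrec decaying :: "nat \<Rightarrow> nat \<Rightarrow> real \<Rightarrow> real \<Rightarrow> 'a::euclidean_space \<Rightarrow> ('a \<Rightarrow> complex) \<Rightarrow> bool" where
  "decaying N 0 L s x g \<longleftrightarrow> continuous_on UNIV g \<and>
     (\<forall>y. norm (g y) \<le> L / (1 + (norm (y - x) / s)\<^sup>2) ^ N)"
| "decaying N (Suc j) L s x g \<longleftrightarrow> (\<forall>y. g differentiable (at y)) \<and>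
     (\<forall>y. norm (g y) \<le> L / (1 + (norm (y - x) / s)\<^sup>2) ^ N) \<and>
     (\<forall>i\<in>Basis. decaying N j (L / s) s x (dderiv i g))"

lemma differentiable_imp_continuous_UNIV: "(\<forall>y. g differentiable (at y)) \<Longrightarrow> continuous_on UNIV g"
  by (simp add: differentiable_imp_continuous_within continuous_at_imp_continuous_on)

lemma decaying_bound: "decaying N j L s x g \<Longrightarrow> norm (g y) \<le> L / (1 + (norm (y - x) / s)\<^sup>2) ^ N"
  by (cases j) auto

lemma decaying_continuous: "decaying N j L s x g \<Longrightarrow> continuous_on UNIV g"
  by (cases j) (auto intro: differentiable_imp_continuous_UNIV)

lemma decaying_measurable: "decaying N j L s x g \<Longrightarrow> g \<in> borel_measurable lebesgue"
  by (rule measurable_completion) (simp add: borel_measurable_continuous_onI decaying_continuous)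

lemma decaying_nonneg: "decaying N j L s x g \<Longrightarrow> 0 \<le> L"
  using decaying_bound[of N j L s x g x] order_trans[OF norm_ge_zero[of "g x"], of L] by simp

lemma decaying_le_bound:
  assumes "decaying N j L s x g"
  shows "norm (g y) \<le> L"
proof -
  have "(1::real) \<le> (1 + (norm (y - x) / s)\<^sup>2) ^ N" by (intro one_le_power) simp
  then have "L / (1 + (norm (y - x) / s)\<^sup>2) ^ N \<le> L"
    using decaying_nonneg[OF assms] by (simp add: divide_le_eq mult_le_cancel_left1 mult_left_le)
  with decaying_bound[OF assms, of y] show ?thesis by linarith
qed

lemma decaying_Suc_D: "decaying N (Suc j) L s x g \<Longrightarrow> decaying N j L s x g"
proof (induction j arbitrary: L g)
  case 0
  then show ?case by (simp add: differentiable_imp_continuous_UNIV)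
next
  case (Suc j)
  then show ?case using Suc.IH[of "L / s"] by (simp only: decaying.simps(2)[of N "Suc j"] decaying.simps(2)[of N j]) blast
qed

lemma decaying_le: "decaying N j L s x g \<Longrightarrow> i \<le> j \<Longrightarrow> decaying N i L s x g"
  by (induction j) (auto simp: le_Suc_eq dest: decaying_Suc_D simp del: decaying.simps)

lemma decaying_mono: "decaying N j L s x g \<Longrightarrow> L \<le> M \<Longrightarrow> 0 < s \<Longrightarrow> decaying N j M s x g"
proof (induction j arbitrary: L M g)
  case 0
  have "L / (1 + (norm (y - x) / s)\<^sup>2) ^ N \<le> M / (1 + (norm (y - x) / s)\<^sup>2) ^ N" for y
    using 0 by (intro divide_right_mono) auto
  then show ?case using 0 by (auto intro: order_trans)
next
  case (Suc j)
  have "L / (1 + (norm (y - x) / s)\<^sup>2) ^ N \<le> M / (1 + (norm (y - x) / s)\<^sup>2) ^ N" for y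
    using Suc by (intro divide_right_mono) auto
  moreover have "L / s \<le> M / s" using Suc by (intro divide_right_mono) auto
  ultimately show ?case using Suc by (auto intro: order_trans)
qed

lemma decaying_add:
  "decaying N j L s x f \<Longrightarrow> decaying N j M s x g \<Longrightarrow> decaying N j (L + M) s x (\<lambda>y. f y + g y)"
proof (induction j arbitrary: L M f g)
  case 0
  then show ?case
    by (auto simp: add_divide_distrib intro: continuous_on_add norm_triangle_mono)
next
  case (Suc j)
  have "dderiv i (\<lambda>y. f y + g y) = (\<lambda>y. dderiv i f y + dderiv i g y)" for i
    using Suc.prems by (intro ext dderiv_add) auto
  then show ?case using Suc
    by (auto simp: add_divide_distrib intro: norm_triangle_mono)
qed

lemma dderiv_cmult:
  fixes f :: "'a::euclidean_space \<Rightarrow> complex"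
  assumes "f differentiable (at x)"
  shows "dderiv e (\<lambda>x. c * f x) x = c * dderiv e f x"
  using dderiv_mult[of "\<lambda>_. c" x f e] assms by (simp add: dderiv_const)

lemma decaying_cmult:
  "decaying N j L s x f \<Longrightarrow> decaying N j (norm c * L) s x (\<lambda>y. c * f y)"
proof (induction j arbitrary: L f)
  case 0
  then show ?case
    by (auto simp: norm_mult simp flip: times_divide_eq_right intro!: continuous_intros mult_left_mono)
next
  case (Suc j)
  have "dderiv i (\<lambda>y. c * f y) = (\<lambda>y. c * dderiv i f y)" for i
    using Suc.prems by (intro ext dderiv_cmult) auto
  then show ?case using Suc
    by (auto simp: norm_mult simp flip: times_divide_eq_right intro!: mult_left_mono)
qed

lemma decaying_sum:
  "finite I \<Longrightarrow> I \<noteq> {} \<Longrightarrow> (\<And>i. i \<in> I \<Longrightarrow> decaying N j L s x (f i))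
    \<Longrightarrow> decaying N j (real (card I) * L) s x (\<lambda>y. \<Sum>i\<in>I. f i y)"
proof (induction I rule: finite_ne_induct)
  case (insert i F)
  from decaying_add[OF insert.prems[of i] insert.IH] insert
  show ?case by (simp add: algebra_simps)
qed simp

lemma dderiv_of_real:
  fixes v :: "'a::euclidean_space \<Rightarrow> real"
  assumes "v differentiable (at x)"
  shows "(\<lambda>y. complex_of_real (v y)) differentiable (at x)"
    and "dderiv e (\<lambda>y. complex_of_real (v y)) x = complex_of_real (dderiv e v x)"
proof -
  have d: "((\<lambda>y. complex_of_real (v y)) has_derivative (\<lambda>h. complex_of_real (frechet_derivative v (at x) h))) (at x)"
    using frechet_dderiv(1)[OF assms] by (rule has_derivative_of_real)
  then show "(\<lambda>y. complex_of_real (v y)) differentiable (at x)" by (auto simp: differentiable_def)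
  show "dderiv e (\<lambda>y. complex_of_real (v y)) x = complex_of_real (dderiv e v x)"
    using dderiv_eqI[OF d] frechet_dderiv(2)[OF assms] by simp
qed

lemma bounded_derivs_Suc_D: "bounded_derivs (Suc j) B v \<Longrightarrow> bounded_derivs j B v"
proof (induction j arbitrary: v)
  case 0
  then show ?case by (simp add: differentiable_imp_continuous_UNIV)
next
  case (Suc j)
  then show ?case by (simp only: bounded_derivs.simps(2)[of "Suc j"] bounded_derivs.simps(2)[of j]) blast
qed

lemma bounded_derivs_le: "bounded_derivs j B v \<Longrightarrow> i \<le> j \<Longrightarrow> bounded_derivs i B v"
  by (induction j) (auto simp: le_Suc_eq dest: bounded_derivs_Suc_D simp del: bounded_derivs.simps)

lemma bounded_derivs_bound: "bounded_derivs j B v \<Longrightarrow> \<bar>v y\<bar> \<le> B"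
  by (cases j) auto

lemma bounded_derivs_mono: "bounded_derivs j B v \<Longrightarrow> B \<le> C \<Longrightarrow> bounded_derivs j C v"
  by (induction j arbitrary: v) (auto intro: order_trans)

text \<open>The Leibniz rule doubles the number of terms with each derivative, hence 2^j.
  Derivatives of \<open>v\<close> do not see the scale, and s <= 1 allows charging them the factor
  1/s of \<open>decaying\<close> all the same.\<close>

lemma decaying_mult:
  assumes "bounded_derivs j B v" "decaying N j L s x g" "0 < s" "s \<le> 1"
  shows "decaying N j (2 ^ j * B * L) s x (\<lambda>y. complex_of_real (v y) * g y)"
  using assms
proof (induction j arbitrary: L v g)
  case 0
  have "norm (complex_of_real (v y) * g y) \<le> B * (L / (1 + (norm (y - x) / s)\<^sup>2) ^ N)" for y
    unfolding norm_mult norm_of_real using 0 norm_ge_zero[of "g y"] abs_ge_zero[of "v y"]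
    by (intro mult_mono) (auto intro: order_trans)
  then show ?case using 0 by (auto intro!: continuous_intros)
next
  case (Suc j)
  note B = bounded_derivs_bound[OF Suc.prems(1)]
  have B0: "B \<ge> 0" using B[of x] by linarith
  have L0: "L \<ge> 0" by (rule decaying_nonneg[OF Suc.prems(2)])
  have v: "v differentiable (at y)" and g: "g differentiable (at y)" for y
    using Suc.prems by auto
  have "norm (complex_of_real (v y) * g y) \<le> B * (L / (1 + (norm (y - x) / s)\<^sup>2) ^ N)" for y
    unfolding norm_mult norm_of_real
    using B[of y] decaying_bound[OF Suc.prems(2), of y] B0 by (intro mult_mono) auto
  moreover have "B * (L / (1 + (norm (y - x) / s)\<^sup>2) ^ N)
       \<le> 2 ^ Suc j * B * L / (1 + (norm (y - x) / s)\<^sup>2) ^ N" for y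
  proof -
    have "1 * (B * L) \<le> 2 ^ Suc j * (B * L)"
      using B0 L0 by (intro mult_right_mono one_le_power) auto
    then show ?thesis by (simp add: divide_right_mono mult.assoc)
  qed
  moreover have "decaying N j (2 ^ Suc j * B * L / s) s x (dderiv i (\<lambda>y. complex_of_real (v y) * g y))"
    if i: "i \<in> Basis" for i
  proof -
    have e: "dderiv i (\<lambda>y. complex_of_real (v y) * g y)
       = (\<lambda>y. complex_of_real (v y) * dderiv i g y + complex_of_real (dderiv i v y) * g y)"
    proof
      fix y
      show "dderiv i (\<lambda>y. complex_of_real (v y) * g y) y
         = complex_of_real (v y) * dderiv i g y + complex_of_real (dderiv i v y) * g y"
        using dderiv_mult[OF dderiv_of_real(1)[OF v] g] dderiv_of_real(2)[OF v] by simp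
    qed
    have 1: "decaying N j (2 ^ j * B * (L / s)) s x (\<lambda>y. complex_of_real (v y) * dderiv i g y)"
      by (rule Suc.IH[OF bounded_derivs_Suc_D[OF Suc.prems(1)]]) (use Suc.prems i in auto)
    have 2: "decaying N j (2 ^ j * B * L) s x (\<lambda>y. complex_of_real (dderiv i v y) * g y)"
      by (rule Suc.IH[OF _ decaying_Suc_D[OF Suc.prems(2)]]) (use Suc.prems i in auto)
    show ?thesis unfolding e
    proof (rule decaying_mono[OF decaying_add[OF 1 2] _ \<open>0 < s\<close>])
      have "2 ^ j * B * L * s \<le> 2 ^ j * B * L * 1"
        using B0 L0 \<open>s \<le> 1\<close> by (intro mult_left_mono) auto
      then have "2 ^ j * B * L \<le> 2 ^ j * B * L / s"
        using \<open>0 < s\<close> by (simp add: le_divide_eq)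
      moreover have "2 ^ Suc j * B * L / s = 2 ^ j * B * L / s + 2 ^ j * B * L / s"
        unfolding mult_2[symmetric] by simp
      ultimately show "2 ^ j * B * (L / s) + 2 ^ j * B * L \<le> 2 ^ Suc j * B * L / s"
        unfolding times_divide_eq_right by linarith
    qed
  qed
  ultimately show ?case using v g dderiv_of_real(1)[OF v]
    by (auto intro: order_trans differentiable_mult)
qed

lemma decaying_dderiv: "decaying N (Suc j) L s x g \<Longrightarrow> i \<in> Basis \<Longrightarrow> decaying N j (L / s) s x (dderiv i g)"
  by simp

definition japanese_integral :: "'a::euclidean_space itself \<Rightarrow> real" where
  "japanese_integral _ = (\<integral>z. 1 / (1 + (norm (z::'a))\<^sup>2) ^ DIM('a) \<partial>lebesgue)"

text \<open>Since s <= 1, the weight is below its rescaled version. The decay exponent absorbs it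
  and still leaves (1 + |z|^2)^(-d), and the substitution y = x + s z produces s^d.\<close>

lemma decaying_moment:
  fixes g :: "'a::euclidean_space \<Rightarrow> complex"
  assumes g: "decaying N j L s x g" and s: "0 < s" "s \<le> 1" and k: "k + DIM('a) \<le> 2 * N"
  shows "integrable lebesgue (\<lambda>y. (1 + (norm (y - x))\<^sup>2) ^ k * (norm (g y))\<^sup>2)"
    and "(\<integral>y. (1 + (norm (y - x))\<^sup>2) ^ k * (norm (g y))\<^sup>2 \<partial>lebesgue)
      \<le> L\<^sup>2 * s ^ DIM('a) * japanese_integral TYPE('a)"
proof -
  let ?P = "\<lambda>z::'a. 1 / (1 + (norm z)\<^sup>2) ^ DIM('a)"
  let ?Q = "\<lambda>y. ?P ((y - x) /\<^sub>R s)"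
  have Qm: "?Q \<in> borel_measurable lebesgue" by (rule measurable_completion) simp
  have QP: "?Q (x + s *\<^sub>R z) = ?P z" for z using s by simp
  have Qi: "integrable lebesgue ?Q" and Qe: "(\<integral>y. ?Q y \<partial>lebesgue) = s ^ DIM('a) * japanese_integral TYPE('a)"
    using integrable_lebesgue_affine[OF s(1) Qm, of x, unfolded QP] integrable_japanese_bracket
    by (auto simp: japanese_integral_def)
  have le: "(1 + (norm (y - x))\<^sup>2) ^ k * (norm (g y))\<^sup>2 \<le> L\<^sup>2 * ?Q y" for y
  proof -
    let ?a = "1 + (norm (y - x) / s)\<^sup>2"
    have a1: "?a \<ge> 1" by simp
    have "norm (y - x) \<le> norm (y - x) / s"
      using s by (simp add: le_divide_eq mult_left_le)
    then have "1 + (norm (y - x))\<^sup>2 \<le> ?a" by (intro add_left_mono power_mono) auto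
    then have 1: "(1 + (norm (y - x))\<^sup>2) ^ k \<le> ?a ^ k" by (intro power_mono) auto
    have "(norm (g y))\<^sup>2 \<le> (L / ?a ^ N)\<^sup>2" by (intro power_mono decaying_bound[OF g]) auto
    then have 2: "(norm (g y))\<^sup>2 \<le> L\<^sup>2 / ?a ^ (2 * N)" by (simp add: power_divide power_mult mult.commute flip: power_mult)
    have "(1 + (norm (y - x))\<^sup>2) ^ k * (norm (g y))\<^sup>2 \<le> ?a ^ k * (L\<^sup>2 / ?a ^ (2 * N))"
      using 1 2 by (intro mult_mono) auto
    also have "\<dots> \<le> L\<^sup>2 / ?a ^ DIM('a)"
    proof -
      have "?a ^ (k + DIM('a)) \<le> ?a ^ (2 * N)" using k a1 by (intro power_increasing) auto
      then have "?a ^ k / ?a ^ (2 * N) \<le> 1 / ?a ^ DIM('a)"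
        using a1 by (simp add: power_add divide_simps)
      from mult_left_mono[OF this, of "L\<^sup>2"] show ?thesis by (simp add: mult_ac)
    qed
    also have "\<dots> = L\<^sup>2 * ?Q y" using s by (simp add: divide_inverse mult.commute)
    finally show ?thesis .
  qed
  show i: "integrable lebesgue (\<lambda>y. (1 + (norm (y - x))\<^sup>2) ^ k * (norm (g y))\<^sup>2)"
  proof (rule Bochner_Integration.integrable_bound[OF integrable_mult_right[of "L\<^sup>2"]])
    show "integrable lebesgue ?Q" by (rule Qi)
    have "(\<lambda>y. (1 + (norm (y - x))\<^sup>2) ^ k) \<in> borel_measurable lebesgue"
      by (rule measurable_completion) simp
    then show "(\<lambda>y. (1 + (norm (y - x))\<^sup>2) ^ k * (norm (g y))\<^sup>2) \<in> borel_measurable lebesgue"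
      using decaying_measurable[OF g] by measurable
    show "AE y in lebesgue. norm ((1 + (norm (y - x))\<^sup>2) ^ k * (norm (g y))\<^sup>2) \<le> norm (L\<^sup>2 * ?Q y)"
    proof (rule AE_I2)
      fix y
      have "0 \<le> (1 + (norm (y - x))\<^sup>2) ^ k * (norm (g y))\<^sup>2"
        by (intro mult_nonneg_nonneg zero_le_power) auto
      then show "norm ((1 + (norm (y - x))\<^sup>2) ^ k * (norm (g y))\<^sup>2) \<le> norm (L\<^sup>2 * ?Q y)"
        using le[of y] by (metis abs_of_nonneg order_trans real_norm_def)
    qed
  qed
  have "(\<integral>y. (1 + (norm (y - x))\<^sup>2) ^ k * (norm (g y))\<^sup>2 \<partial>lebesgue) \<le> (\<integral>y. L\<^sup>2 * ?Q y \<partial>lebesgue)"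
    by (rule integral_mono[OF i]) (rule integrable_mult_right, rule Qi, rule le)
  also have "\<dots> = L\<^sup>2 * s ^ DIM('a) * japanese_integral TYPE('a)"
    unfolding integral_mult_right_zero Qe by simp
  finally show "(\<integral>y. (1 + (norm (y - x))\<^sup>2) ^ k * (norm (g y))\<^sup>2 \<partial>lebesgue)
      \<le> L\<^sup>2 * s ^ DIM('a) * japanese_integral TYPE('a)" .
qed

lemma decaying_L2:
  fixes g :: "'a::euclidean_space \<Rightarrow> complex"
  assumes g: "decaying N j L s x g" and s: "0 < s" "s \<le> 1" and k: "DIM('a) \<le> 2 * N"
  shows "L2 g" and "(L2norm g)\<^sup>2 \<le> L\<^sup>2 * s ^ DIM('a) * japanese_integral TYPE('a)"
  using decaying_moment[OF g s, of 0] k decaying_measurable[OF g]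
  by (auto simp: L2_def L2norm_power2)

section \<open>From classical to weak derivatives\<close>

section \<open>The weak Laplacian\<close>

text \<open>The difference quotients of \<open>F\<close> times a test function have integral 0 by
  translation invariance. Dominated convergence passes this to the derivative of the product, and
  the product rule finishes.\<close>

lemma weak_deriv_classical:
  fixes F :: "'a::euclidean_space \<Rightarrow> complex"
  assumes F: "\<And>y. F differentiable (at y)" "L2 F" "L2 (dderiv e F)"
    and FB: "\<And>y. norm (F y) \<le> B" "\<And>y. norm (dderiv e F y) \<le> B" and e: "e \<in> Basis"
  shows "weak_deriv [e] F (dderiv e F)"
  unfolding weak_deriv_def
proof (intro allI impI)
  fix \<phi> :: "'a \<Rightarrow> real" assume \<phi>: "test_fun \<phi>"
  let ?H = "\<lambda>y. F y * complex_of_real (\<phi> y)"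
  let ?dH = "\<lambda>y. F y * complex_of_real (dderiv e \<phi> y) + dderiv e F y * complex_of_real (\<phi> y)"
  define k where "k = (\<lambda>n. 1 / real (Suc n))"
  have k: "k n > 0" "k n \<le> 1" for n by (auto simp: k_def)
  have k0: "k \<longlonglongrightarrow> 0" unfolding k_def by (rule LIMSEQ_inverse_real_of_nat[unfolded inverse_eq_divide])
  have kf: "filterlim k (at 0) sequentially"
    using k0 k(1) by (auto simp: filterlim_at intro!: always_eventually) (metis less_irrefl)
  let ?q = "\<lambda>n y. (?H (y + k n *\<^sub>R e) - ?H y) /\<^sub>R k n"
  note d\<phi> = test_fun_differentiable[OF \<phi>]
  have dH: "((\<lambda>h. ?H (y + h *\<^sub>R e)) has_vector_derivative ?dH y) (at 0)" for y
  proof -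
    have "?H differentiable (at (y + 0 *\<^sub>R e))"
      by (intro differentiable_mult F dderiv_of_real(1) d\<phi>)
    from dderiv_works[OF this] show ?thesis
      using dderiv_mult[OF F(1) dderiv_of_real(1)[OF d\<phi>], of e y]
      by (simp add: dderiv_of_real(2)[OF d\<phi>])
  qed
  obtain M where M: "M > 0" "\<And>y. \<bar>\<phi> y\<bar> \<le> M" using test_fun_bounded[OF \<phi>] by metis
  obtain M' where M': "M' > 0" "\<And>y. \<bar>dderiv e \<phi> y\<bar> \<le> M'"
    using test_fun_bounded[OF test_fun_dderiv[OF \<phi> e]] by metis
  obtain R where R: "\<And>x. \<phi> x \<noteq> 0 \<Longrightarrow> norm x \<le> R" using test_fun_support[OF \<phi>] by metis
  have B0: "B \<ge> 0" using FB(1)[of 0] norm_ge_zero order_trans by blast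
  \<comment> \<open>Bounds the derivative of the product and so, by the mean value theorem, every
    difference quotient; steps of at most 1 keep all of them supported in the ball of radius R +
    1.\<close>
  define C where "C = B * M' + B * M"
  have dHB: "norm (?dH y) \<le> C" for y
    unfolding C_def
    by (rule norm_triangle_le) (use FB M M' B0 in \<open>auto simp: norm_mult intro!: add_mono mult_mono\<close>)
  have C0: "C \<ge> 0" using dHB[of 0] norm_ge_zero order_trans by blast
  note L\<phi> = test_fun_L2[OF \<phi>] and Ld\<phi> = test_fun_L2[OF test_fun_dderiv[OF \<phi> e]]
  have iH: "integrable lebesgue ?H" by (intro L2_integrable_mult F L\<phi>)
  have i1: "integrable lebesgue (\<lambda>y. F y * complex_of_real (dderiv e \<phi> y))"
    by (intro L2_integrable_mult F Ld\<phi>)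
  have i2: "integrable lebesgue (\<lambda>y. dderiv e F y * complex_of_real (\<phi> y))"
    by (intro L2_integrable_mult F L\<phi>)
  have Hm: "?H \<in> borel_measurable lebesgue" using iH by auto
  have q0: "(\<integral>y. ?q n y \<partial>lebesgue) = 0" for n
  proof -
    have "(\<integral>y. ?q n y \<partial>lebesgue) = ((\<integral>y. ?H (y + k n *\<^sub>R e) \<partial>lebesgue) - (\<integral>y. ?H y \<partial>lebesgue)) /\<^sub>R k n"
      using iH integrable_translate[OF Hm, of "k n *\<^sub>R e"] by simp
    also have "\<dots> = 0" using integral_translate[OF Hm, of "k n *\<^sub>R e"] by simp
    finally show ?thesis .
  qed
  have "(\<lambda>n. \<integral>y. ?q n y \<partial>lebesgue) \<longlonglongrightarrow> (\<integral>y. ?dH y \<partial>lebesgue)"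
  proof (rule integral_dominated_convergence)
    show "?dH \<in> borel_measurable lebesgue" using i1 i2 by auto
    show "?q n \<in> borel_measurable lebesgue" for n
      using Hm measurable_translate[OF Hm, of "k n *\<^sub>R e"] by (intro borel_measurable_scaleR borel_measurable_diff) auto
    show "integrable lebesgue (\<lambda>y::'a. C * indicator (cball 0 (R + 1)) y)"
      by (intro integrable_mult_right) (use lmeasurable_cball lmeasurable_iff_integrable in blast)
    have "(\<lambda>n. ?q n y) \<longlonglongrightarrow> ?dH y" for y
      using dH[of y] unfolding has_vector_derivative_quotient_iff
      by (intro filterlim_compose[OF _ kf]) simp
    then show "AE y in lebesgue. (\<lambda>n. ?q n y) \<longlonglongrightarrow> ?dH y" by simp
    have "norm (?q n y) \<le> C * indicator (cball 0 (R + 1)) y" for n y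
    proof (cases "norm y \<le> R + 1")
      case True
      have "norm (?H (y + k n *\<^sub>R e) - ?H y) \<le> C * \<bar>k n\<bar>"
        by (rule directional_lipschitz[OF dH dHB])
      then have "norm (?H (y + k n *\<^sub>R e) - ?H y) / k n \<le> C"
        using k(1)[of n] by (simp add: pos_divide_le_eq)
      moreover have "norm (?q n y) = norm (?H (y + k n *\<^sub>R e) - ?H y) / k n"
        unfolding norm_scaleR using k(1)[of n] by (simp add: divide_inverse mult.commute)
      ultimately show ?thesis using True by simp
    next
      case False
      have "norm y \<le> norm (y + k n *\<^sub>R e) + norm (k n *\<^sub>R e)"
        using norm_triangle_ineq4[of "y + k n *\<^sub>R e" "k n *\<^sub>R e"] by simp
      then have "norm y \<le> norm (y + k n *\<^sub>R e) + 1" using k[of n] e by simp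
      then have "\<phi> y = 0 \<and> \<phi> (y + k n *\<^sub>R e) = 0"
        using R[of y] R[of "y + k n *\<^sub>R e"] False by fastforce
      then show ?thesis using False by simp
    qed
    then show "AE y in lebesgue. norm (?q n y) \<le> C * indicator (cball 0 (R + 1)) y" for n by simp
  qed
  then have "(\<integral>y. ?dH y \<partial>lebesgue) = 0"
    unfolding q0 by (simp add: LIMSEQ_const_iff)
  then show "(\<integral>x. F x * complex_of_real (iterdiff [e] \<phi> x) \<partial>lebesgue)
      = (-1) ^ length [e] * (\<integral>x. dderiv e F x * complex_of_real (\<phi> x) \<partial>lebesgue)"
    using i1 i2 by (simp add: add_eq_0_iff2)
qed

section \<open>Second-order weak derivatives and membership in \<open>H2\<close>\<close>

lemma weak_deriv_append:
  assumes "weak_deriv [i] f g" "weak_deriv [j] g h" "j \<in> Basis"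
  shows "weak_deriv [i, j] f h"
  unfolding weak_deriv_def
proof (intro allI impI)
  fix \<phi> :: "'a \<Rightarrow> real" assume \<phi>: "test_fun \<phi>"
  note \<phi>' = test_fun_dderiv[OF \<phi> assms(3)]
  from assms(1)[unfolded weak_deriv_def, rule_format, OF \<phi>']
    assms(2)[unfolded weak_deriv_def, rule_format, OF \<phi>]
  show "(\<integral>x. f x * complex_of_real (iterdiff [i, j] \<phi> x) \<partial>lebesgue)
      = (-1) ^ length [i, j] * (\<integral>x. h x * complex_of_real (\<phi> x) \<partial>lebesgue)"
    by simp
qed

text \<open>Representatives of first and second weak derivatives are chosen independently of each
  other; this makes the second a weak derivative of the first, as integration by parts
  requires.\<close>

lemma weak_deriv_tail:
  assumes "weak_deriv [i] f g" "weak_deriv [i, j] f h" "j \<in> Basis"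
  shows "weak_deriv [j] g h"
  unfolding weak_deriv_def
proof (intro allI impI)
  fix \<phi> :: "'a \<Rightarrow> real" assume \<phi>: "test_fun \<phi>"
  note \<phi>' = test_fun_dderiv[OF \<phi> assms(3)]
  from assms(1)[unfolded weak_deriv_def, rule_format, OF \<phi>']
    assms(2)[unfolded weak_deriv_def, rule_format, OF \<phi>]
  have "- (\<integral>x. g x * complex_of_real (dderiv j \<phi> x) \<partial>lebesgue) = (\<integral>x. h x * complex_of_real (\<phi> x) \<partial>lebesgue)"
    by simp
  then show "(\<integral>x. g x * complex_of_real (iterdiff [j] \<phi> x) \<partial>lebesgue)
      = (-1) ^ length [j] * (\<integral>x. h x * complex_of_real (\<phi> x) \<partial>lebesgue)"
    by (simp add: minus_equation_iff[symmetric] del: add_uminus_conv_diff)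
qed

lemma lists_le_2:
  assumes "ds \<in> lists A" "length ds \<le> 2"
  obtains "ds = []" | i where "i \<in> A" "ds = [i]" | i j where "i \<in> A" "j \<in> A" "ds = [i, j]"
proof (cases ds)
  case (Cons i es)
  with assms show thesis by (cases es) (auto intro: that)
qed (rule that(1))

lemma decaying_weak_deriv:
  assumes g: "decaying N (Suc j) L s x g" and s: "0 < s" "s \<le> 1" and N: "DIM('a) \<le> 2 * N"
    and e: "e \<in> (Basis :: 'a::euclidean_space set)"
  shows "weak_deriv [e] g (dderiv e g)"
proof (rule weak_deriv_classical[OF _ _ _ _ _ e])
  note dg = decaying_dderiv[OF g e]
  show "g differentiable (at y)" for y using g by simp
  show "L2 g" "L2 (dderiv e g)" by (rule decaying_L2(1)[OF _ s N], rule g dg)+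
  show "norm (g y) \<le> max L (L / s)" "norm (dderiv e g y) \<le> max L (L / s)" for y
    using decaying_le_bound[OF g, of y] decaying_le_bound[OF dg, of y] by auto
qed

lemma decaying_H2:
  fixes g :: "'a::euclidean_space \<Rightarrow> complex"
  assumes g: "decaying N (Suc (Suc j)) L s x g" and s: "0 < s" "s \<le> 1" and N: "DIM('a) \<le> 2 * N"
  shows "H2 g"
  unfolding H2_def
proof (intro conjI ballI impI)
  show Lg: "L2 g" by (rule decaying_L2(1)[OF g s N])
  fix ds :: "'a list" assume "ds \<in> lists Basis" "length ds \<le> 2"
  then show "\<exists>h. L2 h \<and> weak_deriv ds g h"
  proof (cases rule: lists_le_2)
    case 1
    then show ?thesis using Lg by (auto simp: weak_deriv_def intro!: exI[of _ g])
  next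
    case (2 i)
    then show ?thesis
      using decaying_weak_deriv[OF g s N] decaying_L2(1)[OF decaying_dderiv[OF g] s N] by blast
  next
    case (3 i k)
    note dg = decaying_dderiv[OF g 3(1)]
    show ?thesis
      using weak_deriv_append[OF decaying_weak_deriv[OF g s N 3(1)] decaying_weak_deriv[OF dg s N 3(2)] 3(2)]
        decaying_L2(1)[OF decaying_dderiv[OF dg 3(2)] s N] 3(3) by blast
  qed
qed

lemma H2_L2: "H2 f \<Longrightarrow> L2 f"
  by (simp add: H2_def)

definition grad_rep :: "('a::euclidean_space \<Rightarrow> complex) \<Rightarrow> 'a \<Rightarrow> 'a \<Rightarrow> complex" where
  "grad_rep f i = (SOME g. L2 g \<and> weak_deriv [i] f g)"

text \<open>Literally the choice term inside \<open>lap\<close>, so that \<open>lap\<close> becomes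
  a sum of these by unfolding.\<close>

definition hess_rep :: "('a::euclidean_space \<Rightarrow> complex) \<Rightarrow> 'a \<Rightarrow> 'a \<Rightarrow> complex" where
  "hess_rep f i = (SOME g. L2 g \<and> weak_deriv [i, i] f g)"

lemma lap_hess_rep: "lap f = (\<lambda>x. \<Sum>i\<in>Basis. hess_rep f i x)"
  by (simp add: lap_def hess_rep_def)

lemma H2_grad_rep:
  assumes "H2 f" "i \<in> Basis"
  shows "L2 (grad_rep f i)" "weak_deriv [i] f (grad_rep f i)"
proof -
  have "\<exists>g. L2 g \<and> weak_deriv [i] f g" using assms by (auto simp: H2_def)
  from someI_ex[OF this] show "L2 (grad_rep f i)" "weak_deriv [i] f (grad_rep f i)"
    by (auto simp: grad_rep_def)
qed

lemma H2_hess_rep: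
  assumes "H2 f" "i \<in> Basis"
  shows "L2 (hess_rep f i)" "weak_deriv [i, i] f (hess_rep f i)" "weak_deriv [i] (grad_rep f i) (hess_rep f i)"
proof -
  have "\<exists>g. L2 g \<and> weak_deriv [i, i] f g" using assms by (auto simp: H2_def)
  from someI_ex[OF this] show "L2 (hess_rep f i)" "weak_deriv [i, i] f (hess_rep f i)"
    by (auto simp: hess_rep_def)
  then show "weak_deriv [i] (grad_rep f i) (hess_rep f i)"
    using weak_deriv_tail[OF H2_grad_rep(2)[OF assms] _ assms(2)] by blast
qed

lemma L2_lap: "H2 f \<Longrightarrow> L2 (lap f)"
  unfolding lap_hess_rep by (intro L2_sum H2_hess_rep)

text \<open>Weak derivatives are unique almost everywhere, so the arbitrary choice in
  \<open>lap\<close> may be replaced by any convenient representatives.\<close>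

lemma lap_eqI:
  assumes "H2 f" and h: "\<And>i. i \<in> Basis \<Longrightarrow> L2 (h i)" "\<And>i. i \<in> Basis \<Longrightarrow> weak_deriv [i, i] f (h i)"
  shows "AE x in lebesgue. lap f x = (\<Sum>i\<in>Basis. h i x)"
proof -
  have "AE x in lebesgue. \<forall>i\<in>Basis. hess_rep f i x = h i x"
    by (intro AE_finite_allI finite_Basis weak_deriv_unique[OF H2_hess_rep(2)[OF assms(1)] h(2)] H2_hess_rep assms)
  then show ?thesis by eventually_elim (simp add: lap_hess_rep)
qed

definition lap_classical :: "('a::euclidean_space \<Rightarrow> complex) \<Rightarrow> 'a \<Rightarrow> complex" where
  "lap_classical g = (\<lambda>y. \<Sum>i\<in>Basis. dderiv i (dderiv i g) y)"

lemma lap_decaying: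
  fixes g :: "'a::euclidean_space \<Rightarrow> complex"
  assumes g: "decaying N (Suc (Suc j)) L s x g" and s: "0 < s" "s \<le> 1" and N: "DIM('a) \<le> 2 * N"
  shows "AE y in lebesgue. lap g y = lap_classical g y"
  unfolding lap_classical_def
proof (rule lap_eqI[OF decaying_H2[OF g s N]])
  fix i :: 'a assume i: "i \<in> Basis"
  note dg = decaying_dderiv[OF g i]
  show "L2 (dderiv i (dderiv i g))" by (rule decaying_L2(1)[OF decaying_dderiv[OF dg i] s N])
  show "weak_deriv [i, i] g (dderiv i (dderiv i g))"
    by (rule weak_deriv_append[OF decaying_weak_deriv[OF g s N i] decaying_weak_deriv[OF dg s N i] i])
qed

lemma decaying_lap_classical:
  fixes g :: "'a::euclidean_space \<Rightarrow> complex"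
  assumes g: "decaying N (Suc (Suc j)) L s x g" 
  shows "decaying N j (real DIM('a) * (L / s / s)) s x (lap_classical g)"
  unfolding lap_classical_def
  by (rule decaying_sum) (use g in auto)

lemma weak_deriv_linear:
  assumes "weak_deriv ds f f'" "weak_deriv ds g g'" "L2 f" "L2 f'" "L2 g" "L2 g'" "ds \<in> lists Basis"
  shows "weak_deriv ds (\<lambda>x. f x + c * g x) (\<lambda>x. f' x + c * g' x)"
  unfolding weak_deriv_def
proof (intro allI impI)
  fix \<phi> :: "'a \<Rightarrow> real" assume \<phi>: "test_fun \<phi>"
  have it: "test_fun (iterdiff ds \<phi>)"
    using assms(7) by induction (auto simp: \<phi> test_fun_dderiv)
  have lin: "(\<integral>x. (u x + c * v x) * complex_of_real (\<psi> x) \<partial>lebesgue)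
    = (\<integral>x. u x * complex_of_real (\<psi> x) \<partial>lebesgue) + c * (\<integral>x. v x * complex_of_real (\<psi> x) \<partial>lebesgue)"
    if "L2 u" "L2 v" "test_fun \<psi>" for u v and \<psi> :: "'a \<Rightarrow> real"
    using L2_integrable_mult[OF that(1) test_fun_L2[OF that(3)]] L2_integrable_mult[OF that(2) test_fun_L2[OF that(3)]]
    by (simp add: distrib_right mult.assoc)
  show "(\<integral>x. (f x + c * g x) * complex_of_real (iterdiff ds \<phi> x) \<partial>lebesgue)
    = (-1) ^ length ds * (\<integral>x. (f' x + c * g' x) * complex_of_real (\<phi> x) \<partial>lebesgue)"
    unfolding lin[OF assms(3,5) it] lin[OF assms(4,6) \<phi>]
      assms(1)[unfolded weak_deriv_def, rule_format, OF \<phi>] assms(2)[unfolded weak_deriv_def, rule_format, OF \<phi>]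
    by (simp add: distrib_left mult.left_commute)
qed

lemma H2_linear:
  assumes "H2 f" "H2 g"
  shows "H2 (\<lambda>x. f x + c * g x)"
  unfolding H2_def
proof (intro conjI ballI impI)
  show "L2 (\<lambda>x. f x + c * g x)" using assms by (intro L2_add L2_cmult H2_L2)
  fix ds :: "'a list" assume ds: "ds \<in> lists Basis" "length ds \<le> 2"
  then obtain f' g' where "L2 f'" "weak_deriv ds f f'" "L2 g'" "weak_deriv ds g g'"
    using assms by (metis H2_def)
  then show "\<exists>h. L2 h \<and> weak_deriv ds (\<lambda>x. f x + c * g x) h"
    using weak_deriv_linear[of ds f f' g g' c] assms ds
    by (intro exI[of _ "\<lambda>x. f' x + c * g' x"]) (auto intro: L2_add L2_cmult H2_L2)
qed

lemma lap_linear: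
  assumes "H2 f" "H2 g"
  shows "AE x in lebesgue. lap (\<lambda>x. f x + c * g x) x = lap f x + c * lap g x"
proof -
  have "AE x in lebesgue. lap (\<lambda>x. f x + c * g x) x = (\<Sum>i\<in>Basis. hess_rep f i x + c * hess_rep g i x)"
    by (rule lap_eqI[OF H2_linear[OF assms]])
       (use assms in \<open>auto intro!: L2_add L2_cmult H2_hess_rep weak_deriv_linear intro: H2_L2\<close>)
  then show ?thesis by (simp add: lap_hess_rep sum.distrib sum_distrib_left)
qed

section \<open>Schwartz functions and the potential\<close>

text \<open>Polynomials times the standard Gaussian, in a form closed under directional derivatives,
  so that one induction bounds all derivatives of the Gaussian.\<close>

inductive hermite_alg :: "('a::euclidean_space \<Rightarrow> complex) \<Rightarrow> bool" where
  gaussian: "hermite_alg (\<lambda>y. complex_of_real (exp (- (y \<bullet> y) / 2)))"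
| coord: "hermite_alg f \<Longrightarrow> hermite_alg (\<lambda>y. complex_of_real (y \<bullet> a) * f y)"
| cmult: "hermite_alg f \<Longrightarrow> hermite_alg (\<lambda>y. c * f y)"
| add: "hermite_alg f \<Longrightarrow> hermite_alg g \<Longrightarrow> hermite_alg (\<lambda>y. f y + g y)"

lemma hermite_alg_dderiv:
  assumes "hermite_alg f"
  shows "(\<forall>x. f differentiable (at x)) \<and> (\<forall>j. hermite_alg (dderiv j f))"
  using assms
proof induction
  case gaussian
  let ?f = "\<lambda>y::'a. exp (- (y \<bullet> y) / 2)"
  have d: "(?f has_derivative (\<lambda>v. - (x \<bullet> v) * exp (- (x \<bullet> x) / 2))) (at x)" for x
    by (auto intro!: derivative_eq_intros simp: inner_commute)
  then have df: "?f differentiable (at x)" for x by (auto simp: differentiable_def)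
  have "dderiv j (\<lambda>y. complex_of_real (?f y)) = (\<lambda>y. (-1) * (complex_of_real (y \<bullet> j) * complex_of_real (?f y)))" for j
  proof
    fix x
    show "dderiv j (\<lambda>y. complex_of_real (?f y)) x = (-1) * (complex_of_real (x \<bullet> j) * complex_of_real (?f x))"
      unfolding dderiv_of_real(2)[OF df] dderiv_eqI[OF d] by simp
  qed
  then have "hermite_alg (dderiv j (\<lambda>y. complex_of_real (?f y)))" for j
    by (simp only:) (intro hermite_alg.cmult hermite_alg.coord hermite_alg.gaussian)
  then show ?case using dderiv_of_real(1)[OF df] by blast
next
  case (coord f a)
  have d: "((\<lambda>y. complex_of_real (y \<bullet> a)) has_derivative (\<lambda>v. complex_of_real (v \<bullet> a))) (at x)" for x :: 'a
    by (auto intro!: derivative_eq_intros)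
  then have dc: "(\<lambda>y. complex_of_real (y \<bullet> a)) differentiable (at x)" for x :: 'a
    by (auto simp: differentiable_def)
  have "dderiv j (\<lambda>y. complex_of_real (y \<bullet> a) * f y)
    = (\<lambda>y. complex_of_real (y \<bullet> a) * dderiv j f y + complex_of_real (j \<bullet> a) * f y)" for j
    using coord by (intro ext) (simp add: dderiv_mult[OF dc] dderiv_eqI[OF d])
  then show ?case using coord dc by (auto intro!: hermite_alg.intros differentiable_mult)
next
  case (cmult f c)
  then have "dderiv j (\<lambda>y. c * f y) = (\<lambda>y. c * dderiv j f y)" for j
    by (intro ext dderiv_cmult) auto
  then show ?case using cmult by (auto intro!: hermite_alg.cmult)
next
  case (add f g)
  then have "dderiv j (\<lambda>y. f y + g y) = (\<lambda>y. dderiv j f y + dderiv j g y)" for j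
    by (intro ext dderiv_add) auto
  then show ?case using add by (auto intro!: hermite_alg.add)
qed

lemma hermite_alg_bound:
  assumes "hermite_alg f"
  shows "\<exists>B. \<forall>y. norm y ^ k * norm (f y) \<le> B"
  using assms
proof (induction arbitrary: k)
  case gaussian
  have "norm y ^ k * exp (- (y \<bullet> y) / 2) \<le> 1 + 2 ^ k * fact k" for y :: 'a
  proof -
    \<comment> \<open>The detour through the even power 2k produces a power of y \<bullet> y, to
      which the exponential bound applies.\<close>
    have "norm y ^ k \<le> 1 + norm y ^ (2 * k)"
    proof (cases "norm y \<le> 1")
      case True
      then have "norm y ^ k \<le> 1" by (simp add: power_le_one)
      then show ?thesis by (simp add: add_increasing2)
    next
      case False
      then have "norm y ^ k \<le> norm y ^ (2 * k)" by (intro power_increasing) auto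
      then show ?thesis by simp
    qed
    then have "norm y ^ k * exp (- (y \<bullet> y) / 2) \<le> (1 + norm y ^ (2 * k)) * exp (- (y \<bullet> y) / 2)"
      by (intro mult_right_mono) auto
    also have "\<dots> \<le> 1 + norm y ^ (2 * k) * exp (- (y \<bullet> y) / 2)" by (simp add: distrib_right)
    also have "norm y ^ (2 * k) = 2 ^ k * ((y \<bullet> y) / 2) ^ k"
      by (simp add: power_mult power2_norm_eq_inner power_divide)
    also have "2 ^ k * ((y \<bullet> y) / 2) ^ k * exp (- (y \<bullet> y) / 2)
       \<le> 2 ^ k * (fact k * exp ((y \<bullet> y) / 2)) * exp (- (y \<bullet> y) / 2)"
      by (intro mult_right_mono mult_left_mono exp_ge_power) auto
    also have "\<dots> = 2 ^ k * fact k" by (simp add: mult.assoc flip: exp_add)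
    finally show ?thesis by simp
  qed
  then show ?case by (intro exI[of _ "1 + 2 ^ k * fact k"]) (simp add: norm_mult)
next
  case (coord f a)
  \<comment> \<open>A coordinate factor costs one more power of the norm, which is why the induction
    is over all k.\<close>
  obtain B where B: "\<And>y. norm y ^ Suc k * norm (f y) \<le> B" using coord.IH[of "Suc k"] by blast
  have "norm y ^ k * norm (complex_of_real (y \<bullet> a) * f y) \<le> norm a * B" for y
  proof -
    have "norm y ^ k * norm (complex_of_real (y \<bullet> a) * f y) \<le> norm y ^ k * ((norm y * norm a) * norm (f y))"
      by (intro mult_left_mono) (auto simp: norm_mult intro!: mult_right_mono Cauchy_Schwarz_ineq2)
    also have "\<dots> = norm a * (norm y ^ Suc k * norm (f y))" by simp
    also have "\<dots> \<le> norm a * B" by (intro mult_left_mono B) auto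
    finally show ?thesis .
  qed
  then show ?case by blast
next
  case (cmult f c)
  obtain B where B: "\<And>y. norm y ^ k * norm (f y) \<le> B" using cmult.IH[of k] by blast
  have "norm y ^ k * norm (c * f y) \<le> norm c * B" for y
    using mult_left_mono[OF B, of "norm c" y] by (simp add: norm_mult mult.left_commute)
  then show ?case by blast
next
  case (add f g)
  obtain B C where B: "\<And>y. norm y ^ k * norm (f y) \<le> B" and C: "\<And>y. norm y ^ k * norm (g y) \<le> C"
    using add.IH[of k] by blast
  have "norm y ^ k * norm (f y + g y) \<le> B + C" for y
  proof -
    have "norm y ^ k * norm (f y + g y) \<le> norm y ^ k * (norm (f y) + norm (g y))"
      by (intro mult_left_mono norm_triangle_ineq) auto
    then show ?thesis using B[of y] C[of y] by (simp add: distrib_left)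
  qed
  then show ?case by blast
qed

lemma schwartz_gauss: "schwartz (gauss 1 :: 'a::euclidean_space \<Rightarrow> complex)"
proof -
  have "gauss 1 = (\<lambda>y::'a. complex_of_real (pi powr (- real DIM('a) / 2)) * complex_of_real (exp (- (y \<bullet> y) / 2)))"
    by (simp add: gauss_def fun_eq_iff power2_norm_eq_inner)
  then have "hermite_alg (gauss 1 :: 'a \<Rightarrow> complex)" by (simp only:) (intro hermite_alg.intros)
  then have "hermite_alg (iterdiff ds (gauss 1 :: 'a \<Rightarrow> complex))" if "ds \<in> lists Basis" for ds
    using that by (induction ds) (auto simp: hermite_alg_dderiv)
  then show ?thesis by (simp add: schwartz_def smooth_fun_def hermite_alg_dderiv hermite_alg_bound)
qed

text \<open>Puts the whole dependence on \<sigma> into an amplitude and a length scale, leaving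
  constants that belong to one fixed Schwartz function.\<close>

lemma gauss_scale:
  fixes y :: "'a::euclidean_space"
  assumes "\<sigma> > 0"
  shows "gauss \<sigma> y = complex_of_real (\<sigma> powr (- real DIM('a))) * gauss 1 (y /\<^sub>R \<sigma>)"
proof -
  have "(pi * \<sigma>\<^sup>2) powr (- real DIM('a) / 2) = pi powr (- real DIM('a) / 2) * \<sigma> powr (- real DIM('a))"
    using assms by (simp add: powr_mult powr_powr flip: powr_numeral)
  moreover have "norm (y /\<^sub>R \<sigma>) = norm y / \<sigma>"
    using assms by (simp add: divide_inverse mult.commute)
  then have "- (norm y)\<^sup>2 / (2 * \<sigma>\<^sup>2) = - (norm (y /\<^sub>R \<sigma>))\<^sup>2 / (2 * 1\<^sup>2)"
    by (simp add: power_divide)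
  ultimately show ?thesis unfolding gauss_def by simp
qed

text \<open>The seminorms with powers 0 and 2N together control (1 + |y|^2)^N up to the factor 2^N.
  The centre 0 and the scale 1 are written out to match \<open>decaying\<close>.\<close>

lemma schwartz_decaying_bound:
  assumes "schwartz \<phi>" "ds \<in> lists Basis"
  shows "\<exists>L. \<forall>y. norm (iterdiff ds \<phi> y) \<le> L / (1 + (norm (y - 0) / 1)\<^sup>2) ^ N"
proof -
  let ?f = "iterdiff ds \<phi>"
  obtain B0 where B0: "\<And>y. norm y ^ 0 * norm (?f y) \<le> B0" using assms unfolding schwartz_def by metis
  obtain B1 where B1: "\<And>y. norm y ^ (2 * N) * norm (?f y) \<le> B1" using assms unfolding schwartz_def by metis
  have "norm (?f y) \<le> 2 ^ N * (B0 + B1) / (1 + (norm (y - 0) / 1)\<^sup>2) ^ N" for y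
  proof -
    have "(1 + (norm y)\<^sup>2) ^ N \<le> 2 ^ N * (1 + norm y ^ (2 * N))"
    proof (cases "norm y \<le> 1")
      case True
      then have "(1 + (norm y)\<^sup>2) ^ N \<le> 2 ^ N * 1" by (simp add: power_mono power_le_one)
      also have "\<dots> \<le> 2 ^ N * (1 + norm y ^ (2 * N))" by (intro mult_left_mono) auto
      finally show ?thesis .
    next
      case False
      then have "1 \<le> (norm y)\<^sup>2" by (simp add: one_le_power)
      then have "(1 + (norm y)\<^sup>2) ^ N \<le> (2 * (norm y)\<^sup>2) ^ N" by (intro power_mono) auto
      also have "\<dots> = 2 ^ N * norm y ^ (2 * N)" by (simp add: power_mult_distrib power_mult)
      also have "\<dots> \<le> 2 ^ N * (1 + norm y ^ (2 * N))" by (intro mult_left_mono) auto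
      finally show ?thesis .
    qed
    then have "(1 + (norm y)\<^sup>2) ^ N * norm (?f y) \<le> 2 ^ N * (1 + norm y ^ (2 * N)) * norm (?f y)"
      by (intro mult_right_mono) auto
    also have "\<dots> = 2 ^ N * (norm (?f y) + norm y ^ (2 * N) * norm (?f y))" by (simp add: algebra_simps)
    also have "\<dots> \<le> 2 ^ N * (B0 + B1)" using B0[of y] B1[of y] by (intro mult_left_mono add_mono) auto
    finally show ?thesis
      by (subst pos_le_divide_eq) (auto simp: mult.commute add_pos_nonneg)
  qed
  then show ?thesis by blast
qed

text \<open>At scale 1 a derivative costs no factor, so a single constant, a sum of absolute values,
  serves the function and its derivatives together.\<close>

lemma schwartz_decaying_unit:
  assumes "schwartz \<phi>" "ds \<in> lists Basis"
  shows "\<exists>L. decaying N j L 1 0 (iterdiff ds \<phi>)"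
  using assms(2)
proof (induction j arbitrary: ds)
  case 0
  obtain L where "\<And>y. norm (iterdiff ds \<phi> y) \<le> L / (1 + (norm (y - 0) / 1)\<^sup>2) ^ N"
    using schwartz_decaying_bound[OF assms(1) 0] by blast
  moreover have "continuous_on UNIV (iterdiff ds \<phi>)"
    using assms(1) 0 by (intro differentiable_imp_continuous_UNIV) (auto simp: schwartz_def smooth_fun_def)
  ultimately show ?case by (intro exI[of _ L]) simp
next
  case (Suc j)
  have "\<exists>L. decaying N j L 1 0 (iterdiff (i # ds) \<phi>)" if "i \<in> Basis" for i
    using Suc that by (intro Suc.IH) auto
  then obtain M where M: "\<And>i. i \<in> Basis \<Longrightarrow> decaying N j (M i) 1 0 (dderiv i (iterdiff ds \<phi>))"
    by (metis iterdiff.simps(2))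
  obtain L where L: "\<And>y. norm (iterdiff ds \<phi> y) \<le> L / (1 + (norm (y - 0) / 1)\<^sup>2) ^ N"
    using schwartz_decaying_bound[OF assms(1) Suc.prems] by blast
  let ?K = "\<bar>L\<bar> + (\<Sum>i\<in>Basis. \<bar>M i\<bar>)"
  have "norm (iterdiff ds \<phi> y) \<le> ?K / (1 + (norm (y - 0) / 1)\<^sup>2) ^ N" for y
  proof (rule order_trans[OF L])
    have "0 \<le> (\<Sum>i\<in>Basis. \<bar>M i\<bar>)" by (rule sum_nonneg) simp
    then have "L \<le> ?K" by linarith
    then show "L / (1 + (norm (y - 0) / 1)\<^sup>2) ^ N \<le> ?K / (1 + (norm (y - 0) / 1)\<^sup>2) ^ N"
      by (intro divide_right_mono) auto
  qed
  moreover have "decaying N j (?K / 1) 1 0 (dderiv i (iterdiff ds \<phi>))" if "i \<in> Basis" for i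
  proof (rule decaying_mono[OF M[OF that]])
    have "\<bar>M i\<bar> \<le> (\<Sum>i\<in>Basis. \<bar>M i\<bar>)" by (rule member_le_sum) (use that in auto)
    then show "M i \<le> ?K / 1" by simp
  qed simp
  moreover have "\<forall>y. iterdiff ds \<phi> differentiable (at y)"
    using assms(1) Suc.prems by (auto simp: schwartz_def smooth_fun_def)
  ultimately show ?case by (intro exI[of _ ?K]) simp
qed

text \<open>The class is built for this: the chain rule yields one factor 1/s per derivative, while
  the amplitude stays that of the unscaled function.\<close>

lemma decaying_rescale:
  fixes f :: "'a::euclidean_space \<Rightarrow> complex"
  assumes "decaying N j L 1 0 f" "0 < s"
  shows "decaying N j L s x (\<lambda>y. f ((y - x) /\<^sub>R s))"
  using assms
proof (induction j arbitrary: L f)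
  case 0
  have "norm (f ((y - x) /\<^sub>R s)) \<le> L / (1 + (norm (y - x) / s)\<^sup>2) ^ N" for y
    using decaying_bound[OF 0(1), of "(y - x) /\<^sub>R s"] 0(2) by (simp add: divide_inverse mult.commute)
  moreover have "continuous_on UNIV (\<lambda>y. f ((y - x) /\<^sub>R s))"
    by (rule continuous_on_compose2[OF decaying_continuous[OF 0(1)]]) (auto intro!: continuous_intros)
  ultimately show ?case by simp
next
  case (Suc j)
  have f: "f differentiable (at y)" for y using Suc.prems by simp
  have d: "((\<lambda>y. f ((y - x) /\<^sub>R s)) has_derivative (\<lambda>v. frechet_derivative f (at ((y - x) /\<^sub>R s)) (v /\<^sub>R s))) (at y)" for y
    by (rule has_derivative_compose[OF _ frechet_dderiv(1)[OF f]]) (auto intro!: derivative_eq_intros)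
  have dd: "dderiv i (\<lambda>y. f ((y - x) /\<^sub>R s)) = (\<lambda>y. complex_of_real (1 / s) * dderiv i f ((y - x) /\<^sub>R s))" for i
  proof
    fix y
    have "linear (frechet_derivative f (at ((y - x) /\<^sub>R s)))" by (rule linear_frechet_derivative[OF f])
    then show "dderiv i (\<lambda>y. f ((y - x) /\<^sub>R s)) y = complex_of_real (1 / s) * dderiv i f ((y - x) /\<^sub>R s)"
      unfolding dderiv_eqI[OF d] frechet_dderiv(2)[OF f]
      by (simp add: linear_cmul scaleR_conv_of_real inverse_eq_divide)
  qed
  have "decaying N j (norm (complex_of_real (1 / s)) * L) s x (dderiv i (\<lambda>y. f ((y - x) /\<^sub>R s)))"
    if "i \<in> Basis" for i
    unfolding dd by (intro decaying_cmult Suc.IH) (use Suc.prems that in auto)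
  moreover have "norm (f ((y - x) /\<^sub>R s)) \<le> L / (1 + (norm (y - x) / s)\<^sup>2) ^ N" for y
    using decaying_bound[OF Suc.prems(1), of "(y - x) /\<^sub>R s"] Suc.prems(2) by (simp add: divide_inverse mult.commute)
  ultimately show ?case using d Suc.prems(2) by (auto simp: differentiable_def norm_divide)
qed

text \<open>One amplitude serves all scales and centres. This is the source of the uniformity in x
  and of the explicit dependence on \<sigma>.\<close>

lemma schwartz_decaying:
  assumes "schwartz \<phi>"
  obtains L where "L > 0" "\<And>s x. 0 < s \<Longrightarrow> decaying N j L s x (\<lambda>y. \<phi> ((y - x) /\<^sub>R s))"
proof -
  obtain L where L: "decaying N j L 1 0 \<phi>"
    using schwartz_decaying_unit[OF assms, of "[]" N j] by auto
  then have "decaying N j (\<bar>L\<bar> + 1) 1 0 \<phi>" by (rule decaying_mono) auto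
  then show thesis using decaying_rescale by (intro that[of "\<bar>L\<bar> + 1"]) auto
qed

section \<open>Uniform bounds on the potential and its derivatives\<close>

lemma AE_continuous_bound:
  fixes f :: "'a::euclidean_space \<Rightarrow> real"
  assumes c: "continuous_on UNIV f" and ae: "AE x in lebesgue. \<bar>f x\<bar> \<le> B"
  shows "\<bar>f x\<bar> \<le> B"
proof (rule ccontr)
  assume "\<not> \<bar>f x\<bar> \<le> B"
  let ?S = "{x. \<bar>f x\<bar> > B}"
  \<comment> \<open>The violating set is open by continuity and null by assumption, hence
    empty.\<close>
  have o: "open ?S" using c by (intro open_Collect_less) (auto intro!: continuous_intros)
  have "AE x in lebesgue. x \<notin> ?S" using ae by eventually_elim simp
  moreover have "?S \<in> sets lebesgue" by (rule sets_completionI_sets) (use borel_open[OF o] in \<open>simp only: sets_lborel\<close>)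
  ultimately have "?S \<in> null_sets lebesgue" by (subst AE_iff_null_sets)
  then have "negligible ?S" by (simp add: negligible_iff_null_sets)
  with o have "?S = {}" using open_not_negligible by blast
  then show False using \<open>\<not> \<bar>f x\<bar> \<le> B\<close> by (auto simp: not_le)
qed

text \<open>The inequality is strict because an essential bound becomes a pointwise one by
  continuity, and continuity comes from differentiability, which (V2) grants below order
  \<open>nV\<close>. (V2) gives no bound at order 0, hence the extra premise for
  \<open>ds = []\<close>.\<close>

lemma V2_bounded_derivs:
  fixes V :: "'a::euclidean_space \<Rightarrow> real"
  assumes V2: "V2 V nV" and ds: "ds \<in> lists Basis" and j: "j + length ds < nV"
    and b: "ds = [] \<Longrightarrow> \<exists>B. \<forall>x. \<bar>V x\<bar> \<le> B"
  shows "\<exists>B. bounded_derivs j B (iterdiff ds V)"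
  using ds j b
proof (induction j arbitrary: ds)
  case (0 ds)
  have d: "\<forall>x. iterdiff ds V differentiable (at x)" using V2 0 by (auto simp: V2_def)
  note c = differentiable_imp_continuous_UNIV[OF d]
  have "\<exists>B. \<forall>x. \<bar>iterdiff ds V x\<bar> \<le> B"
  proof (cases "ds = []")
    case False
    then have "\<exists>B. AE x in lebesgue. \<bar>iterdiff ds V x\<bar> \<le> B"
      using V2 0 by (auto simp: V2_def Suc_le_eq)
    then show ?thesis using AE_continuous_bound[OF c] by blast
  qed (use 0 in auto)
  then show ?case using c by auto
next
  case (Suc j ds)
  have "\<exists>B. bounded_derivs j B (iterdiff (i # ds) V)" if "i \<in> Basis" for i
    using Suc.prems that by (intro Suc.IH) auto
  then obtain M where M: "\<And>i. i \<in> Basis \<Longrightarrow> bounded_derivs j (M i) (dderiv i (iterdiff ds V))"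
    by (metis iterdiff.simps(2))
  have "\<exists>B. bounded_derivs j B (iterdiff ds V)" using Suc.prems by (intro Suc.IH) auto
  then obtain L where L: "bounded_derivs j L (iterdiff ds V)" by blast
  let ?K = "\<bar>L\<bar> + (\<Sum>i\<in>Basis. \<bar>M i\<bar>)"
  have s0: "0 \<le> (\<Sum>i\<in>Basis. \<bar>M i\<bar>)" by (rule sum_nonneg) simp
  have "\<bar>iterdiff ds V y\<bar> \<le> ?K" for y using bounded_derivs_bound[OF L, of y] s0 by linarith
  moreover have "bounded_derivs j ?K (dderiv i (iterdiff ds V))" if "i \<in> Basis" for i
  proof (rule bounded_derivs_mono[OF M[OF that]])
    have "\<bar>M i\<bar> \<le> (\<Sum>i\<in>Basis. \<bar>M i\<bar>)" by (rule member_le_sum) (use that in auto)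
    then show "M i \<le> ?K" by simp
  qed
  moreover have "\<forall>x. iterdiff ds V differentiable (at x)" using V2 Suc.prems by (auto simp: V2_def)
  ultimately show ?case by (intro exI[of _ ?K]) simp
qed

lemma bounded_derivs_lipschitz:
  fixes V :: "'a::euclidean_space \<Rightarrow> real"
  assumes d: "\<And>x. V differentiable (at x)" and b: "\<And>i x. i \<in> Basis \<Longrightarrow> \<bar>dderiv i V x\<bar> \<le> B i"
  shows "\<bar>V y - V x\<bar> \<le> (\<Sum>i\<in>Basis. B i) * norm (y - x)"
proof -
  have "norm (V y - V x) \<le> (\<Sum>i\<in>Basis. B i) * norm (y - x)"
  proof (rule differentiable_bound[of UNIV V "\<lambda>z. frechet_derivative V (at z)"])
    show "(V has_derivative frechet_derivative V (at z)) (at z)" for z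
      using d by (simp add: frechet_derivative_works[symmetric])
    fix z
    let ?D = "frechet_derivative V (at z)"
    have lin: "linear ?D" by (rule linear_frechet_derivative[OF d])
    show "onorm ?D \<le> (\<Sum>i\<in>Basis. B i)"
    proof (rule onorm_le)
      fix v
      have "?D v = (\<Sum>i\<in>Basis. (v \<bullet> i) * ?D i)"
        using linear_sum[OF lin, of "\<lambda>i. (v \<bullet> i) *\<^sub>R i" Basis]
        by (simp add: euclidean_representation linear_cmul[OF lin])
      also have "norm \<dots> \<le> (\<Sum>i\<in>Basis. norm v * B i)"
      proof (rule sum_norm_le)
        fix i :: 'a assume i: "i \<in> Basis"
        show "norm ((v \<bullet> i) * ?D i) \<le> norm v * B i"
          using b[OF i, of z] Basis_le_norm[OF i, of v]
          by (auto simp: abs_mult frechet_dderiv(2)[OF d] intro!: mult_mono)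
      qed
      finally show "norm (?D v) \<le> (\<Sum>i\<in>Basis. B i) * norm v"
        by (simp add: sum_distrib_left mult.commute)
    qed
  qed auto
  then show ?thesis by simp
qed

lemma L2norm_indicator_cball:
  fixes x :: "'a::euclidean_space"
  shows "L2norm (\<lambda>y. complex_of_real (indicator (cball x 1) y)) = sqrt (measure lebesgue (cball (0::'a) 1))"
proof -
  have L: "L2 (\<lambda>y::'a. complex_of_real (indicator (cball 0 1) y))"
    using L2_indicator_cball[of 1] by simp
  have "(\<lambda>y. complex_of_real (indicator (cball x 1) y)) = (\<lambda>y. complex_of_real (indicator (cball 0 1) (y + - x)))"
    by (auto simp: indicator_def dist_norm norm_minus_commute)
  then have "L2norm (\<lambda>y. complex_of_real (indicator (cball x 1) y))
    = L2norm (\<lambda>y::'a. complex_of_real (indicator (cball 0 1) y))"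
    using L2norm_translate[OF L, of "- x"] by simp
  also have "\<dots> = sqrt (\<integral>y. indicator (cball (0::'a) 1) y \<partial>lebesgue)"
    unfolding L2norm_def by (intro arg_cong[of _ _ sqrt] Bochner_Integration.integral_cong) (auto simp: indicator_def)
  finally show ?thesis by simp
qed

text \<open>Testing (V1) on translates of a fixed Gaussian bounds \<open>V\<close> in local \<open>L\<^sup>2\<close> uniformly; since
  \<open>V\<close> is Lipschitz this is a uniform bound.\<close>
lemma potential_bounded:
  fixes V :: "'a::euclidean_space \<Rightarrow> real"
  assumes V1: "V1 V" and V2: "V2 V nV" and nV: "2 \<le> nV"
  shows "\<exists>B. \<forall>x. \<bar>V x\<bar> \<le> B"
proof -
  define N where "N = DIM('a)"
  have N: "DIM('a) \<le> 2 * N" by (simp add: N_def)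
  obtain L where L: "L > 0" "\<And>s x. 0 < s \<Longrightarrow> decaying N 2 L s x (\<lambda>y::'a. gauss 1 ((y - x) /\<^sub>R s))"
    using schwartz_decaying[OF schwartz_gauss] by metis
  define g :: "'a \<Rightarrow> 'a \<Rightarrow> complex" where "g = (\<lambda>x y. gauss 1 (y - x))"
  have g: "decaying N (Suc (Suc 0)) L 1 x (g x)" for x
    using L(2)[of 1 x] by (simp add: g_def numeral_2_eq_2)
  note gH2 = decaying_H2[OF g _ _ N, simplified]
  let ?J = "japanese_integral TYPE('a)"
  \<comment> \<open>Norm bounds for the Gaussian and, below, for its Laplacian; they are uniform in
    the centre because the decay data do not depend on it.\<close>
  define c0 where "c0 = sqrt (L\<^sup>2 * ?J)"
  define c1 where "c1 = sqrt ((real DIM('a) * L)\<^sup>2 * ?J)"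
  have n0: "L2norm (g x) \<le> c0" for x
    using decaying_L2(2)[OF g _ _ N, of x] unfolding c0_def by (intro real_le_rsqrt) simp
  have n1: "L2norm (lap (g x)) \<le> c1" for x
  proof -
    note dl = decaying_lap_classical[OF g, of x]
    have "L2norm (lap (g x)) = L2norm (lap_classical (g x))"
      by (rule L2norm_cong_AE[OF L2_lap[OF gH2] decaying_L2(1)[OF dl _ _ N] lap_decaying[OF g _ _ N]]) auto
    also have "\<dots> \<le> c1"
      using decaying_L2(2)[OF dl _ _ N] unfolding c1_def by (intro real_le_rsqrt) simp
    finally show ?thesis .
  qed
  obtain a b where ab: "0 \<le> a" "0 \<le> b"
    "\<And>f. H2 f \<Longrightarrow> L2 (\<lambda>x. complex_of_real (V x) * f x)"
    "\<And>f. H2 f \<Longrightarrow> L2norm (\<lambda>x. complex_of_real (V x) * f x) \<le> a * L2norm (lap f) + b * L2norm f"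
    using V1 unfolding V1_def by blast
  define C where "C = a * c1 + b * c0"
  have VC: "L2norm (\<lambda>y. complex_of_real (V y) * g x y) \<le> C" for x
    unfolding C_def using ab(4)[OF gH2, of x] mult_left_mono[OF n1 ab(1), of x] mult_left_mono[OF n0 ab(2), of x]
    by linarith
  \<comment> \<open>First derivatives are strictly below order \<open>nV\<close> since nV >= 2, so
    their bounds hold pointwise.\<close>
  have "\<exists>B. \<forall>x. \<bar>dderiv i V x\<bar> \<le> B" if i: "i \<in> Basis" for i
  proof -
    have "\<exists>B. bounded_derivs 0 B (iterdiff [i] V)"
      by (rule V2_bounded_derivs[OF V2]) (use i nV in auto)
    then show ?thesis by auto
  qed
  then obtain D where D: "\<And>i x. i \<in> Basis \<Longrightarrow> \<bar>dderiv i V x\<bar> \<le> D i" by metis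
  have dV: "V differentiable (at x)" for x
    using V2 nV by (auto simp: V2_def dest!: bspec[of _ _ "[]"])
  note lip = bounded_derivs_lipschitz[OF dV D]
  define E where "E = (\<Sum>i\<in>(Basis::'a set). D i)"
  have E0: "E \<ge> 0" unfolding E_def
    by (rule sum_nonneg) (use D abs_ge_zero order_trans in blast)
  \<comment> \<open>The value of the unit Gaussian at distance 1, its minimum over the unit
    ball.\<close>
  define m where "m = pi powr (- real DIM('a) / 2) * exp (- 1 / 2)"
  have m0: "m > 0" by (simp add: m_def)
  have gm: "m \<le> norm (g x y)" if "norm (y - x) \<le> 1" for x y
  proof -
    have "(norm (y - x))\<^sup>2 \<le> 1" using that by (simp add: power_le_one)
    then have "exp (- 1 / 2) \<le> exp (- (norm (y - x))\<^sup>2 / 2)" by simp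
    then show ?thesis by (simp add: g_def gauss_def m_def norm_mult mult_left_mono)
  qed
  define \<mu> where "\<mu> = sqrt (measure lebesgue (cball (0::'a) 1))"
  have \<mu>0: "\<mu> > 0" unfolding \<mu>_def using content_cball_pos[of 1 "0::'a"] by simp
  have "\<bar>V x\<bar> \<le> E + C / (m * \<mu>)" for x
  proof (cases "\<bar>V x\<bar> \<le> E")
    case True
    have "C \<ge> 0" using VC[of x] L2norm_nonneg order_trans by blast
    then show ?thesis using True m0 \<mu>0 by (simp add: add_increasing2)
  next
    case False
    \<comment> \<open>On the unit ball about x, |V| is at least |V x| - E by the Lipschitz bound,
      and the Gaussian is at least m. Hence \<open>?c\<close> times the indicator of the ball is a
      minorant of the product controlled by (V1).\<close>
    let ?c = "(\<bar>V x\<bar> - E) * m"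
    have c0: "?c \<ge> 0" using False m0 by simp
    have "?c * \<mu> = L2norm (\<lambda>y. complex_of_real ?c * complex_of_real (indicator (cball x 1) y))"
      unfolding L2norm_cmult L2norm_indicator_cball \<mu>_def norm_of_real using c0 by simp
    also have "\<dots> \<le> L2norm (\<lambda>y. complex_of_real (V y) * g x y)"
    proof (rule L2norm_mono[OF ab(3)[OF gH2]])
      show "L2 (\<lambda>y. complex_of_real ?c * complex_of_real (indicator (cball x 1) y))"
        using L2_indicator_cball[of ?c x 1] by simp
      show "norm (complex_of_real ?c * complex_of_real (indicator (cball x 1) y))
        \<le> norm (complex_of_real (V y) * g x y)" for y
      proof (cases "norm (y - x) \<le> 1")
        case True
        have "\<bar>V y - V x\<bar> \<le> E * norm (y - x)" using lip[of y x] by (simp add: E_def)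
        also have "\<dots> \<le> E * 1" using True E0 by (intro mult_left_mono) auto
        finally have "\<bar>V x\<bar> - E \<le> \<bar>V y\<bar>" by linarith
        then have "?c \<le> \<bar>V y\<bar> * norm (g x y)" using gm[OF True] m0 False by (intro mult_mono) auto
        then show ?thesis using True c0
          unfolding norm_mult norm_of_real by (simp add: indicator_def dist_norm norm_minus_commute)
      next
        case False
        then show ?thesis by (simp add: indicator_def dist_norm norm_minus_commute)
      qed
    qed
    also have "\<dots> \<le> C" by (rule VC)
    finally have "(\<bar>V x\<bar> - E) * (m * \<mu>) \<le> C" by (simp add: mult.assoc)
    then have "\<bar>V x\<bar> - E \<le> C / (m * \<mu>)" using m0 \<mu>0 by (subst pos_le_divide_eq) auto
    then show ?thesis by simp
  qed
  then show ?thesis by blast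
qed

section \<open>Integration by parts on \<open>H2\<close> and symmetry of the Laplacian\<close>

lemma weak_deriv_cnj:
  assumes "weak_deriv ds f g"
  shows "weak_deriv ds (\<lambda>x. cnj (f x)) (\<lambda>x. cnj (g x))"
  unfolding weak_deriv_def
proof (intro allI impI)
  fix \<phi> :: "'a \<Rightarrow> real" assume \<phi>: "test_fun \<phi>"
  have c: "(\<integral>x. cnj (u x) * complex_of_real (\<psi> x) \<partial>lebesgue) = cnj (\<integral>x. u x * complex_of_real (\<psi> x) \<partial>lebesgue)"
    for u :: "'a \<Rightarrow> complex" and \<psi> :: "'a \<Rightarrow> real"
    by (subst Bochner_Integration.integral_cnj[symmetric]) simp
  show "(\<integral>x. cnj (f x) * complex_of_real (iterdiff ds \<phi> x) \<partial>lebesgue)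
      = (-1) ^ length ds * (\<integral>x. cnj (g x) * complex_of_real (\<phi> x) \<partial>lebesgue)"
    unfolding c assms[unfolded weak_deriv_def, rule_format, OF \<phi>] by simp
qed

lemma hess_rep_by_parts:
  fixes f g :: "'a::euclidean_space \<Rightarrow> complex" and w w' :: "'a \<Rightarrow> real"
  assumes "H2 f" "H2 g" "i \<in> Basis"
    and w: "\<And>x. ((\<lambda>h. w (x + h *\<^sub>R i)) has_vector_derivative w' x) (at 0)"
    and wm: "w \<in> borel_measurable lebesgue" "w' \<in> borel_measurable lebesgue"
    and wb: "\<And>x. \<bar>w x\<bar> \<le> B" "\<And>x. \<bar>w' x\<bar> \<le> B"
  shows "(\<integral>x. w x * cnj (f x) * hess_rep g i x \<partial>lebesgue)
    = - (\<integral>x. (w x * cnj (grad_rep f i x) + w' x * cnj (f x)) * grad_rep g i x \<partial>lebesgue)"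
  by (rule weak_integration_by_parts[OF weak_deriv_cnj L2_cnj L2_cnj H2_hess_rep(3) _ _ assms(3) w wm wb])
     (use assms in \<open>auto intro: H2_grad_rep H2_hess_rep H2_L2\<close>)

text \<open>By parts with the constant weight 1, both sides reduce to the same pairing of
  gradients.\<close>

lemma lap_symmetric:
  assumes f: "H2 f" and g: "H2 g"
  shows "(\<integral>x. cnj (f x) * lap g x \<partial>lebesgue) = (\<integral>x. cnj (lap f x) * g x \<partial>lebesgue)"
proof -
  have d: "((\<lambda>h. 1) has_vector_derivative 0) (at (0::real))" by (rule has_vector_derivative_const)
  have ibp: "(\<integral>x. cnj (u x) * hess_rep v i x \<partial>lebesgue) = - (\<integral>x. cnj (grad_rep u i x) * grad_rep v i x \<partial>lebesgue)"
    if "H2 u" "H2 v" "i \<in> Basis" for u v and i :: 'a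
    using hess_rep_by_parts[OF that, of "\<lambda>_. 1" "\<lambda>_. 0" 1] by (simp add: d)
  have lapsum: "(\<integral>x. cnj (u x) * lap v x \<partial>lebesgue) = (\<Sum>i\<in>Basis. \<integral>x. cnj (u x) * hess_rep v i x \<partial>lebesgue)"
    if "H2 u" "H2 v" for u v :: "'a \<Rightarrow> complex"
    unfolding lap_hess_rep sum_distrib_left
    by (intro Bochner_Integration.integral_sum L2_integrable_mult L2_cnj H2_L2 H2_hess_rep that)
  have "(\<integral>x. cnj (lap f x) * g x \<partial>lebesgue) = cnj (\<integral>x. cnj (g x) * lap f x \<partial>lebesgue)"
    by (subst Bochner_Integration.integral_cnj[symmetric]) (simp add: mult.commute)
  also have "\<dots> = (\<Sum>i\<in>Basis. - cnj (\<integral>x. cnj (grad_rep g i x) * grad_rep f i x \<partial>lebesgue))"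
    by (simp add: lapsum[OF g f] ibp[OF g f])
  also have "\<dots> = (\<Sum>i\<in>Basis. - (\<integral>x. cnj (grad_rep f i x) * grad_rep g i x \<partial>lebesgue))"
    by (intro sum.cong refl, subst Bochner_Integration.integral_cnj[symmetric]) (simp add: mult.commute)
  also have "\<dots> = (\<integral>x. cnj (f x) * lap g x \<partial>lebesgue)"
    by (simp add: lapsum[OF f g] ibp[OF f g])
  finally show ?thesis by simp
qed

section \<open>Differentiation of curves in L2\<close>

definition L2_deriv :: "(real \<Rightarrow> 'a::euclidean_space \<Rightarrow> complex) \<Rightarrow> ('a \<Rightarrow> complex) \<Rightarrow> real \<Rightarrow> bool" where
  "L2_deriv u u' t \<longleftrightarrow> ((\<lambda>h. L2norm (\<lambda>x. (u (t + h) x - u t x) / complex_of_real h - u' x)) \<longlongrightarrow> 0) (at 0)"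

lemma L2_deriv_pairing:
  assumes u: "\<And>s. L2 (u s)" and u': "L2 u'" and d: "L2_deriv u u' t" and f: "L2 f"
  shows "((\<lambda>s. \<integral>x. u s x * f x \<partial>lebesgue) has_vector_derivative (\<integral>x. u' x * f x \<partial>lebesgue)) (at t)"
proof -
  have "((\<lambda>h. \<integral>x. (u (t + h) x - u t x) / complex_of_real h * f x \<partial>lebesgue) \<longlongrightarrow> (\<integral>x. u' x * f x \<partial>lebesgue)) (at 0)"
    by (rule tendsto_integral_mult[OF _ u' f d[unfolded L2_deriv_def]]) (intro L2_divide L2_diff u)
  moreover have "(\<integral>x. (u (t + h) x - u t x) / complex_of_real h * f x \<partial>lebesgue)
      = ((\<integral>x. u (t + h) x * f x \<partial>lebesgue) - (\<integral>x. u t x * f x \<partial>lebesgue)) /\<^sub>R h" for h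
  proof -
    have "(\<integral>x. (u (t + h) x - u t x) / complex_of_real h * f x \<partial>lebesgue)
      = (\<integral>x. (u (t + h) x * f x - u t x * f x) / complex_of_real h \<partial>lebesgue)"
      by (simp add: left_diff_distrib)
    also have "\<dots> = ((\<integral>x. u (t + h) x * f x \<partial>lebesgue) - (\<integral>x. u t x * f x \<partial>lebesgue)) / complex_of_real h"
      by (simp only: integral_divide_zero Bochner_Integration.integral_diff[OF L2_integrable_mult[OF u f] L2_integrable_mult[OF u f]])
    finally show ?thesis by (simp add: scaleR_conv_of_real divide_inverse mult.commute)
  qed
  ultimately show ?thesis unfolding has_vector_derivative_quotient_iff by simp
qed

text \<open>Expanding the square gives h times the weighted square of the difference quotient plus
  twice the real part of its pairing with \<open>u t\<close>. The quotients stay bounded in norm, so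
  the first term vanishes with h.\<close>

lemma L2_deriv_weighted_square:
  assumes u: "\<And>s. L2 (u s)" and u': "L2 u'" and d: "L2_deriv u u' t"
    and w: "w \<in> borel_measurable lebesgue" "\<And>x. 0 \<le> w x" "\<And>x. w x \<le> B"
  shows "((\<lambda>s. \<integral>x. w x * (norm (u s x))\<^sup>2 \<partial>lebesgue) has_real_derivative
     2 * Re (\<integral>x. complex_of_real (w x) * cnj (u t x) * u' x \<partial>lebesgue)) (at t)"
proof -
  let ?D = "\<lambda>h x. (u (t + h) x - u t x) / complex_of_real h"
  let ?g = "\<lambda>x. complex_of_real (w x) * cnj (u t x)"
  let ?W = "\<lambda>v. \<integral>x. w x * (norm (v x))\<^sup>2 \<partial>lebesgue"
  have LD: "L2 (?D h)" for h by (intro L2_divide L2_diff u)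
  have Lg: "L2 ?g" by (rule L2_bounded_mult_real[of _ _ B]) (use w u in \<open>auto intro: L2_cnj\<close>)
  have iw: "integrable lebesgue (\<lambda>x. w x * (norm (v x))\<^sup>2)" if "L2 v" for v
    by (rule L2_integrable_weight[OF that w])
  have B0: "B \<ge> 0" using w(2)[of undefined] w(3)[of undefined] by linarith
  have iD: "integrable lebesgue (\<lambda>x. ?D h x * ?g x)" for h by (intro L2_integrable_mult LD Lg)
  have eq: "(?W (u (t + h)) - ?W (u t)) / h = h * ?W (?D h) + 2 * Re (\<integral>x. ?D h x * ?g x \<partial>lebesgue)"
    if h: "h \<noteq> 0" for h
  proof -
    have pt: "w x * (norm (u (t + h) x))\<^sup>2 = w x * (norm (u t x))\<^sup>2
      + (h\<^sup>2 * (w x * (norm (?D h x))\<^sup>2) + 2 * h * Re (?D h x * ?g x))" for x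
    proof -
      have sq: "(norm (a + complex_of_real h * b))\<^sup>2 = (norm a)\<^sup>2 + h\<^sup>2 * (norm b)\<^sup>2 + 2 * h * Re (b * cnj a)" for a b
        unfolding cmod_power2 by (simp add: power2_sum power_mult_distrib algebra_simps)
      have "u (t + h) x = u t x + complex_of_real h * ?D h x" using h by simp
      then have "(norm (u (t + h) x))\<^sup>2 = (norm (u t x))\<^sup>2 + h\<^sup>2 * (norm (?D h x))\<^sup>2 + 2 * h * Re (?D h x * cnj (u t x))"
        by (metis sq)
      then have "w x * (norm (u (t + h) x))\<^sup>2 = w x * ((norm (u t x))\<^sup>2 + h\<^sup>2 * (norm (?D h x))\<^sup>2 + 2 * h * Re (?D h x * cnj (u t x)))"
        by (simp only:)
      moreover have "Re (?D h x * ?g x) = w x * Re (?D h x * cnj (u t x))"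
        by (simp add: mult.left_commute[of "?D h x"] del: times_divide_eq_left)
      ultimately show ?thesis by (simp add: algebra_simps)
    qed
    have "?W (u (t + h)) = ?W (u t) + (h\<^sup>2 * ?W (?D h) + 2 * h * (\<integral>x. Re (?D h x * ?g x) \<partial>lebesgue))"
    proof -
      have i1: "integrable lebesgue (\<lambda>x. h\<^sup>2 * (w x * (norm (?D h x))\<^sup>2))"
        by (intro integrable_mult_right iw LD)
      have i2: "integrable lebesgue (\<lambda>x. 2 * h * Re (?D h x * ?g x))"
        by (intro integrable_mult_right integrable_Re iD)
      show ?thesis
        unfolding pt Bochner_Integration.integral_add[OF iw[OF u] Bochner_Integration.integrable_add[OF i1 i2]]
          Bochner_Integration.integral_add[OF i1 i2] integral_mult_right_zero ..
    qed
    also have "(\<integral>x. Re (?D h x * ?g x) \<partial>lebesgue) = Re (\<integral>x. ?D h x * ?g x \<partial>lebesgue)"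
      by (rule integral_Re[OF iD])
    finally show ?thesis using h by (simp add: field_simps power2_eq_square)
  qed
  have "((\<lambda>h. \<integral>x. ?D h x * ?g x \<partial>lebesgue) \<longlongrightarrow> (\<integral>x. u' x * ?g x \<partial>lebesgue)) (at 0)"
    by (rule tendsto_integral_mult[OF LD u' Lg d[unfolded L2_deriv_def]])
  then have l1: "((\<lambda>h. 2 * Re (\<integral>x. ?D h x * ?g x \<partial>lebesgue)) \<longlongrightarrow> 2 * Re (\<integral>x. u' x * ?g x \<partial>lebesgue)) (at 0)"
    by (intro tendsto_intros)
  have l2: "((\<lambda>h. h * ?W (?D h)) \<longlongrightarrow> 0) (at 0)"
  proof (rule Lim_null_comparison)
    let ?b = "\<lambda>h. \<bar>h\<bar> * (B * (L2norm (\<lambda>x. ?D h x - u' x) + L2norm u')\<^sup>2)"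
    have "(?b \<longlongrightarrow> \<bar>0\<bar> * (B * (0 + L2norm u')\<^sup>2)) (at 0)"
      by (intro tendsto_intros d[unfolded L2_deriv_def])
    then show "(?b \<longlongrightarrow> 0) (at 0)" by simp
    have "norm (h * ?W (?D h)) \<le> ?b h" for h
    proof -
      have "?W (?D h) \<le> (\<integral>x. B * (norm (?D h x))\<^sup>2 \<partial>lebesgue)"
        using w L2_square_integrable[OF LD[of h]]
        by (intro integral_mono iw LD mult_right_mono integrable_mult_right) auto
      also have "\<dots> = B * (L2norm (?D h))\<^sup>2" by (simp add: L2norm_power2)
      also have "L2norm (?D h) \<le> L2norm (\<lambda>x. ?D h x - u' x) + L2norm u'"
        using L2norm_triangle[OF L2_diff[OF LD u'] u', of h] by simp
      then have "B * (L2norm (?D h))\<^sup>2 \<le> B * (L2norm (\<lambda>x. ?D h x - u' x) + L2norm u')\<^sup>2"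
        by (intro mult_left_mono power_mono B0) auto
      finally have "?W (?D h) \<le> B * (L2norm (\<lambda>x. ?D h x - u' x) + L2norm u')\<^sup>2" .
      moreover have "0 \<le> ?W (?D h)" by (intro integral_nonneg_AE AE_I2 mult_nonneg_nonneg w) auto
      ultimately show ?thesis by (simp add: abs_mult mult_left_mono)
    qed
    then show "\<forall>\<^sub>F h in at 0. norm (h * ?W (?D h)) \<le> ?b h" by simp
  qed
  have "((\<lambda>h. (?W (u (t + h)) - ?W (u t)) / h) \<longlongrightarrow> 0 + 2 * Re (\<integral>x. u' x * ?g x \<partial>lebesgue)) (at 0)"
    by (rule Lim_transform_eventually[OF tendsto_add[OF l2 l1]]) (auto simp: eventually_at_filter eq)
  then show ?thesis by (simp add: DERIV_def mult_ac)
qed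

section \<open>The propagator\<close>

text \<open>From here on the evolution sees the potential only through a uniform bound; derivatives
  of \<open>V\<close> matter for the initial data alone.\<close>

locale schroedinger =
  fixes V :: "'a::euclidean_space \<Rightarrow> real" and U :: "real \<Rightarrow> ('a \<Rightarrow> complex) \<Rightarrow> 'a \<Rightarrow> complex" and B :: real
  assumes V_measurable: "V \<in> borel_measurable lebesgue"
    and V_bound: "\<And>x. \<bar>V x\<bar> \<le> B"
    and propagates: "propagator V U"
begin

lemma B_nonneg: "0 \<le> B"
  using V_bound[of 0] by linarith

lemma U_L2: "L2 f \<Longrightarrow> L2 (U t f)"
  and U_linear: "L2 f \<Longrightarrow> L2 g \<Longrightarrow> AE x in lebesgue. U t (\<lambda>y. f y + c * g y) x = U t f x + c * U t g x"
  and U_norm: "L2 f \<Longrightarrow> L2norm (U t f) = L2norm f"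
  and U_0: "L2 f \<Longrightarrow> AE x in lebesgue. U 0 f x = f x"
  and U_H2: "H2 \<psi> \<Longrightarrow> H2 (U t \<psi>)"
  using propagates unfolding propagator_def by blast+

text \<open>The isometry sends the difference, of norm 0, to a function of norm 0, and linearity
  splits the result.\<close>

lemma U_cong:
  assumes "L2 f" "L2 g" "AE x in lebesgue. f x = g x"
  shows "AE x in lebesgue. U t f x = U t g x"
proof -
  have L: "L2 (\<lambda>x. f x + (-1) * g x)" by (intro L2_add L2_cmult assms)
  have "AE x in lebesgue. f x + (-1) * g x = 0" using assms(3) by eventually_elim simp
  then have "L2norm (U t (\<lambda>x. f x + (-1) * g x)) = 0"
    using U_norm[OF L] L2norm_eq_0_iff[OF L] by simp
  then have "AE x in lebesgue. U t (\<lambda>x. f x + (-1) * g x) x = 0"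
    using L2norm_eq_0_iff[OF U_L2[OF L]] by blast
  with U_linear[OF assms(1,2), of t "-1"] show ?thesis by eventually_elim simp
qed

lemma U_cmult:
  assumes "L2 g"
  shows "AE x in lebesgue. U t (\<lambda>y. c * g y) x = c * U t g x"
proof -
  have "AE x in lebesgue. U t (\<lambda>y. 0) x = 0"
    using U_norm[OF L2_zero] L2norm_eq_0_iff[OF U_L2[OF L2_zero]] by (simp add: L2norm_def)
  with U_linear[OF L2_zero assms, of t c] show ?thesis by eventually_elim simp
qed

abbreviation "T \<equiv> schr_op V"

lemma L2_T: "H2 f \<Longrightarrow> L2 (T f)"
  unfolding schr_op_def
  by (intro L2_add L2_cmult L2_lap L2_bounded_mult_real[OF H2_L2 V_measurable V_bound])

lemma T_linear:
  assumes "H2 f" "H2 g"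
  shows "AE x in lebesgue. T (\<lambda>x. f x + c * g x) x = T f x + c * T g x"
  using lap_linear[OF assms, of c] by eventually_elim (simp add: schr_op_def algebra_simps)

text \<open>\<open>SOME\<close> may pick different representatives for functions that agree only
  almost everywhere. Integrals against test functions agree, and uniqueness of weak derivatives
  settles the rest.\<close>

lemma T_cong:
  assumes "H2 f" "H2 g" "AE x in lebesgue. f x = g x"
  shows "AE x in lebesgue. T f x = T g x"
proof -
  have "AE x in lebesgue. lap f x = (\<Sum>i\<in>Basis. hess_rep g i x)"
  proof (rule lap_eqI[OF assms(1)])
    fix i :: 'a assume i: "i \<in> Basis"
    show "L2 (hess_rep g i)" by (rule H2_hess_rep[OF assms(2) i])
    have eq: "(\<integral>x. f x * complex_of_real (\<psi> x) \<partial>lebesgue) = (\<integral>x. g x * complex_of_real (\<psi> x) \<partial>lebesgue)"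
      if "test_fun \<psi>" for \<psi>
    proof (rule integral_cong_AE)
      show "AE x in lebesgue. f x * complex_of_real (\<psi> x) = g x * complex_of_real (\<psi> x)"
        using assms(3) by eventually_elim simp
    qed (use assms(1,2) test_fun_L2[OF that] in \<open>auto intro!: borel_measurable_integrable L2_integrable_mult H2_L2\<close>)
    show "weak_deriv [i, i] f (hess_rep g i)"
      unfolding weak_deriv_def
    proof (intro allI impI)
      fix \<psi> :: "'a \<Rightarrow> real" assume \<psi>: "test_fun \<psi>"
      have "test_fun (iterdiff [i, i] \<psi>)" using test_fun_dderiv[OF test_fun_dderiv[OF \<psi> i] i] by simp
      from eq[OF this] H2_hess_rep(2)[OF assms(2) i] \<psi>
      show "(\<integral>x. f x * complex_of_real (iterdiff [i, i] \<psi> x) \<partial>lebesgue)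
        = (-1) ^ length [i, i] * (\<integral>x. hess_rep g i x * complex_of_real (\<psi> x) \<partial>lebesgue)"
        unfolding weak_deriv_def by metis
    qed
  qed
  with assms(3) show ?thesis by eventually_elim (simp add: schr_op_def lap_hess_rep)
qed

lemma T_symmetric:
  assumes f: "H2 f" and g: "H2 g"
  shows "(\<integral>x. cnj (f x) * T g x \<partial>lebesgue) = (\<integral>x. cnj (T f x) * g x \<partial>lebesgue)"
proof -
  note LV = L2_bounded_mult_real[OF H2_L2 V_measurable V_bound]
  have "(\<integral>x. cnj (f x) * T g x \<partial>lebesgue)
    = - (1/2) * (\<integral>x. cnj (f x) * lap g x \<partial>lebesgue) + (\<integral>x. cnj (f x) * (complex_of_real (V x) * g x) \<partial>lebesgue)"
  proof -
    have "(\<integral>x. cnj (f x) * T g x \<partial>lebesgue)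
      = (\<integral>x. - (1/2) * (cnj (f x) * lap g x) + cnj (f x) * (complex_of_real (V x) * g x) \<partial>lebesgue)"
      by (simp add: schr_op_def algebra_simps)
    also have "\<dots> = (\<integral>x. - (1/2) * (cnj (f x) * lap g x) \<partial>lebesgue) + (\<integral>x. cnj (f x) * (complex_of_real (V x) * g x) \<partial>lebesgue)"
      by (intro Bochner_Integration.integral_add integrable_mult_right L2_integrable_mult L2_cnj H2_L2 L2_lap LV f g)
    finally show ?thesis by simp
  qed
  moreover have "(\<integral>x. cnj (T f x) * g x \<partial>lebesgue)
    = - (1/2) * (\<integral>x. cnj (lap f x) * g x \<partial>lebesgue) + (\<integral>x. cnj (f x) * (complex_of_real (V x) * g x) \<partial>lebesgue)"
  proof -
    have "(\<integral>x. cnj (T f x) * g x \<partial>lebesgue)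
      = (\<integral>x. - (1/2) * (cnj (lap f x) * g x) + cnj (f x) * (complex_of_real (V x) * g x) \<partial>lebesgue)"
      by (simp add: schr_op_def algebra_simps)
    also have "\<dots> = (\<integral>x. - (1/2) * (cnj (lap f x) * g x) \<partial>lebesgue) + (\<integral>x. cnj (f x) * (complex_of_real (V x) * g x) \<partial>lebesgue)"
      by (intro Bochner_Integration.integral_add integrable_mult_right L2_integrable_mult L2_cnj H2_L2 L2_lap LV f g)
    finally show ?thesis by simp
  qed
  ultimately show ?thesis by (simp add: lap_symmetric[OF f g])
qed

lemma U_deriv:
  assumes "H2 \<psi>"
  shows "L2_deriv (\<lambda>s. U s \<psi>) (\<lambda>x. - (\<i> * T (U t \<psi>) x)) t"
proof -
  have "((\<lambda>h. L2norm (\<lambda>x. (U (t + h) \<psi> x - U t \<psi> x) / complex_of_real h + \<i> * T (U t \<psi>) x)) \<longlongrightarrow> 0) (at 0)"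
    using propagates assms unfolding propagator_def by blast
  then show ?thesis by (simp add: L2_deriv_def)
qed

text \<open>Two solutions with the same initial value agree, because \<open>T\<close> is symmetric.\<close>
lemma U_add:
  assumes \<psi>: "H2 \<psi>"
  shows "AE x in lebesgue. U (t + r) \<psi> x = U t (U r \<psi>) x"
proof -
  define z where "z = (\<lambda>s x. U (s + r) \<psi> x + (-1) * U s (U r \<psi>) x)"
  have zx: "z s x = U (s + r) \<psi> x - U s (U r \<psi>) x" for s x by (simp add: z_def)
  note \<psi>r = U_H2[OF \<psi>, of r]
  have zH: "H2 (z s)" for s unfolding z_def by (intro H2_linear U_H2 \<psi>)
  have d: "L2_deriv z (\<lambda>x. - (\<i> * T (z s) x)) s" for s
    unfolding L2_deriv_def
  proof (rule Lim_null_comparison)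
    let ?a = "\<lambda>h x. (U (s + r + h) \<psi> x - U (s + r) \<psi> x) / complex_of_real h - - (\<i> * T (U (s + r) \<psi>) x)"
    let ?b = "\<lambda>h x. (U (s + h) (U r \<psi>) x - U s (U r \<psi>) x) / complex_of_real h - - (\<i> * T (U s (U r \<psi>)) x)"
    have La: "L2 (?a h)" and Lb: "L2 (?b h)" for h
      by (intro L2_diff L2_divide L2_uminus L2_cmult L2_T U_L2 U_H2 H2_L2 \<psi>)+
    show "((\<lambda>h. L2norm (?a h) + L2norm (?b h)) \<longlongrightarrow> 0) (at 0)"
      using tendsto_add[OF U_deriv[OF \<psi>, of "s + r", unfolded L2_deriv_def] U_deriv[OF \<psi>r, of s, unfolded L2_deriv_def]]
      by simp
    have "norm (L2norm (\<lambda>x. (z (s + h) x - z s x) / complex_of_real h - - (\<i> * T (z s) x)))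
       \<le> L2norm (?a h) + L2norm (?b h)" for h
    proof -
      have "L2norm (\<lambda>x. (z (s + h) x - z s x) / complex_of_real h - - (\<i> * T (z s) x))
        = L2norm (\<lambda>x. ?a h x + - ?b h x)"
      proof (rule L2norm_cong_AE)
        show "L2 (\<lambda>x. (z (s + h) x - z s x) / complex_of_real h - - (\<i> * T (z s) x))"
          by (intro L2_diff L2_divide L2_uminus L2_cmult L2_T H2_L2 zH)
        show "L2 (\<lambda>x. ?a h x + - ?b h x)" by (intro L2_add L2_uminus La Lb)
        have "AE x in lebesgue. T (z s) x = T (U (s + r) \<psi>) x + (-1) * T (U s (U r \<psi>)) x"
          unfolding z_def by (intro T_linear U_H2 \<psi>)
        then show "AE x in lebesgue. (z (s + h) x - z s x) / complex_of_real h - - (\<i> * T (z s) x) = ?a h x + - ?b h x"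
        proof eventually_elim
          case (elim x)
          show ?case unfolding elim zx by (simp add: diff_divide_distrib add_divide_distrib algebra_simps)
        qed
      qed
      also have "\<dots> \<le> L2norm (?a h) + L2norm (?b h)"
        using L2norm_triangle[OF La L2_uminus[OF Lb]] by (simp only: L2norm_uminus)
      finally show ?thesis by simp
    qed
    then show "\<forall>\<^sub>F h in at 0. norm (L2norm (\<lambda>x. (z (s + h) x - z s x) / complex_of_real h - - (\<i> * T (z s) x)))
       \<le> L2norm (?a h) + L2norm (?b h)" by simp
  qed
  have const: "((\<lambda>s. \<integral>x. 1 * (norm (z s x))\<^sup>2 \<partial>lebesgue) has_real_derivative 0) (at s)" for s
  proof -
    have "((\<lambda>s. \<integral>x. 1 * (norm (z s x))\<^sup>2 \<partial>lebesgue) has_real_derivative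
        2 * Re (\<integral>x. complex_of_real 1 * cnj (z s x) * - (\<i> * T (z s) x) \<partial>lebesgue)) (at s)"
      by (rule L2_deriv_weighted_square[of z _ s "\<lambda>_. 1" 1])
         (auto intro!: zH H2_L2 L2_uminus L2_cmult L2_T d)
    \<comment> \<open>Symmetry makes the pairing of z with T z real, so multiplication by -i leaves
      no real part and the norm of z is conserved.\<close>
    moreover have "Re (\<integral>x. complex_of_real 1 * cnj (z s x) * - (\<i> * T (z s) x) \<partial>lebesgue) = 0"
    proof -
      let ?I = "\<integral>x. cnj (z s x) * T (z s) x \<partial>lebesgue"
      have "cnj ?I = (\<integral>x. cnj (T (z s) x) * z s x \<partial>lebesgue)"
        by (subst Bochner_Integration.integral_cnj[symmetric]) (simp add: mult.commute)
      then have "cnj ?I = ?I" using T_symmetric[OF zH zH] by simp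
      then have "Im ?I = 0" by (simp add: complex_eq_iff)
      moreover have "(\<integral>x. complex_of_real 1 * cnj (z s x) * - (\<i> * T (z s) x) \<partial>lebesgue)
        = (\<integral>x. - \<i> * (cnj (z s x) * T (z s) x) \<partial>lebesgue)"
        by (intro Bochner_Integration.integral_cong) auto
      ultimately show ?thesis by simp
    qed
    ultimately show ?thesis by simp
  qed
  have "(\<integral>x. 1 * (norm (z t x))\<^sup>2 \<partial>lebesgue) = (\<integral>x. 1 * (norm (z 0 x))\<^sup>2 \<partial>lebesgue)"
    by (rule DERIV_isconst_all) (use const in blast)
  moreover have "AE x in lebesgue. z 0 x = 0"
    using U_0[OF H2_L2[OF \<psi>r]] by eventually_elim (simp add: z_def)
  then have "L2norm (z 0) = 0" using L2norm_eq_0_iff[OF H2_L2[OF zH]] by blast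
  ultimately have "L2norm (z t) = 0" by (simp add: L2norm_def)
  then have "AE x in lebesgue. z t x = 0" using L2norm_eq_0_iff[OF H2_L2[OF zH]] by blast
  then show ?thesis by eventually_elim (simp add: z_def)
qed

text \<open>By the group law, the difference quotient at time t is the image under
  \<open>U t\<close> of the one at time 0. Both converge in norm, the second because
  \<open>U t\<close> is isometric, and the two limits must agree.\<close>

lemma U_commutes_T:
  assumes \<psi>: "H2 \<psi>"
  shows "AE x in lebesgue. T (U t \<psi>) x = U t (T \<psi>) x"
proof -
  note L\<psi> = H2_L2[OF \<psi>]
  have LT: "L2 (\<lambda>x. - (\<i> * T \<psi> x))" by (intro L2_uminus L2_cmult L2_T \<psi>)
  let ?a = "\<lambda>h x. (U (t + h) \<psi> x - U t \<psi> x) / complex_of_real h - - (\<i> * T (U t \<psi>) x)"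
  let ?b = "\<lambda>h x. (U (0 + h) \<psi> x - U 0 \<psi> x) / complex_of_real h - - (\<i> * T (U 0 \<psi>) x)"
  have La: "L2 (?a h)" and Lb: "L2 (?b h)" for h
    by (intro L2_diff L2_divide L2_uminus L2_cmult L2_T U_L2 U_H2 H2_L2 \<psi>)+
  let ?d = "\<lambda>x. \<i> * T (U t \<psi>) x - \<i> * U t (T \<psi>) x"
  have Ld: "L2 ?d" by (intro L2_diff L2_cmult L2_T U_H2 U_L2 \<psi>)
  \<comment> \<open>The left side does not depend on h, while the right side tends to 0.\<close>
  have key: "L2norm ?d \<le> L2norm (?a h) + L2norm (?b h)" for h
  proof -
    let ?c = "inverse (complex_of_real h)"
    let ?v = "\<lambda>y. U h \<psi> y + (-1) * \<psi> y"
    let ?e = "\<lambda>y. \<i> * T \<psi> y + ?c * ?v y"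
    have Lv: "L2 ?v" by (intro L2_add L2_cmult U_L2 L\<psi>)
    have LiT: "L2 (\<lambda>y. \<i> * T \<psi> y)" by (intro L2_cmult L2_T \<psi>)
    have Le: "L2 ?e" by (intro L2_add L2_cmult LiT Lv)
    have "AE x in lebesgue. ?b h x = ?e x"
      using U_0[OF L\<psi>] T_cong[OF U_H2[OF \<psi>] \<psi> U_0[OF L\<psi>]]
      by eventually_elim (simp add: divide_inverse mult.commute)
    then have nb: "L2norm (?b h) = L2norm ?e" by (rule L2norm_cong_AE[OF Lb Le])
    have "AE x in lebesgue. U t ?e x = \<i> * U t (T \<psi>) x + ?c * (U (t + h) \<psi> x - U t \<psi> x)"
      using U_linear[OF LiT Lv, of t ?c] U_cmult[OF L2_T[OF \<psi>], of t \<i>] U_linear[OF U_L2[OF L\<psi>, of h] L\<psi>, of t "-1"]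
        U_add[OF \<psi>, of t h]
      by eventually_elim simp
    then have "AE x in lebesgue. ?d x = ?a h x + - U t ?e x"
      by eventually_elim (simp add: divide_inverse mult.commute)
    then have "L2norm ?d = L2norm (\<lambda>x. ?a h x + - U t ?e x)"
      by (rule L2norm_cong_AE[OF Ld L2_add[OF La L2_uminus[OF U_L2[OF Le]]]])
    also have "\<dots> \<le> L2norm (?a h) + L2norm (U t ?e)"
      using L2norm_triangle[OF La L2_uminus[OF U_L2[OF Le]]] by (simp only: L2norm_uminus)
    finally show ?thesis unfolding nb U_norm[OF Le] .
  qed
  have "((\<lambda>h. L2norm (?a h) + L2norm (?b h)) \<longlongrightarrow> 0 + 0) (at 0)"
    by (intro tendsto_add U_deriv[OF \<psi>, unfolded L2_deriv_def])
  then have "L2norm ?d \<le> 0 + 0"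
    by (rule tendsto_lowerbound) (use key in auto)
  then have "L2norm ?d = 0" using L2norm_nonneg[of ?d] by linarith
  then have "AE x in lebesgue. ?d x = 0" using L2norm_eq_0_iff[OF Ld] by blast
  then show ?thesis by eventually_elim simp
qed

end

section \<open>Moments\<close>

text \<open>The square root is not differentiable at 0, so the root of Y + e^2 is differentiated
  instead and e is sent to 0.\<close>

lemma sqrt_growth:
  fixes Y D :: "real \<Rightarrow> real"
  assumes Y: "\<And>s. 0 \<le> Y s" and d: "\<And>s. (Y has_real_derivative D s) (at s)"
    and b: "\<And>s. \<bar>s\<bar> \<le> \<bar>t\<bar> \<Longrightarrow> \<bar>D s\<bar> \<le> 2 * (R * sqrt (Y s))" and R: "0 \<le> R"
  shows "sqrt (Y t) \<le> sqrt (Y 0) + R * \<bar>t\<bar>"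
proof (rule field_le_epsilon)
  fix e :: real assume e: "e > 0"
  let ?F = "\<lambda>s. sqrt (Y s + e\<^sup>2)"
  have pos: "Y s + e\<^sup>2 > 0" for s using Y[of s] e by (simp add: add_nonneg_pos)
  have "norm (?F t - ?F 0) \<le> R * \<bar>t - 0\<bar>"
  proof (rule has_vector_derivative_bound)
    fix s assume s: "s \<in> closed_segment 0 t"
    then have "\<bar>s\<bar> \<le> \<bar>t\<bar>" by (auto simp: closed_segment_eq_real_ivl split: if_splits)
    have "(?F has_real_derivative (D s) * (inverse (sqrt (Y s + e\<^sup>2)) / 2)) (at s)"
      using DERIV_chain2[OF DERIV_real_sqrt[OF pos] DERIV_add[OF d[of s] DERIV_const[of "e\<^sup>2"]]] by (simp add: mult.commute)
    then show "(?F has_vector_derivative (D s) * (inverse (sqrt (Y s + e\<^sup>2)) / 2)) (at s)"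
      by (simp add: has_real_derivative_iff_has_vector_derivative)
    have "\<bar>D s\<bar> \<le> 2 * (R * sqrt (Y s + e\<^sup>2))"
      using b[OF \<open>\<bar>s\<bar> \<le> \<bar>t\<bar>\<close>] mult_left_mono[OF real_sqrt_le_mono[of "Y s" "Y s + e\<^sup>2"] R] by simp
    then show "norm ((D s) * (inverse (sqrt (Y s + e\<^sup>2)) / 2)) \<le> R"
      using pos[of s] by (simp add: abs_mult divide_simps mult.commute)
  qed
  then have "?F t \<le> ?F 0 + R * \<bar>t\<bar>" by simp
  moreover have "sqrt (Y t) \<le> ?F t" by simp
  moreover have "?F 0 \<le> sqrt (Y 0) + e"
    using sqrt_add_le_add_sqrt[of "Y 0" "e\<^sup>2"] Y[of 0] e by simp
  ultimately show "sqrt (Y t) \<le> sqrt (Y 0) + R * \<bar>t\<bar> + e" by linarith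
qed

section \<open>A bounded regularised weight\<close>

text \<open>A bounded regularisation of \<open>1 + |y - x|\<^sup>2\<close>, to which it increases as \<open>e\<close> tends to 0.\<close>
definition reg_weight :: "real \<Rightarrow> 'a::euclidean_space \<Rightarrow> 'a \<Rightarrow> real" where
  "reg_weight e x y = (1 + (norm (y - x))\<^sup>2) / (1 + e * (1 + (norm (y - x))\<^sup>2))"

definition reg_weight_deriv :: "real \<Rightarrow> 'a::euclidean_space \<Rightarrow> 'a \<Rightarrow> 'a \<Rightarrow> real" where
  "reg_weight_deriv e x i y = 2 * ((y - x) \<bullet> i) / (1 + e * (1 + (norm (y - x))\<^sup>2))\<^sup>2"

text \<open>Only the upper bound 1/e depends on the regularisation, and it serves integrability. The
  others are uniform in e: a derivative costs half a power of the weight, as for 1 + |y - x|^2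
  itself, and the lower bound 1/2 lets lower powers be absorbed into higher ones.\<close>

lemma reg_weight_bounds:
  assumes e: "0 < e" "e \<le> 1"
  shows "1 / 2 \<le> reg_weight e x y" "reg_weight e x y \<le> 1 / e" "reg_weight e x y \<le> 1 + (norm (y - x))\<^sup>2"
    "i \<in> Basis \<Longrightarrow> \<bar>reg_weight_deriv e x i y\<bar> \<le> 2 * sqrt (reg_weight e x y)"
proof -
  define a where "a = 1 + (norm (y - x))\<^sup>2"
  define b where "b = 1 + e * a"
  have a: "a \<ge> 1" by (simp add: a_def)
  then have ea: "e * a \<le> a" "0 < e * a" using e by (auto simp: mult_le_cancel_right1)
  have b: "b \<ge> 1" "b \<le> 2 * a" using ea a unfolding b_def by linarith+
  have q: "reg_weight e x y = a / b" by (simp add: reg_weight_def a_def b_def)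
  show "1 / 2 \<le> reg_weight e x y" "reg_weight e x y \<le> 1 / e"
  proof -
    show "1 / 2 \<le> reg_weight e x y" unfolding q using b by (simp add: pos_le_divide_eq)
    have "a \<le> (1 / e) * b" using e by (simp add: b_def distrib_left)
    then show "reg_weight e x y \<le> 1 / e" unfolding q using b by (subst pos_divide_le_eq) auto
  qed
  have "a \<le> a * b" using a b by (simp add: mult_le_cancel_left1)
  then show "reg_weight e x y \<le> 1 + (norm (y - x))\<^sup>2"
    using b unfolding q a_def[symmetric] by (simp add: divide_le_eq)
  assume i: "i \<in> Basis"
  have "((y - x) \<bullet> i)\<^sup>2 \<le> (norm (y - x))\<^sup>2"
    using Basis_le_norm[OF i, of "y - x"] by (simp add: abs_le_square_iff[symmetric])
  then have n: "((y - x) \<bullet> i)\<^sup>2 \<le> a" by (simp add: a_def)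
  have "(reg_weight_deriv e x i y)\<^sup>2 = 4 * (((y - x) \<bullet> i)\<^sup>2 / b ^ 4)"
    by (simp add: reg_weight_deriv_def power_divide power_mult_distrib b_def a_def)
  also have "\<dots> \<le> 4 * (a / b)"
  proof -
    have "b ^ 1 \<le> b ^ 4" using b by (intro power_increasing) auto
    then have "((y - x) \<bullet> i)\<^sup>2 / b ^ 4 \<le> a / b" using n b a by (intro frac_le) auto
    then show ?thesis by simp
  qed
  also have "\<dots> = (2 * sqrt (reg_weight e x y))\<^sup>2" using a b by (simp add: q power_mult_distrib)
  finally show "\<bar>reg_weight_deriv e x i y\<bar> \<le> 2 * sqrt (reg_weight e x y)"
    using a b by (intro power2_le_imp_le[of "\<bar>_\<bar>"]) (auto simp: q)
qed

lemma reg_weight_measurable: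
  assumes "0 < e"
  shows "reg_weight e x \<in> borel_measurable lebesgue" "reg_weight_deriv e x i \<in> borel_measurable lebesgue"
  unfolding reg_weight_def[abs_def] reg_weight_deriv_def[abs_def] by (rule measurable_completion, simp)+

lemma reg_weight_has_derivative:
  assumes e: "0 < e" and i: "i \<in> Basis"
  shows "((\<lambda>h. reg_weight e x (y + h *\<^sub>R i) ^ k) has_vector_derivative
     real k * reg_weight e x y ^ (k - 1) * reg_weight_deriv e x i y) (at 0)"
proof -
  have n: "(norm (y + h *\<^sub>R i - x))\<^sup>2 = (norm (y - x))\<^sup>2 + 2 * h * ((y - x) \<bullet> i) + h\<^sup>2" for h
    using i unfolding power2_norm_eq_inner
    by (simp add: algebra_simps inner_add_left inner_add_right inner_diff_left inner_diff_right inner_commute power2_eq_square)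
  let ?a = "\<lambda>h. 1 + ((norm (y - x))\<^sup>2 + 2 * h * ((y - x) \<bullet> i) + h\<^sup>2)"
  have pos: "1 + e * ?a 0 > 0" using e by (simp add: add_pos_nonneg)
  have "((\<lambda>h. ?a h / (1 + e * ?a h)) has_real_derivative reg_weight_deriv e x i y) (at 0)"
    using pos by (auto intro!: derivative_eq_intros simp: reg_weight_deriv_def power2_eq_square divide_simps algebra_simps)
  then have "((\<lambda>h. reg_weight e x (y + h *\<^sub>R i)) has_real_derivative reg_weight_deriv e x i y) (at 0)"
    unfolding reg_weight_def n by simp
  from DERIV_power[OF this, of k] show ?thesis
    by (simp add: has_real_derivative_iff_has_vector_derivative mult_ac)
qed

section \<open>Weighted energy and mass\<close>

context schroedinger
begin

text \<open>Integration by parts of the weighted pairing of \<open>f\<close> with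
  \<open>lap f\<close> produces the gradient energy and a cross term with \<open>w'\<close>; Young's
  inequality absorbs the latter into half of the energy. Then \<open>lap f\<close> is expressed as 2
  V f - 2 T f.\<close>

lemma gradient_energy:
  fixes w :: "'a \<Rightarrow> real" and w' :: "'a \<Rightarrow> 'a \<Rightarrow> real"
  assumes f: "H2 f"
    and w: "\<And>i x. i \<in> Basis \<Longrightarrow> ((\<lambda>h. w (x + h *\<^sub>R i)) has_vector_derivative w' i x) (at 0)"
    and wm: "w \<in> borel_measurable lebesgue" "\<And>i. i \<in> Basis \<Longrightarrow> w' i \<in> borel_measurable lebesgue"
    and wb: "\<And>x. 0 \<le> w x" "\<And>x. w x \<le> W" "\<And>i x. i \<in> Basis \<Longrightarrow> \<bar>w' i x\<bar> \<le> c * w x" and c: "0 \<le> c"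
  shows "(\<Sum>i\<in>Basis. \<integral>x. w x * (norm (grad_rep f i x))\<^sup>2 \<partial>lebesgue)
    \<le> 4 * (sqrt (\<integral>x. w x * (norm (f x))\<^sup>2 \<partial>lebesgue) * sqrt (\<integral>x. w x * (norm (T f x))\<^sup>2 \<partial>lebesgue))
      + (4 * B + c\<^sup>2 * DIM('a)) * (\<integral>x. w x * (norm (f x))\<^sup>2 \<partial>lebesgue)"
proof -
  let ?G = "grad_rep f" and ?X = "\<integral>x. w x * (norm (f x))\<^sup>2 \<partial>lebesgue"
  let ?E = "\<lambda>i. \<integral>x. w x * (norm (?G i x))\<^sup>2 \<partial>lebesgue"
  note Lf = H2_L2[OF f]
  note LG = H2_grad_rep(1)[OF f]
  have W0: "W \<ge> 0" using wb(1,2)[of 0] by linarith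
  have Lw: "L2 (\<lambda>x. complex_of_real (w x) * h x)" if "L2 h" for h
    by (rule L2_bounded_mult_real[OF that wm(1), of W]) (use wb in auto)
  have w'W: "\<bar>w' i x\<bar> \<le> c * W" if "i \<in> Basis" for i x
    using wb(3)[OF that, of x] mult_left_mono[OF wb(2) c, of x] by linarith
  have Lw': "L2 (\<lambda>x. complex_of_real (w' i x) * h x)" if "L2 h" "i \<in> Basis" for h i
    by (rule L2_bounded_mult_real[OF that(1) wm(2)[OF that(2)] w'W[OF that(2)]])
  have iw: "integrable lebesgue (\<lambda>x. w x * (norm (h x))\<^sup>2)" if "L2 h" for h
    by (rule L2_integrable_weight[OF that wm(1) wb(1,2)])
  \<comment> \<open>The half of the energy left on the right is cancelled only after summation over
    the coordinates, which doubles the other constants.\<close>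
  have parts: "?E i \<le> - Re (\<integral>x. complex_of_real (w x) * cnj (f x) * hess_rep f i x \<partial>lebesgue)
      + (?E i / 2 + c\<^sup>2 * ?X / 2)" if i: "i \<in> Basis" for i
  proof -
    let ?K = "\<integral>x. complex_of_real (w' i x) * cnj (f x) * ?G i x \<partial>lebesgue"
    have iK: "integrable lebesgue (\<lambda>x. complex_of_real (w' i x) * cnj (f x) * ?G i x)"
      by (intro L2_integrable_mult Lw' L2_cnj Lf LG i)
    have "(\<integral>x. complex_of_real (w x) * cnj (f x) * hess_rep f i x \<partial>lebesgue)
      = - (\<integral>x. (complex_of_real (w x) * cnj (?G i x) + complex_of_real (w' i x) * cnj (f x)) * ?G i x \<partial>lebesgue)"
    proof (rule hess_rep_by_parts[OF f f i w[OF i] wm(1) wm(2)[OF i]])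
      show "\<bar>w x\<bar> \<le> max W (c * W)" "\<bar>w' i x\<bar> \<le> max W (c * W)" for x
        using wb(1,2)[of x] w'W[OF i, of x] by auto
    qed
    also have "(\<integral>x. (complex_of_real (w x) * cnj (?G i x) + complex_of_real (w' i x) * cnj (f x)) * ?G i x \<partial>lebesgue)
      = (\<integral>x. complex_of_real (w x * (norm (?G i x))\<^sup>2) + complex_of_real (w' i x) * cnj (f x) * ?G i x \<partial>lebesgue)"
      by (intro Bochner_Integration.integral_cong refl)
         (simp add: complex_norm_square algebra_simps del: of_real_power)
    also have "\<dots> = complex_of_real (?E i) + ?K"
      by (subst Bochner_Integration.integral_add)
         (auto intro!: integrable_of_real iw LG i iK simp del: of_real_mult of_real_power)
    finally have "?E i = - Re (\<integral>x. complex_of_real (w x) * cnj (f x) * hess_rep f i x \<partial>lebesgue) - Re ?K"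
      by simp
    moreover have "- Re ?K \<le> ?E i / 2 + c\<^sup>2 * ?X / 2"
    proof -
      have "- Re ?K \<le> norm ?K" using abs_Re_le_cmod[of ?K] by linarith
      also have "\<dots> \<le> (\<integral>x. norm (complex_of_real (w' i x) * cnj (f x) * ?G i x) \<partial>lebesgue)"
        by (rule integral_norm_bound)
      also have "\<dots> \<le> (\<integral>x. w x * (norm (?G i x))\<^sup>2 / 2 + c\<^sup>2 * (w x * (norm (f x))\<^sup>2) / 2 \<partial>lebesgue)"
      proof (rule integral_mono)
        show "integrable lebesgue (\<lambda>x. norm (complex_of_real (w' i x) * cnj (f x) * ?G i x))"
          by (rule integrable_norm[OF iK])
        show "integrable lebesgue (\<lambda>x. w x * (norm (?G i x))\<^sup>2 / 2 + c\<^sup>2 * (w x * (norm (f x))\<^sup>2) / 2)"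
          using iw[OF LG[OF i]] iw[OF Lf] by auto
        fix x
        have "norm (complex_of_real (w' i x) * cnj (f x) * ?G i x) \<le> (c * w x) * norm (f x) * norm (?G i x)"
          using wb(3)[OF i, of x] by (auto simp: norm_mult intro!: mult_right_mono)
        also have "\<dots> = w x * ((c * norm (f x)) * norm (?G i x))" by simp
        also have "\<dots> \<le> w x * ((norm (?G i x))\<^sup>2 / 2 + (c * norm (f x))\<^sup>2 / 2)"
          using sum_squares_bound[of "c * norm (f x)" "norm (?G i x)"] by (intro mult_left_mono wb(1)) simp
        finally show "norm (complex_of_real (w' i x) * cnj (f x) * ?G i x)
            \<le> w x * (norm (?G i x))\<^sup>2 / 2 + c\<^sup>2 * (w x * (norm (f x))\<^sup>2) / 2"
          by (simp add: algebra_simps power_mult_distrib)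
      qed
      also have "\<dots> = ?E i / 2 + c\<^sup>2 * ?X / 2"
        using iw[OF LG[OF i]] iw[OF Lf] by simp
      finally show ?thesis .
    qed
    ultimately show ?thesis by linarith
  qed
  have lapsum: "(\<Sum>i\<in>Basis. \<integral>x. complex_of_real (w x) * cnj (f x) * hess_rep f i x \<partial>lebesgue)
    = (\<integral>x. complex_of_real (w x) * cnj (f x) * lap f x \<partial>lebesgue)"
    unfolding lap_hess_rep sum_distrib_left
    by (intro Bochner_Integration.integral_sum[symmetric] L2_integrable_mult Lw L2_cnj Lf H2_hess_rep f)
  have LVf: "L2 (\<lambda>x. complex_of_real (V x) * f x)" by (rule L2_bounded_mult_real[OF Lf V_measurable V_bound])
  have "(\<integral>x. complex_of_real (w x) * cnj (f x) * lap f x \<partial>lebesgue)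
    = (\<integral>x. 2 * (complex_of_real (w x) * cnj (f x) * (complex_of_real (V x) * f x))
        - 2 * (complex_of_real (w x) * cnj (f x) * T f x) \<partial>lebesgue)"
    by (intro Bochner_Integration.integral_cong refl) (simp add: schr_op_def algebra_simps)
  also have "\<dots> = 2 * (\<integral>x. complex_of_real (w x) * cnj (f x) * (complex_of_real (V x) * f x) \<partial>lebesgue)
       - 2 * (\<integral>x. complex_of_real (w x) * cnj (f x) * T f x \<partial>lebesgue)"
    by (subst Bochner_Integration.integral_diff)
       (auto intro!: integrable_mult_right L2_integrable_mult Lw L2_cnj Lf LVf L2_T f)
  finally have lapT: "(\<integral>x. complex_of_real (w x) * cnj (f x) * lap f x \<partial>lebesgue)
    = 2 * (\<integral>x. complex_of_real (w x) * cnj (f x) * (complex_of_real (V x) * f x) \<partial>lebesgue)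
       - 2 * (\<integral>x. complex_of_real (w x) * cnj (f x) * T f x \<partial>lebesgue)" .
  have b1: "norm (\<integral>x. complex_of_real (w x) * cnj (f x) * (complex_of_real (V x) * f x) \<partial>lebesgue) \<le> B * ?X"
  proof -
    have "norm (\<integral>x. complex_of_real (w x) * cnj (f x) * (complex_of_real (V x) * f x) \<partial>lebesgue)
      \<le> (\<integral>x. norm (complex_of_real (w x) * cnj (f x) * (complex_of_real (V x) * f x)) \<partial>lebesgue)"
      by (rule integral_norm_bound)
    also have "\<dots> \<le> (\<integral>x. B * (w x * (norm (f x))\<^sup>2) \<partial>lebesgue)"
    proof (rule integral_mono)
      show "integrable lebesgue (\<lambda>x. norm (complex_of_real (w x) * cnj (f x) * (complex_of_real (V x) * f x)))"
        by (intro integrable_norm L2_integrable_mult Lw L2_cnj Lf LVf)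
      show "integrable lebesgue (\<lambda>x. B * (w x * (norm (f x))\<^sup>2))" by (intro integrable_mult_right iw Lf)
      fix x
      have "norm (complex_of_real (w x) * cnj (f x) * (complex_of_real (V x) * f x)) = \<bar>V x\<bar> * (w x * (norm (f x))\<^sup>2)"
        using wb(1)[of x] by (simp add: norm_mult power2_eq_square)
      also have "\<dots> \<le> B * (w x * (norm (f x))\<^sup>2)" by (intro mult_right_mono V_bound mult_nonneg_nonneg wb(1)) auto
      finally show "norm (complex_of_real (w x) * cnj (f x) * (complex_of_real (V x) * f x)) \<le> B * (w x * (norm (f x))\<^sup>2)" .
    qed
    finally show ?thesis by simp
  qed
  have b2: "norm (\<integral>x. complex_of_real (w x) * cnj (f x) * T f x \<partial>lebesgue)
     \<le> sqrt ?X * sqrt (\<integral>x. w x * (norm (T f x))\<^sup>2 \<partial>lebesgue)"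
  proof -
    have "norm (\<integral>x. complex_of_real (w x) * cnj (f x) * T f x \<partial>lebesgue)
      \<le> (\<integral>x. norm (complex_of_real (w x) * cnj (f x) * T f x) \<partial>lebesgue)"
      by (rule integral_norm_bound)
    also have "\<dots> = (\<integral>x. w x * (norm (f x) * norm (T f x)) \<partial>lebesgue)"
      using wb(1) by (intro Bochner_Integration.integral_cong refl) (simp add: norm_mult)
    also have "\<dots> \<le> sqrt ?X * sqrt (\<integral>x. w x * (norm (T f x))\<^sup>2 \<partial>lebesgue)"
      by (rule integral_weight_mult_le(2)[OF Lf L2_T[OF f] wm(1) wb(1,2)])
    finally show ?thesis .
  qed
  have "(\<Sum>i\<in>Basis. ?E i) \<le> (\<Sum>i\<in>Basis. - Re (\<integral>x. complex_of_real (w x) * cnj (f x) * hess_rep f i x \<partial>lebesgue)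
      + (?E i / 2 + c\<^sup>2 * ?X / 2))"
    by (rule sum_mono) (rule parts)
  also have "\<dots> = - Re (\<integral>x. complex_of_real (w x) * cnj (f x) * lap f x \<partial>lebesgue)
      + (\<Sum>i\<in>Basis. ?E i) / 2 + c\<^sup>2 * DIM('a) * ?X / 2"
    unfolding lapsum[symmetric] by (simp add: sum.distrib sum_subtractf sum_negf sum_divide_distrib)
  also have "- Re (\<integral>x. complex_of_real (w x) * cnj (f x) * lap f x \<partial>lebesgue)
     \<le> 2 * (B * ?X) + 2 * (sqrt ?X * sqrt (\<integral>x. w x * (norm (T f x))\<^sup>2 \<partial>lebesgue))"
    unfolding lapT using b1 b2
      abs_Re_le_cmod[of "\<integral>x. complex_of_real (w x) * cnj (f x) * (complex_of_real (V x) * f x) \<partial>lebesgue"]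
      abs_Re_le_cmod[of "\<integral>x. complex_of_real (w x) * cnj (f x) * T f x \<partial>lebesgue"]
    by simp
  finally show ?thesis by (simp add: algebra_simps)
qed

text \<open>The real potential and the gradient energy drop out of the derivative, so only the term
  with \<open>w'\<close> remains. Its bound is split into roots of \<open>w\<close> and
  \<open>v\<close> so that Cauchy-Schwarz leaves \<open>w\<close> on the function and a separate
  weight, later one power lower, on the gradient.\<close>

lemma weighted_mass_derivative:
  fixes w v :: "'a \<Rightarrow> real" and w' :: "'a \<Rightarrow> 'a \<Rightarrow> real"
  assumes \<psi>: "H2 \<psi>"
    and w: "\<And>i x. i \<in> Basis \<Longrightarrow> ((\<lambda>h. w (x + h *\<^sub>R i)) has_vector_derivative w' i x) (at 0)"
    and wm: "w \<in> borel_measurable lebesgue" "\<And>i. i \<in> Basis \<Longrightarrow> w' i \<in> borel_measurable lebesgue"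
    and wb: "\<And>x. 0 \<le> w x" "\<And>x. w x \<le> W"
    and v: "v \<in> borel_measurable lebesgue" "\<And>x. 0 \<le> v x" "\<And>x. v x \<le> W"
    and w'b: "\<And>i x. i \<in> Basis \<Longrightarrow> \<bar>w' i x\<bar> \<le> c * (sqrt (w x) * sqrt (v x))" and c: "0 \<le> c"
  obtains D where "((\<lambda>s. \<integral>x. w x * (norm (U s \<psi> x))\<^sup>2 \<partial>lebesgue) has_real_derivative D) (at t)"
    "\<bar>D\<bar> \<le> c * (sqrt (\<integral>x. w x * (norm (U t \<psi> x))\<^sup>2 \<partial>lebesgue)
       * (\<Sum>i\<in>Basis. sqrt (\<integral>x. v x * (norm (grad_rep (U t \<psi>) i x))\<^sup>2 \<partial>lebesgue)))"
proof -
  let ?u = "U t \<psi>"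
  let ?G = "grad_rep ?u"
  note uH = U_H2[OF \<psi>, of t]
  note Lu = H2_L2[OF uH]
  note LG = H2_grad_rep(1)[OF uH]
  have W0: "W \<ge> 0" using wb[of 0] by linarith
  have Lw: "L2 (\<lambda>x. complex_of_real (w x) * h x)" if "L2 h" for h
    by (rule L2_bounded_mult_real[OF that wm(1), of W]) (use wb in auto)
  have w'W: "\<bar>w' i x\<bar> \<le> c * W" if "i \<in> Basis" for i x
  proof -
    have "sqrt (w x) * sqrt (v x) \<le> sqrt W * sqrt W" using wb v W0 by (intro mult_mono) auto
    then show ?thesis using w'b[OF that, of x] mult_left_mono[of "sqrt (w x) * sqrt (v x)" W c] c W0 by simp
  qed
  have Lw': "L2 (\<lambda>x. complex_of_real (w' i x) * h x)" if "L2 h" "i \<in> Basis" for h i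
    by (rule L2_bounded_mult_real[OF that(1) wm(2)[OF that(2)] w'W[OF that(2)]])
  let ?D = "2 * Re (\<integral>x. complex_of_real (w x) * cnj (?u x) * - (\<i> * T ?u x) \<partial>lebesgue)"
  have d: "((\<lambda>s. \<integral>x. w x * (norm (U s \<psi> x))\<^sup>2 \<partial>lebesgue) has_real_derivative ?D) (at t)"
    by (rule L2_deriv_weighted_square[OF U_L2[OF H2_L2[OF \<psi>]] L2_uminus[OF L2_cmult[OF L2_T[OF uH]]]
          U_deriv[OF \<psi>] wm(1) wb])
  let ?K = "\<lambda>i. \<integral>x. complex_of_real (w' i x) * cnj (?u x) * ?G i x \<partial>lebesgue"
  have parts: "Im (\<integral>x. complex_of_real (w x) * cnj (?u x) * hess_rep ?u i x \<partial>lebesgue) = - Im (?K i)"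
    if i: "i \<in> Basis" for i
  proof -
    have iK: "integrable lebesgue (\<lambda>x. complex_of_real (w' i x) * cnj (?u x) * ?G i x)"
      by (intro L2_integrable_mult Lw' L2_cnj Lu LG i)
    have iw: "integrable lebesgue (\<lambda>x. w x * (norm (?G i x))\<^sup>2)"
      by (rule L2_integrable_weight[OF LG[OF i] wm(1) wb])
    have "(\<integral>x. complex_of_real (w x) * cnj (?u x) * hess_rep ?u i x \<partial>lebesgue)
      = - (\<integral>x. (complex_of_real (w x) * cnj (?G i x) + complex_of_real (w' i x) * cnj (?u x)) * ?G i x \<partial>lebesgue)"
    proof (rule hess_rep_by_parts[OF uH uH i w[OF i] wm(1) wm(2)[OF i]])
      show "\<bar>w x\<bar> \<le> max W (c * W)" "\<bar>w' i x\<bar> \<le> max W (c * W)" for x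
        using wb[of x] w'W[OF i, of x] by auto
    qed
    also have "(\<integral>x. (complex_of_real (w x) * cnj (?G i x) + complex_of_real (w' i x) * cnj (?u x)) * ?G i x \<partial>lebesgue)
      = (\<integral>x. complex_of_real (w x * (norm (?G i x))\<^sup>2) + complex_of_real (w' i x) * cnj (?u x) * ?G i x \<partial>lebesgue)"
      by (intro Bochner_Integration.integral_cong refl)
         (simp add: complex_norm_square algebra_simps del: of_real_power)
    also have "\<dots> = complex_of_real (\<integral>x. w x * (norm (?G i x))\<^sup>2 \<partial>lebesgue) + ?K i"
      by (subst Bochner_Integration.integral_add)
         (auto intro!: integrable_of_real iw iK simp del: of_real_mult of_real_power)
    finally show ?thesis by simp
  qed
  have LVu: "L2 (\<lambda>x. complex_of_real (V x) * ?u x)" by (rule L2_bounded_mult_real[OF Lu V_measurable V_bound])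
  have "(\<integral>x. complex_of_real (w x) * cnj (?u x) * - (\<i> * T ?u x) \<partial>lebesgue)
    = (\<integral>x. (\<i> / 2) * (complex_of_real (w x) * cnj (?u x) * lap ?u x)
        - \<i> * complex_of_real (V x * w x * (norm (?u x))\<^sup>2) \<partial>lebesgue)"
    by (intro Bochner_Integration.integral_cong refl)
       (simp add: schr_op_def complex_norm_square algebra_simps del: of_real_power)
  also have "\<dots> = (\<i> / 2) * (\<integral>x. complex_of_real (w x) * cnj (?u x) * lap ?u x \<partial>lebesgue)
        - \<i> * complex_of_real (\<integral>x. V x * w x * (norm (?u x))\<^sup>2 \<partial>lebesgue)"
  proof -
    have i1: "integrable lebesgue (\<lambda>x. (\<i> / 2) * (complex_of_real (w x) * cnj (?u x) * lap ?u x))"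
      by (intro integrable_mult_right L2_integrable_mult Lw L2_cnj Lu L2_lap uH)
    have "integrable lebesgue (\<lambda>x. (complex_of_real (w x) * cnj (?u x)) * (complex_of_real (V x) * ?u x))"
      by (intro L2_integrable_mult Lw L2_cnj Lu LVu)
    then have "integrable lebesgue (\<lambda>x. complex_of_real (V x * w x * (norm (?u x))\<^sup>2))"
      by (rule Bochner_Integration.integrable_cong[THEN iffD1, rotated -1])
         (simp_all add: complex_norm_square mult_ac del: of_real_power)
    then have i2: "integrable lebesgue (\<lambda>x. \<i> * complex_of_real (V x * w x * (norm (?u x))\<^sup>2))"
      by (intro integrable_mult_right)
    show ?thesis
      unfolding Bochner_Integration.integral_diff[OF i1 i2] integral_mult_right_zero integral_complex_of_real ..
  qed
  finally have Deq: "?D = - Im (\<integral>x. complex_of_real (w x) * cnj (?u x) * lap ?u x \<partial>lebesgue)" by simp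
  also have "(\<integral>x. complex_of_real (w x) * cnj (?u x) * lap ?u x \<partial>lebesgue)
    = (\<Sum>i\<in>Basis. \<integral>x. complex_of_real (w x) * cnj (?u x) * hess_rep ?u i x \<partial>lebesgue)"
    unfolding lap_hess_rep sum_distrib_left
    by (intro Bochner_Integration.integral_sum L2_integrable_mult Lw L2_cnj Lu H2_hess_rep uH)
  finally have DK: "?D = (\<Sum>i\<in>Basis. Im (?K i))" by (simp add: parts sum_negf)
  have K: "\<bar>Im (?K i)\<bar> \<le> c * (sqrt (\<integral>x. w x * (norm (?u x))\<^sup>2 \<partial>lebesgue)
       * sqrt (\<integral>x. v x * (norm (?G i x))\<^sup>2 \<partial>lebesgue))" if i: "i \<in> Basis" for i
  proof -
    let ?a = "\<lambda>x. complex_of_real (sqrt (w x)) * ?u x" and ?b = "\<lambda>x. complex_of_real (sqrt (v x)) * ?G i x"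
    have La: "L2 ?a" by (rule L2_bounded_mult_real[OF Lu, of _ "sqrt W"]) (use wb wm in auto)
    have Lb: "L2 ?b" by (rule L2_bounded_mult_real[OF LG[OF i], of _ "sqrt W"]) (use v in auto)
    have "\<bar>Im (?K i)\<bar> \<le> norm (?K i)" by (rule abs_Im_le_cmod)
    also have "\<dots> \<le> (\<integral>x. norm (complex_of_real (w' i x) * cnj (?u x) * ?G i x) \<partial>lebesgue)"
      by (rule integral_norm_bound)
    also have "\<dots> \<le> (\<integral>x. c * (norm (?a x) * norm (?b x)) \<partial>lebesgue)"
    proof (rule integral_mono)
      show "integrable lebesgue (\<lambda>x. norm (complex_of_real (w' i x) * cnj (?u x) * ?G i x))"
        by (intro integrable_norm L2_integrable_mult Lw' L2_cnj Lu LG i)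
      show "integrable lebesgue (\<lambda>x. c * (norm (?a x) * norm (?b x)))"
        by (intro integrable_mult_right L2_integrable_norm_mult La Lb)
      fix x
      have "norm (complex_of_real (w' i x) * cnj (?u x) * ?G i x)
          \<le> (c * (sqrt (w x) * sqrt (v x))) * norm (?u x) * norm (?G i x)"
        using w'b[OF i, of x] by (auto simp: norm_mult intro!: mult_right_mono)
      also have "\<dots> = c * (norm (?a x) * norm (?b x))" using wb(1)[of x] v(2)[of x] by (simp add: norm_mult)
      finally show "norm (complex_of_real (w' i x) * cnj (?u x) * ?G i x) \<le> c * (norm (?a x) * norm (?b x))" .
    qed
    also have "\<dots> \<le> c * (L2norm ?a * L2norm ?b)"
      using integral_norm_mult_le[OF La Lb] c by (simp add: mult_left_mono)
    also have "L2norm ?a = sqrt (\<integral>x. w x * (norm (?u x))\<^sup>2 \<partial>lebesgue)"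
      using wb by (simp add: L2norm_def norm_mult power_mult_distrib)
    also have "L2norm ?b = sqrt (\<integral>x. v x * (norm (?G i x))\<^sup>2 \<partial>lebesgue)"
      using v by (simp add: L2norm_def norm_mult power_mult_distrib)
    finally show ?thesis .
  qed
  have "\<bar>?D\<bar> \<le> (\<Sum>i\<in>Basis. \<bar>Im (?K i)\<bar>)" unfolding DK by (rule sum_abs)
  also have "\<dots> \<le> (\<Sum>i\<in>Basis. c * (sqrt (\<integral>x. w x * (norm (?u x))\<^sup>2 \<partial>lebesgue)
       * sqrt (\<integral>x. v x * (norm (?G i x))\<^sup>2 \<partial>lebesgue)))"
    by (rule sum_mono) (rule K)
  finally have "\<bar>?D\<bar> \<le> c * (sqrt (\<integral>x. w x * (norm (?u x))\<^sup>2 \<partial>lebesgue)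
       * (\<Sum>i\<in>Basis. sqrt (\<integral>x. v x * (norm (?G i x))\<^sup>2 \<partial>lebesgue)))"
    by (simp add: sum_distrib_left)
  with d show thesis by (rule that)
qed

end

section \<open>Induction over the moments\<close>

lemma jbr_ge_1: "1 \<le> jbr t" and jbr_pos: "0 < jbr t" and abs_le_jbr: "\<bar>t\<bar> \<le> jbr t"
proof -
  show 1: "1 \<le> jbr t" by (simp add: jbr_def)
  then show "0 < jbr t" by linarith
  show "\<bar>t\<bar> \<le> jbr t" unfolding jbr_def by (rule real_le_rsqrt) simp
qed

lemma jbr_mono: "\<bar>s\<bar> \<le> \<bar>t\<bar> \<Longrightarrow> jbr s \<le> jbr t"
  by (simp add: jbr_def abs_le_square_iff)

text \<open>The recursion mirrors the inductive step: 1 for the initial moment, the rest for the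
  growth in time. The factor k + 1 comes from differentiating the power of the weight, d from
  summing over coordinates, and the root from the gradient energy, with 4k bounding the logarithmic
  derivative of the k-th power of the weight.\<close>

primrec moment_const :: "real \<Rightarrow> real \<Rightarrow> nat \<Rightarrow> real" where
  "moment_const B d 0 = 1"
| "moment_const B d (Suc k) =
     1 + (real k + 1) * d * sqrt (4 + 4 * B + (4 * real k)\<^sup>2 * d) * moment_const B d k"

lemma moment_const_ge_1: "0 \<le> B \<Longrightarrow> 0 \<le> d \<Longrightarrow> 1 \<le> moment_const B d k"
  by (induction k) auto

lemma fatou_bound:
  fixes F :: "nat \<Rightarrow> 'a \<Rightarrow> real"
  assumes F: "\<And>j. integrable M (F j)" "\<And>j x. 0 \<le> F j x" "\<And>j. (\<integral>x. F j x \<partial>M) \<le> C"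
    and lim: "\<And>x. (\<lambda>j. F j x) \<longlonglongrightarrow> f x" and f: "f \<in> borel_measurable M"
  shows "integrable M f" and "(\<integral>x. f x \<partial>M) \<le> C"
proof -
  have f0: "0 \<le> f x" for x by (rule LIMSEQ_le_const[OF lim]) (use F(2) in auto)
  have "0 \<le> (\<integral>x. F 0 x \<partial>M)" by (intro integral_nonneg_AE AE_I2 F(2))
  then have C: "0 \<le> C" using F(3)[of 0] by linarith
  have "(\<integral>\<^sup>+x. ennreal (f x) \<partial>M) = (\<integral>\<^sup>+x. liminf (\<lambda>j. ennreal (F j x)) \<partial>M)"
    by (intro nn_integral_cong lim_imp_Liminf[symmetric] tendsto_ennrealI lim) simp
  also have "\<dots> \<le> liminf (\<lambda>j. \<integral>\<^sup>+x. ennreal (F j x) \<partial>M)"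
    by (rule nn_integral_liminf) (use F(1) in auto)
  also have "\<dots> \<le> liminf (\<lambda>j::nat. ennreal C)"
    by (intro Liminf_mono always_eventually allI)
       (use F in \<open>auto simp: nn_integral_eq_integral intro!: ennreal_leI\<close>)
  also have "\<dots> = ennreal C" by (simp add: Liminf_const)
  finally have b: "(\<integral>\<^sup>+x. ennreal (f x) \<partial>M) \<le> ennreal C" .
  then show "integrable M f"
    by (intro integrableI_bounded f) (use f0 in \<open>auto simp: order_le_less_trans\<close>)
  show "(\<integral>x. f x \<partial>M) \<le> C" by (rule integral_real_bounded[OF C b])
qed

context schroedinger
begin

text \<open>The induction on k is over all m and t at once, since the step from k to k + 1 calls on
  m and m + 1; k + m <= n keeps both in range. The power of \<open>S\<close> is stable because 2m +
  k + 1 is the mean of 2m + k and 2(m + 1) + k.\<close>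

lemma regularised_moment_bound:
  fixes \<psi> :: "nat \<Rightarrow> 'a \<Rightarrow> complex"
  assumes H: "\<And>m. m < n \<Longrightarrow> H2 (\<psi> m)" and L: "\<And>m. m \<le> n \<Longrightarrow> L2 (\<psi> m)"
    and chain: "\<And>m. m < n \<Longrightarrow> AE y in lebesgue. T (\<psi> m) y = \<psi> (Suc m) y"
    and init: "\<And>k m. k + m \<le> n \<Longrightarrow> integrable lebesgue (\<lambda>y. (1 + (norm (y - x))\<^sup>2) ^ k * (norm (\<psi> m y))\<^sup>2)"
      "\<And>k m. k + m \<le> n \<Longrightarrow> (\<integral>y. (1 + (norm (y - x))\<^sup>2) ^ k * (norm (\<psi> m y))\<^sup>2 \<partial>lebesgue) \<le> (M * S ^ (2 * m))\<^sup>2"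
    and S: "1 \<le> S" and M: "0 \<le> M" and e: "0 < e" "e \<le> 1"
  shows "k + m \<le> n \<Longrightarrow> sqrt (\<integral>y. reg_weight e x y ^ k * (norm (U t (\<psi> m) y))\<^sup>2 \<partial>lebesgue)
    \<le> moment_const B DIM('a) k * M * S ^ (2 * m + k) * jbr t ^ k"
proof (induction k arbitrary: m t)
  case 0
  then have m: "m \<le> n" by simp
  have "L2norm (\<psi> m) \<le> M * S ^ (2 * m)"
    unfolding L2norm_def using init(2)[of 0 m] m M S by (intro real_le_lsqrt) auto
  then show ?case using U_norm[OF L[OF m], of t] by (simp add: L2norm_def)
next
  case (Suc k)
  let ?q = "reg_weight e x" and ?d = "real DIM('a)"
  let ?c = "4 * real k"
  define K where "K = moment_const B ?d k"
  define \<Lambda> where "\<Lambda> = 4 + 4 * B + ?c\<^sup>2 * ?d"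
  \<comment> \<open>The geometric mean of the bounds for m and m + 1; since S >= 1 it also dominates
    the bound for m.\<close>
  define Q where "Q = K * M * S ^ (2 * m + k + 1) * jbr t ^ k"
  define R where "R = (real k + 1) * ?d * sqrt \<Lambda> * Q"
  have m: "m < n" and m': "m \<le> n" using Suc.prems by auto
  note \<psi>H = H[OF m]
  have K1: "K \<ge> 1" unfolding K_def using moment_const_ge_1[OF B_nonneg] by simp
  have \<Lambda>0: "\<Lambda> \<ge> 0" using B_nonneg by (simp add: \<Lambda>_def)
  have Q0: "Q \<ge> 0" using K1 M S jbr_pos[of t] by (simp add: Q_def)
  have R0: "R \<ge> 0" using \<Lambda>0 Q0 by (simp add: R_def)
  note qb = reg_weight_bounds[OF e]
  have q0: "0 \<le> ?q y" for y using qb(1)[of x y] by linarith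
  have e1: "1 \<le> 1 / e" using e by simp
  have qpow: "0 \<le> ?q y ^ j" "?q y ^ j \<le> (1 / e) ^ Suc k" if "j \<le> Suc k" for j y
  proof -
    show "0 \<le> ?q y ^ j" using q0 by simp
    have "?q y ^ j \<le> (1 / e) ^ j" by (intro power_mono qb q0)
    also have "\<dots> \<le> (1 / e) ^ Suc k" by (intro power_increasing that e1)
    finally show "?q y ^ j \<le> (1 / e) ^ Suc k" .
  qed
  have qm: "(\<lambda>y. ?q y ^ j) \<in> borel_measurable lebesgue" for j
    using reg_weight_measurable(1)[OF e(1), of x] by measurable
  let ?q' = "\<lambda>j i y. real j * ?q y ^ (j - 1) * reg_weight_deriv e x i y"
  have q'm: "?q' j i \<in> borel_measurable lebesgue" for j i
    using reg_weight_measurable(1)[OF e(1), of x] reg_weight_measurable(2)[OF e(1), of x i] by measurable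
  let ?Y = "\<lambda>k m s. \<integral>y. ?q y ^ k * (norm (U s (\<psi> m) y))\<^sup>2 \<partial>lebesgue"
  have Y0: "0 \<le> ?Y k m s" for k m s
    by (intro integral_nonneg_AE AE_I2 mult_nonneg_nonneg) (use q0 in auto)
  \<comment> \<open>Differentiating q^(k+1) costs half a power: q^k sqrt q is the product of the
    roots of q^(k+1) and q^k, the two weights of the mass estimate.\<close>
  have q'1: "\<bar>?q' (Suc k) i y\<bar> \<le> (2 * (real k + 1)) * (sqrt (?q y ^ Suc k) * sqrt (?q y ^ k))"
    if "i \<in> Basis" for i y
  proof -
    have "\<bar>?q' (Suc k) i y\<bar> = (real k + 1) * ?q y ^ k * \<bar>reg_weight_deriv e x i y\<bar>"
      using q0[of y] by (simp add: abs_mult)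
    also have "\<dots> \<le> (real k + 1) * ?q y ^ k * (2 * sqrt (?q y))"
      using q0[of y] by (intro mult_left_mono qb(4)[OF that]) auto
    also have "?q y ^ k * sqrt (?q y) = sqrt (?q y ^ Suc k) * sqrt (?q y ^ k)"
      using q0[of y] by (simp add: real_sqrt_mult)
    then have "(real k + 1) * ?q y ^ k * (2 * sqrt (?q y)) = (2 * (real k + 1)) * (sqrt (?q y ^ Suc k) * sqrt (?q y ^ k))"
      by (simp add: mult_ac)
    finally show ?thesis .
  qed
  \<comment> \<open>The energy estimate wants \<open>w'\<close> bounded by \<open>w\<close> itself.
    For this, sqrt q <= 2 q is used, which rests on the lower bound 1/2; for k = 0 the weight is
    constant.\<close>
  have q'2: "\<bar>?q' k i y\<bar> \<le> ?c * ?q y ^ k" if i: "i \<in> Basis" for i y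
  proof (cases k)
    case (Suc l)
    have "sqrt (?q y) \<ge> 1 / 2"
      using qb(1)[of x y] by (intro real_le_rsqrt) (simp add: power2_eq_square)
    then have "1 / 2 * sqrt (?q y) \<le> sqrt (?q y) * sqrt (?q y)"
      by (intro mult_right_mono) (use q0 in auto)
    then have "2 * sqrt (?q y) \<le> 4 * ?q y" using q0[of y] by simp
    then have r: "\<bar>reg_weight_deriv e x i y\<bar> \<le> 4 * ?q y" using qb(4)[OF i, of x y] by linarith
    have "\<bar>?q' k i y\<bar> = real k * ?q y ^ l * \<bar>reg_weight_deriv e x i y\<bar>"
      using q0[of y] Suc by (simp add: abs_mult)
    also have "\<dots> \<le> real k * ?q y ^ l * (4 * ?q y)"
      using q0[of y] by (intro mult_left_mono r) auto
    also have "\<dots> = ?c * ?q y ^ k" using Suc by simp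
    finally show ?thesis .
  qed simp
  have energy: "sqrt (\<integral>y. ?q y ^ k * (norm (grad_rep (U s (\<psi> m)) i y))\<^sup>2 \<partial>lebesgue) \<le> sqrt \<Lambda> * Q"
    if s: "\<bar>s\<bar> \<le> \<bar>t\<bar>" and i: "i \<in> Basis" for s i
  proof -
    let ?E = "\<lambda>i. \<integral>y. ?q y ^ k * (norm (grad_rep (U s (\<psi> m)) i y))\<^sup>2 \<partial>lebesgue"
    note uH = U_H2[OF \<psi>H, of s]
    have jj: "jbr s ^ k \<le> jbr t ^ k" using jbr_mono[OF s] jbr_pos[of s] by (intro power_mono) auto
    have aux: "sqrt (?Y k m' s) \<le> K * M * S ^ (2 * m' + k) * jbr t ^ k" if "k + m' \<le> n" for m'
    proof -
      have "0 \<le> K * M * S ^ (2 * m' + k)" using K1 M S by simp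
      from order_trans[OF Suc.IH[OF that, of s, folded K_def] mult_left_mono[OF jj this]] show ?thesis .
    qed
    have a0: "sqrt (?Y k m s) \<le> K * M * S ^ (2 * m + k) * jbr t ^ k"
      and a1: "sqrt (?Y k (Suc m) s) \<le> K * M * S ^ (2 * Suc m + k) * jbr t ^ k"
      by (rule aux, use Suc.prems in simp)+
    have "S ^ (2 * m + k) \<le> S ^ (2 * m + k + 1)" by (intro power_increasing S) simp
    then have "K * M * S ^ (2 * m + k) * jbr t ^ k \<le> Q"
      unfolding Q_def using K1 M jbr_pos[of t] by (intro mult_right_mono mult_left_mono) auto
    then have a0Q: "sqrt (?Y k m s) \<le> Q" using a0 by linarith
    have "sqrt (?Y k m s) * sqrt (?Y k (Suc m) s)
       \<le> (K * M * S ^ (2 * m + k) * jbr t ^ k) * (K * M * S ^ (2 * Suc m + k) * jbr t ^ k)"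
      by (intro mult_mono a0 a1) (use K1 M S jbr_pos[of t] Y0 in auto)
    also have "\<dots> = Q\<^sup>2"
      by (simp add: Q_def power2_eq_square power_add mult_ac)
    finally have p1: "sqrt (?Y k m s) * sqrt (?Y k (Suc m) s) \<le> Q\<^sup>2" .
    have p2: "?Y k m s \<le> Q\<^sup>2"
      using power_mono[OF a0Q, of 2] Y0[of k s m] by simp
    have TY: "(\<integral>y. ?q y ^ k * (norm (T (U s (\<psi> m)) y))\<^sup>2 \<partial>lebesgue) = ?Y k (Suc m) s"
    proof (rule integral_cong_AE)
      have L': "L2 (\<psi> (Suc m))" using L m by simp
      show "AE y in lebesgue. ?q y ^ k * (norm (T (U s (\<psi> m)) y))\<^sup>2 = ?q y ^ k * (norm (U s (\<psi> (Suc m)) y))\<^sup>2"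
        using U_commutes_T[OF \<psi>H, of s] U_cong[OF L2_T[OF \<psi>H] L' chain[OF m], of s] by eventually_elim simp
      show "(\<lambda>y. ?q y ^ k * (norm (T (U s (\<psi> m)) y))\<^sup>2) \<in> borel_measurable lebesgue"
        using qm[of k] L2_measurable[OF L2_T[OF uH]] by measurable
      show "(\<lambda>y. ?q y ^ k * (norm (U s (\<psi> (Suc m)) y))\<^sup>2) \<in> borel_measurable lebesgue"
        using qm[of k] L2_measurable[OF U_L2[OF L']] by measurable
    qed
    have "(\<Sum>i\<in>Basis. ?E i) \<le> 4 * (sqrt (?Y k m s) * sqrt (?Y k (Suc m) s)) + (4 * B + ?c\<^sup>2 * ?d) * ?Y k m s"
      using gradient_energy[OF uH reg_weight_has_derivative[OF e(1), of _ x _ k] qm q'm qpow q'2] TY by simp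
    also have "\<dots> \<le> 4 * Q\<^sup>2 + (4 * B + ?c\<^sup>2 * ?d) * Q\<^sup>2"
      by (intro add_mono mult_left_mono p1 p2) (use B_nonneg in auto)
    also have "\<dots> = \<Lambda> * Q\<^sup>2" by (simp add: \<Lambda>_def algebra_simps)
    finally have sum: "(\<Sum>i\<in>Basis. ?E i) \<le> \<Lambda> * Q\<^sup>2" .
    have "?E i \<le> (\<Sum>i\<in>Basis. ?E i)"
      by (rule member_le_sum[OF i]) (use q0 in \<open>auto intro!: integral_nonneg_AE AE_I2 mult_nonneg_nonneg\<close>)
    then have "sqrt (?E i) \<le> sqrt (\<Lambda> * Q\<^sup>2)" using sum by (intro real_sqrt_le_mono) linarith
    then show ?thesis using Q0 by (simp add: real_sqrt_mult)
  qed
  \<comment> \<open>Bundles the derivative with its bound so that a single function D of time can be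
    chosen.\<close>
  define P where "P = (\<lambda>s D. (?Y (Suc k) m has_real_derivative D) (at s) \<and>
    \<bar>D\<bar> \<le> (2 * (real k + 1)) * (sqrt (?Y (Suc k) m s)
       * (\<Sum>i\<in>Basis. sqrt (\<integral>y. ?q y ^ k * (norm (grad_rep (U s (\<psi> m)) i y))\<^sup>2 \<partial>lebesgue))))"
  have "\<exists>D. P s D" for s
    unfolding P_def
    by (rule weighted_mass_derivative[OF \<psi>H reg_weight_has_derivative[OF e(1), of _ x _ "Suc k"] qm q'm qpow qm qpow q'1, of s])
       auto
  then obtain D where "\<And>s. P s (D s)" by metis
  then have D: "(?Y (Suc k) m has_real_derivative D s) (at s)"
    "\<bar>D s\<bar> \<le> (2 * (real k + 1)) * (sqrt (?Y (Suc k) m s)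
       * (\<Sum>i\<in>Basis. sqrt (\<integral>y. ?q y ^ k * (norm (grad_rep (U s (\<psi> m)) i y))\<^sup>2 \<partial>lebesgue)))" for s
    unfolding P_def by simp_all
  have "sqrt (?Y (Suc k) m t) \<le> sqrt (?Y (Suc k) m 0) + R * \<bar>t\<bar>"
  proof (rule sqrt_growth[OF Y0 D(1) _ R0])
    fix s assume s: "\<bar>s\<bar> \<le> \<bar>t\<bar>"
    have "(\<Sum>i\<in>Basis. sqrt (\<integral>y. ?q y ^ k * (norm (grad_rep (U s (\<psi> m)) i y))\<^sup>2 \<partial>lebesgue))
      \<le> (\<Sum>i\<in>(Basis::'a set). sqrt \<Lambda> * Q)"
      by (intro sum_mono energy s)
    then have "sqrt (?Y (Suc k) m s) * (\<Sum>i\<in>Basis. sqrt (\<integral>y. ?q y ^ k * (norm (grad_rep (U s (\<psi> m)) i y))\<^sup>2 \<partial>lebesgue))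
      \<le> sqrt (?Y (Suc k) m s) * (?d * (sqrt \<Lambda> * Q))"
      by (intro mult_left_mono) (use Y0[of "Suc k" s m] in auto)
    then have "\<bar>D s\<bar> \<le> (2 * (real k + 1)) * (sqrt (?Y (Suc k) m s) * (?d * (sqrt \<Lambda> * Q)))"
      by (rule order_trans[OF D(2) mult_left_mono]) simp
    also have "\<dots> = 2 * (R * sqrt (?Y (Suc k) m s))" by (simp add: R_def mult_ac)
    finally show "\<bar>D s\<bar> \<le> 2 * (R * sqrt (?Y (Suc k) m s))" .
  qed
  also have "sqrt (?Y (Suc k) m 0) \<le> M * S ^ (2 * m)"
  proof (rule real_le_lsqrt)
    have "?Y (Suc k) m 0 = (\<integral>y. ?q y ^ Suc k * (norm (\<psi> m y))\<^sup>2 \<partial>lebesgue)"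
    proof (rule integral_cong_AE)
      show "AE y in lebesgue. ?q y ^ Suc k * (norm (U 0 (\<psi> m) y))\<^sup>2 = ?q y ^ Suc k * (norm (\<psi> m y))\<^sup>2"
        using U_0[OF L[OF m']] by eventually_elim simp
      show "(\<lambda>y. ?q y ^ Suc k * (norm (U 0 (\<psi> m) y))\<^sup>2) \<in> borel_measurable lebesgue"
        using qm[of "Suc k"] L2_measurable[OF U_L2[OF L[OF m']]] by measurable
      show "(\<lambda>y. ?q y ^ Suc k * (norm (\<psi> m y))\<^sup>2) \<in> borel_measurable lebesgue"
        using qm[of "Suc k"] L2_measurable[OF L[OF m']] by measurable
    qed
    \<comment> \<open>The regularised weight lies below the true one, so the moments assumed finite
      for the initial data apply.\<close>
    also have "\<dots> \<le> (\<integral>y. (1 + (norm (y - x))\<^sup>2) ^ Suc k * (norm (\<psi> m y))\<^sup>2 \<partial>lebesgue)"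
      by (intro integral_mono L2_integrable_weight[OF L[OF m'] qm qpow] init(1) mult_right_mono power_mono qb(3) q0)
         (use Suc.prems in auto)
    also have "\<dots> \<le> (M * S ^ (2 * m))\<^sup>2" by (rule init(2)) (use Suc.prems in auto)
    finally show "?Y (Suc k) m 0 \<le> (M * S ^ (2 * m))\<^sup>2" .
  qed (use M S in auto)
  also have "M * S ^ (2 * m) \<le> M * S ^ (2 * m + Suc k) * jbr t ^ Suc k"
  proof -
    have "S ^ (2 * m) * 1 \<le> S ^ (2 * m + Suc k) * jbr t ^ Suc k"
      using S jbr_ge_1[of t] by (intro mult_mono power_increasing one_le_power) auto
    from mult_left_mono[OF this M] show ?thesis by (simp add: mult.assoc)
  qed
  also have "R * \<bar>t\<bar> \<le> R * jbr t" by (intro mult_left_mono abs_le_jbr R0)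
  also have "M * S ^ (2 * m + Suc k) * jbr t ^ Suc k + R * jbr t
     = moment_const B ?d (Suc k) * M * S ^ (2 * m + Suc k) * jbr t ^ Suc k"
    by (simp add: R_def Q_def K_def \<Lambda>_def algebra_simps)
  finally show ?case by simp
qed

end

section \<open>Weighted estimates\<close>

lemma weight_int_nonneg: "0 \<le> weight_int t n x f"
  unfolding weight_int_def
  by (intro integral_nonneg_AE AE_I2 mult_nonneg_nonneg zero_le_power) (use jbr_pos[of t] in auto)

lemma weight_measurable:
  fixes x :: "'a::euclidean_space"
  shows "(\<lambda>y. (min 1 (jbr t / norm (x - y))) ^ n) \<in> borel_measurable lebesgue"
  by (rule measurable_completion) simp

lemma weight_bounds: "0 \<le> (min 1 (jbr t / norm (x - y))) ^ n" "(min 1 (jbr t / norm (x - y))) ^ n \<le> 1"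
  using jbr_pos[of t] by (auto intro!: zero_le_power power_le_one)

lemma weight_int_mono:
  assumes f: "L2 f" and st: "\<bar>s\<bar> \<le> \<bar>t\<bar>"
  shows "weight_int s n x f \<le> weight_int t n x f"
  unfolding weight_int_def
proof (intro integral_mono L2_integrable_weight[OF f weight_measurable weight_bounds] mult_right_mono power_mono)
  fix y
  have "jbr s / norm (x - y) \<le> jbr t / norm (x - y)" using jbr_mono[OF st] by (intro divide_right_mono) auto
  then show "min 1 (jbr s / norm (x - y)) \<le> min 1 (jbr t / norm (x - y))" by auto
qed (use jbr_pos[of s] in auto)

text \<open>Cauchy-Schwarz with the root of the weight on \<open>f\<close> and the root of
  \<open>?\<rho>\<close> on \<open>u\<close>, where the product of the two weights is at least 1.
  The two summands of \<open>?\<rho>\<close> contribute at most A each, hence the factor 2.\<close>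

lemma pairing_weight_bound:
  fixes f u :: "'a::euclidean_space \<Rightarrow> complex"
  assumes f: "L2 f" and u: "L2 u" and nu: "(L2norm u)\<^sup>2 \<le> A"
    and i: "integrable lebesgue (\<lambda>y. (1 + (norm (y - x))\<^sup>2) ^ n * (norm (u y))\<^sup>2)"
    and b: "(\<integral>y. (1 + (norm (y - x))\<^sup>2) ^ n * (norm (u y))\<^sup>2 \<partial>lebesgue) \<le> A * jbr t ^ (2 * n)"
  shows "(norm (\<integral>y. cnj (f y) * u y \<partial>lebesgue))\<^sup>2 \<le> 2 * A * weight_int t n x f"
proof -
  define \<omega> where "\<omega> = (\<lambda>y. (min 1 (jbr t / norm (x - y))) ^ n)"
  have \<omega>m: "\<omega> \<in> borel_measurable lebesgue" unfolding \<omega>_def by (rule weight_measurable)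
  have \<omega>0: "0 \<le> \<omega> y" and \<omega>1: "\<omega> y \<le> 1" for y unfolding \<omega>_def by (rule weight_bounds)+
  let ?\<rho> = "\<lambda>y. 1 + (1 + (norm (y - x))\<^sup>2) ^ n / jbr t ^ (2 * n)"
  let ?F = "\<lambda>y. complex_of_real (sqrt (\<omega> y)) * f y"
  let ?G = "\<lambda>y. complex_of_real (sqrt (?\<rho> y)) * u y"
  have \<rho>0: "0 \<le> ?\<rho> y" for y using jbr_pos[of t] by (simp add: add_nonneg_nonneg)
  have \<rho>m: "?\<rho> \<in> borel_measurable lebesgue" by (rule measurable_completion) simp
  \<comment> \<open>At y = x division by zero makes the weight vanish for n > 0, so this point is
    excluded at the cost of a null set.\<close>
  have key: "1 \<le> \<omega> y * ?\<rho> y" if "y \<noteq> x" for y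
  proof (cases "norm (x - y) \<le> jbr t")
    case True
    then have "1 \<le> jbr t / norm (x - y)" using that by simp
    then have "\<omega> y = 1" by (simp add: \<omega>_def min_absorb1)
    then show ?thesis using jbr_pos[of t] by simp
  next
    case False
    let ?r = "norm (x - y) / jbr t"
    have r: "?r \<ge> 1" using False jbr_pos[of t] by simp
    have "jbr t / norm (x - y) \<le> 1" using False jbr_pos[of t] by (simp add: divide_le_eq_1)
    then have w: "\<omega> y = (1 / ?r) ^ n" by (simp add: \<omega>_def min_absorb2)
    \<comment> \<open>Beyond the distance \<open>jbr t\<close> the weight is r^(-n) with r >= 1, and
      r^n <= r^(2n) is covered by the moment term of \<open>?\<rho>\<close>.\<close>
    have "?r * 1 \<le> ?r * ?r" using r by (intro mult_left_mono) auto
    then have "?r ^ n \<le> (?r\<^sup>2) ^ n"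
      unfolding power2_eq_square mult_1_right using r by (intro power_mono) auto
    also have "\<dots> = ((norm (y - x))\<^sup>2) ^ n / jbr t ^ (2 * n)"
      by (simp add: power_divide power_mult norm_minus_commute)
    also have "\<dots> \<le> ?\<rho> y"
    proof -
      have "((norm (y - x))\<^sup>2) ^ n \<le> (1 + (norm (y - x))\<^sup>2) ^ n" by (intro power_mono) auto
      then have "((norm (y - x))\<^sup>2) ^ n / jbr t ^ (2 * n) \<le> (1 + (norm (y - x))\<^sup>2) ^ n / jbr t ^ (2 * n)"
        using jbr_pos[of t] by (intro divide_right_mono) auto
      then show ?thesis by linarith
    qed
    finally have "?r ^ n \<le> ?\<rho> y" .
    then have "(1 / ?r) ^ n * ?r ^ n \<le> (1 / ?r) ^ n * ?\<rho> y"
      using jbr_pos[of t] by (intro mult_left_mono) auto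
    moreover have "(1 / ?r) ^ n * ?r ^ n = 1"
      using that jbr_pos[of t] by (subst power_mult_distrib[symmetric]) simp
    ultimately show ?thesis unfolding w by simp
  qed
  have LF: "L2 ?F"
    by (rule L2_bounded_mult_real[OF f measurable_compose[OF \<omega>m borel_measurable_sqrt], of 1]) (simp add: \<omega>0 \<omega>1)
  have nF: "(L2norm ?F)\<^sup>2 = weight_int t n x f"
  proof -
    have "weight_int t n x f = (\<integral>y. \<omega> y * (norm (f y))\<^sup>2 \<partial>lebesgue)" by (simp add: weight_int_def \<omega>_def)
    then show ?thesis by (simp add: L2norm_power2 norm_mult power_mult_distrib \<omega>0)
  qed
  have nG: "(norm (?G y))\<^sup>2 = (norm (u y))\<^sup>2 + ((1 + (norm (y - x))\<^sup>2) ^ n * (norm (u y))\<^sup>2) / jbr t ^ (2 * n)" for y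
  proof -
    have "(norm (?G y))\<^sup>2 = ?\<rho> y * (norm (u y))\<^sup>2" using \<rho>0[of y] by (simp add: norm_mult power_mult_distrib)
    then show ?thesis by (simp add: distrib_right)
  qed
  have LG: "L2 ?G"
    unfolding L2_def nG
  proof (intro conjI)
    have "(\<lambda>y. complex_of_real (sqrt (?\<rho> y))) \<in> borel_measurable lebesgue"
      by (rule measurable_compose[OF measurable_compose[OF \<rho>m borel_measurable_sqrt]]) simp
    then show "?G \<in> borel_measurable lebesgue" using L2_measurable[OF u] by (rule borel_measurable_times)
    show "integrable lebesgue (\<lambda>y. (norm (u y))\<^sup>2 + ((1 + (norm (y - x))\<^sup>2) ^ n * (norm (u y))\<^sup>2) / jbr t ^ (2 * n))"
      by (intro Bochner_Integration.integrable_add L2_square_integrable u integrable_divide i)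
  qed
  have "(L2norm ?G)\<^sup>2 = (L2norm u)\<^sup>2 + (\<integral>y. (1 + (norm (y - x))\<^sup>2) ^ n * (norm (u y))\<^sup>2 \<partial>lebesgue) / jbr t ^ (2 * n)"
    unfolding L2norm_power2 nG using L2_square_integrable[OF u] i by simp
  also have "\<dots> \<le> A + A" using b jbr_pos[of t] nu by (intro add_mono) (auto simp: pos_divide_le_eq)
  finally have bG: "(L2norm ?G)\<^sup>2 \<le> 2 * A" by simp
  have "norm (\<integral>y. cnj (f y) * u y \<partial>lebesgue) \<le> (\<integral>y. norm (cnj (f y) * u y) \<partial>lebesgue)"
    by (rule integral_norm_bound)
  also have "\<dots> \<le> (\<integral>y. norm (?F y) * norm (?G y) \<partial>lebesgue)"
  proof (rule integral_mono_AE)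
    show "integrable lebesgue (\<lambda>y. norm (cnj (f y) * u y))"
      by (intro integrable_norm L2_integrable_mult L2_cnj f u)
    show "integrable lebesgue (\<lambda>y. norm (?F y) * norm (?G y))" by (rule L2_integrable_norm_mult[OF LF LG])
    have "AE y in lebesgue. y \<noteq> x" by (rule AE_completion) (simp add: AE_lborel_singleton)
    then show "AE y in lebesgue. norm (cnj (f y) * u y) \<le> norm (?F y) * norm (?G y)"
    proof eventually_elim
      case (elim y)
      have "1 \<le> sqrt (\<omega> y * ?\<rho> y)" using key[OF elim] by simp
      then have "1 * (norm (f y) * norm (u y)) \<le> sqrt (\<omega> y * ?\<rho> y) * (norm (f y) * norm (u y))"
        by (intro mult_right_mono) auto
      also have "\<dots> = norm (?F y) * norm (?G y)"
        using \<omega>0[of y] \<rho>0[of y] unfolding norm_mult norm_of_real real_sqrt_mult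
        by (simp add: mult_ac)
      finally show ?case by (simp add: norm_mult)
    qed
  qed
  also have "\<dots> \<le> L2norm ?F * L2norm ?G" by (rule integral_norm_mult_le[OF LF LG])
  finally have "(norm (\<integral>y. cnj (f y) * u y \<partial>lebesgue))\<^sup>2 \<le> (L2norm ?F * L2norm ?G)\<^sup>2"
    by (rule power_mono) simp
  also have "\<dots> = weight_int t n x f * (L2norm ?G)\<^sup>2" by (simp add: power_mult_distrib nF)
  also have "\<dots> \<le> weight_int t n x f * (2 * A)" by (intro mult_left_mono bG weight_int_nonneg)
  finally show ?thesis by (simp add: mult_ac)
qed

section \<open>Powers of the operator applied to decaying data\<close>

definition schr_classical :: "('a::euclidean_space \<Rightarrow> real) \<Rightarrow> ('a \<Rightarrow> complex) \<Rightarrow> 'a \<Rightarrow> complex" where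
  "schr_classical V g = (\<lambda>y. - (1/2) * lap_classical g y + complex_of_real (V y) * g y)"

text \<open>The Laplacian uses two derivatives and thus costs (1/s)^2. The potential term carries no
  power of 1/s and, as s <= 1, may be charged the same, so one constant covers both.\<close>

lemma decaying_schr_classical:
  fixes g :: "'a::euclidean_space \<Rightarrow> complex"
  assumes V: "bounded_derivs j B V" and g: "decaying N (Suc (Suc j)) L s x g" and s: "0 < s" "s \<le> 1"
    and C: "1 + real DIM('a) + 2 ^ j * B \<le> C"
  shows "decaying N j (C * L * (1 / s)\<^sup>2) s x (schr_classical V g)"
proof -
  have L0: "0 \<le> L" by (rule decaying_nonneg[OF g])
  have B0: "0 \<le> B" using bounded_derivs_bound[OF V, of x] by linarith
  have "decaying N j (norm (- (1 / 2) :: complex) * (DIM('a) * (L / s / s))) s x (\<lambda>y. - (1/2) * lap_classical g y)"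
    by (rule decaying_cmult[OF decaying_lap_classical[OF g]])
  moreover have "decaying N j (2 ^ j * B * L) s x (\<lambda>y. complex_of_real (V y) * g y)"
    by (rule decaying_mult[OF V decaying_le[OF g] s]) simp
  ultimately have "decaying N j (norm (- (1 / 2) :: complex) * (DIM('a) * (L / s / s)) + 2 ^ j * B * L) s x (schr_classical V g)"
    unfolding schr_classical_def by (rule decaying_add)
  then show ?thesis
  proof (rule decaying_mono[OF _ _ s(1)])
    let ?S = "(1 / s)\<^sup>2"
    have S: "1 \<le> ?S" using s by (simp add: one_le_power)
    have "2 ^ j * B * L * 1 \<le> 2 ^ j * B * L * ?S" using B0 L0 S by (intro mult_left_mono) auto
    moreover have "norm (- (1 / 2) :: complex) * (DIM('a) * (L / s / s)) = 1 / 2 * (DIM('a) * L * ?S)"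
      by (simp add: norm_divide power2_eq_square)
    moreover have "0 \<le> DIM('a) * L * ?S" "0 \<le> L * ?S" using L0 by auto
    moreover have "(1 + real DIM('a) + 2 ^ j * B) * (L * ?S) \<le> C * (L * ?S)"
      using C L0 by (intro mult_right_mono) auto
    ultimately show "norm (- (1 / 2) :: complex) * (DIM('a) * (L / s / s)) + 2 ^ j * B * L \<le> C * L * ?S"
      by (simp add: algebra_simps)
  qed
qed

lemma schr_op_decaying:
  fixes g :: "'a::euclidean_space \<Rightarrow> complex"
  assumes g: "decaying N (Suc (Suc j)) L s x g" and s: "0 < s" "s \<le> 1" and N: "DIM('a) \<le> 2 * N"
  shows "AE y in lebesgue. schr_op V g y = schr_classical V g y"
  using lap_decaying[OF g s N] by eventually_elim (simp add: schr_op_def schr_classical_def)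

context schroedinger
begin

text \<open>\<open>K\<close> depends on the potential, n and the dimension only; amplitude, scale
  and centre of the datum stay explicit. The order 2n - 2 for \<open>V\<close> arises because the
  first application of the operator must leave 2(n - 1) derivatives for the remaining ones.\<close>

lemma propagation_bound:
  assumes V: "bounded_derivs (2 * n - 2) B' V"
  obtains K where "0 < K" "\<And>s L x g f t. \<lbrakk>0 < s; s \<le> 1; decaying (n + DIM('a)) (2 * n) L s x g; L2 f\<rbrakk> \<Longrightarrow>
    (norm (inner_L2 f (U t g)))\<^sup>2 \<le> K * (L\<^sup>2 * s ^ DIM('a) * (1 / s) ^ (2 * n)) * weight_int t n x f"
proof -
  let ?J = "japanese_integral TYPE('a)" and ?N = "n + DIM('a)"
  have B'0: "0 \<le> B'" using bounded_derivs_bound[OF V, of 0] by linarith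
  have J0: "0 \<le> ?J" unfolding japanese_integral_def
    by (intro integral_nonneg_AE AE_I2) (simp add: add_nonneg_nonneg)
  \<comment> \<open>The power of 2 dominates the Leibniz factors of all n applications of the
    operator, so one constant serves each of them.\<close>
  define C where "C = 1 + real DIM('a) + 2 ^ (2 * n) * B'"
  have C1: "1 \<le> C" using B'0 by (simp add: C_def)
  define c where "c = moment_const B DIM('a) n"
  have c1: "1 \<le> c" unfolding c_def using moment_const_ge_1[OF B_nonneg] by simp
  define K where "K = 2 * (c * C ^ n)\<^sup>2 * ?J + 1"
  have K0: "0 < K" using J0 by (simp add: K_def add_nonneg_pos)
  have bound: "(norm (inner_L2 f (U t g)))\<^sup>2 \<le> K * (L\<^sup>2 * s ^ DIM('a) * (1 / s) ^ (2 * n)) * weight_int t n x f"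
    if s: "0 < s" "s \<le> 1" and g: "decaying ?N (2 * n) L s x g" and f: "L2 f" for s L x g f t
  proof -
    define S where "S = 1 / s"
    have S: "1 \<le> S" using s by (simp add: S_def)
    have L0: "0 \<le> L" by (rule decaying_nonneg[OF g])
    define \<psi> where "\<psi> = (\<lambda>m. (schr_classical V ^^ m) g)"
    have N: "DIM('a) \<le> 2 * ?N" by simp
    have \<psi>: "decaying ?N (2 * (n - m)) (C ^ m * L * S ^ (2 * m)) s x (\<psi> m)" if "m \<le> n" for m
      using that
    proof (induction m)
      case (Suc m)
      define j where "j = 2 * (n - Suc m)"
      have j: "2 * (n - m) = Suc (Suc j)" using Suc.prems by (simp add: j_def)
      have d: "decaying ?N (Suc (Suc j)) (C ^ m * L * S ^ (2 * m)) s x (\<psi> m)"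
        using Suc.IH Suc.prems unfolding j by simp
      have b: "bounded_derivs j B' V" using bounded_derivs_le[OF V] by (simp add: j_def)
      have C: "1 + real DIM('a) + 2 ^ j * B' \<le> C"
      proof -
        have "(2::real) ^ j \<le> 2 ^ (2 * n)" by (intro power_increasing) (auto simp: j_def)
        then show ?thesis using B'0 by (simp add: C_def mult_right_mono)
      qed
      have "decaying ?N j (C * (C ^ m * L * S ^ (2 * m)) * (1 / s)\<^sup>2) s x (schr_classical V (\<psi> m))"
        by (rule decaying_schr_classical[OF b d s C])
      then have "decaying ?N j (C * (C ^ m * L * S ^ (2 * m)) * (1 / s)\<^sup>2) s x (\<psi> (Suc m))"
        by (simp add: \<psi>_def)
      then show ?case by (simp add: j_def S_def power2_eq_square mult_ac)
    qed (simp add: \<psi>_def g)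
    \<comment> \<open>C^n replaces C^m to make M independent of m; the root is the volume factor
      from \<open>decaying_moment\<close>.\<close>
    define M where "M = C ^ n * L * sqrt (s ^ DIM('a) * ?J)"
    have M0: "0 \<le> M" using C1 L0 J0 s by (simp add: M_def)
    have H: "H2 (\<psi> m)" and chain: "AE y in lebesgue. T (\<psi> m) y = \<psi> (Suc m) y" if "m < n" for m
    proof -
      have j: "2 * (n - m) = Suc (Suc (2 * (n - Suc m)))" using that by simp
      note \<psi>m = \<psi>[of m, unfolded j]
      show "H2 (\<psi> m)" using decaying_H2[OF \<psi>m s N] that by simp
      show "AE y in lebesgue. T (\<psi> m) y = \<psi> (Suc m) y"
        using schr_op_decaying[OF \<psi>m s N, of V] that by (simp add: \<psi>_def)
    qed
    have L\<psi>: "L2 (\<psi> m)" if "m \<le> n" for m by (rule decaying_L2(1)[OF \<psi>[OF that] s N])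
    have init: "integrable lebesgue (\<lambda>y. (1 + (norm (y - x))\<^sup>2) ^ k * (norm (\<psi> m y))\<^sup>2)"
      "(\<integral>y. (1 + (norm (y - x))\<^sup>2) ^ k * (norm (\<psi> m y))\<^sup>2 \<partial>lebesgue) \<le> (M * S ^ (2 * m))\<^sup>2"
      if "k + m \<le> n" for k m
    proof -
      have m: "m \<le> n" and k: "k + DIM('a) \<le> 2 * ?N" using that by auto
      show "integrable lebesgue (\<lambda>y. (1 + (norm (y - x))\<^sup>2) ^ k * (norm (\<psi> m y))\<^sup>2)"
        by (rule decaying_moment(1)[OF \<psi>[OF m] s k])
      have "(\<integral>y. (1 + (norm (y - x))\<^sup>2) ^ k * (norm (\<psi> m y))\<^sup>2 \<partial>lebesgue)
        \<le> (C ^ m * L * S ^ (2 * m))\<^sup>2 * s ^ DIM('a) * ?J"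
        by (rule decaying_moment(2)[OF \<psi>[OF m] s k])
      also have "\<dots> = (C ^ m)\<^sup>2 * ((L * S ^ (2 * m))\<^sup>2 * (s ^ DIM('a) * ?J))"
        by (simp add: power_mult_distrib mult_ac)
      also have "\<dots> \<le> (C ^ n)\<^sup>2 * ((L * S ^ (2 * m))\<^sup>2 * (s ^ DIM('a) * ?J))"
        using C1 m J0 s by (intro mult_right_mono power_mono power_increasing) auto
      also have "\<dots> = (M * S ^ (2 * m))\<^sup>2"
        using J0 s by (simp add: M_def power_mult_distrib mult_ac)
      finally show "(\<integral>y. (1 + (norm (y - x))\<^sup>2) ^ k * (norm (\<psi> m y))\<^sup>2 \<partial>lebesgue) \<le> (M * S ^ (2 * m))\<^sup>2" .
    qed
    define A where "A = (c * M * S ^ n)\<^sup>2"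
    have Lg: "L2 g" using L\<psi>[of 0] by (simp add: \<psi>_def)
    note Lu = U_L2[OF Lg, of t]
    \<comment> \<open>The regularisation parameter 1/(j + 1) is at most 1 and tends to 0, the
      setting for Fatou's lemma.\<close>
    define F where "F = (\<lambda>(j::nat) y. reg_weight (1 / real (Suc j)) x y ^ n * (norm (U t g y))\<^sup>2)"
    let ?f = "\<lambda>y. (1 + (norm (y - x))\<^sup>2) ^ n * (norm (U t g y))\<^sup>2"
    have F: "integrable lebesgue (F j)" "\<And>y. 0 \<le> F j y" "(\<integral>y. F j y \<partial>lebesgue) \<le> A * jbr t ^ (2 * n)" for j
    proof -
      let ?e = "1 / real (Suc j)"
      have e: "0 < ?e" "?e \<le> 1" by auto
      note qb = reg_weight_bounds[OF e]
      have q0: "0 \<le> reg_weight ?e x y" for y using qb(1)[of x y] by linarith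
      show F0: "0 \<le> F j y" for y unfolding F_def using q0[of y] by simp
      show "integrable lebesgue (F j)" unfolding F_def
      proof (rule L2_integrable_weight[OF Lu])
        show "(\<lambda>y. reg_weight ?e x y ^ n) \<in> borel_measurable lebesgue"
          using reg_weight_measurable(1)[OF e(1), of x] by measurable
        show "0 \<le> reg_weight ?e x y ^ n" "reg_weight ?e x y ^ n \<le> (1 / ?e) ^ n" for y
          using q0[of y] qb(2)[of x y] by (auto intro!: power_mono)
      qed
      have "sqrt (\<integral>y. F j y \<partial>lebesgue) \<le> c * M * S ^ n * jbr t ^ n"
        using regularised_moment_bound[OF H L\<psi> chain init S M0 e, where k = n and m = 0 and t = t]
        by (simp add: F_def c_def \<psi>_def)
      then have "(sqrt (\<integral>y. F j y \<partial>lebesgue))\<^sup>2 \<le> (c * M * S ^ n * jbr t ^ n)\<^sup>2"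
        by (rule power_mono) (auto intro!: integral_nonneg_AE AE_I2 F0)
      moreover have "0 \<le> (\<integral>y. F j y \<partial>lebesgue)" by (intro integral_nonneg_AE AE_I2 F0)
      ultimately show "(\<integral>y. F j y \<partial>lebesgue) \<le> A * jbr t ^ (2 * n)"
        by (simp add: A_def power_mult_distrib power_mult[symmetric] mult.commute)
    qed
    have lim: "(\<lambda>j. F j y) \<longlonglongrightarrow> ?f y" for y
    proof -
      let ?a = "1 + (norm (y - x))\<^sup>2"
      have "(\<lambda>j. ?a / (1 + 1 / real (Suc j) * ?a)) \<longlonglongrightarrow> ?a / (1 + 0 * ?a)"
        by (intro tendsto_intros LIMSEQ_inverse_real_of_nat[unfolded inverse_eq_divide]) simp
      then have "(\<lambda>j. reg_weight (1 / real (Suc j)) x y) \<longlonglongrightarrow> ?a" by (simp add: reg_weight_def)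
      then show ?thesis unfolding F_def by (intro tendsto_intros)
    qed
    have fm: "?f \<in> borel_measurable lebesgue"
    proof -
      have "(\<lambda>y. (1 + (norm (y - x))\<^sup>2) ^ n) \<in> borel_measurable lebesgue" by (rule measurable_completion) simp
      then show ?thesis using L2_measurable[OF Lu] by measurable
    qed
    note mom = fatou_bound[OF F lim fm]
    have "(L2norm (U t g))\<^sup>2 \<le> A"
    proof -
      have "(L2norm g)\<^sup>2 \<le> M\<^sup>2"
        using init(2)[of 0 0] by (simp add: \<psi>_def L2norm_power2)
      also have "\<dots> \<le> (c * M * S ^ n)\<^sup>2"
      proof (rule power_mono)
        have "1 * 1 \<le> c * S ^ n" using c1 S by (intro mult_mono one_le_power) auto
        from mult_left_mono[OF this M0] show "M \<le> c * M * S ^ n" by (simp add: mult_ac)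
      qed (rule M0)
      finally show ?thesis by (simp add: A_def U_norm[OF Lg])
    qed
    from pairing_weight_bound[OF f Lu this mom]
    have "(norm (inner_L2 f (U t g)))\<^sup>2 \<le> 2 * A * weight_int t n x f"
      by (simp add: inner_L2_def)
    also have "2 * A = (2 * (c * C ^ n)\<^sup>2 * ?J) * (L\<^sup>2 * s ^ DIM('a) * (1 / s) ^ (2 * n))"
      using J0 s by (simp add: A_def M_def S_def power_mult_distrib power_mult[symmetric] mult_ac)
    also have "\<dots> * weight_int t n x f \<le> K * (L\<^sup>2 * s ^ DIM('a) * (1 / s) ^ (2 * n)) * weight_int t n x f"
      using s by (intro mult_right_mono weight_int_nonneg) (auto simp: K_def)
    finally show ?thesis .
  qed
  show thesis by (rule that[OF K0 bound])
qed

text \<open>Duhamel's principle: the pairing with \<open>U \<tau> g\<close> has derivative -i times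
  the pairing with the evolution of T g. That datum has amplitude C L / s^2, whose square gives the
  extra (1/s)^4, and the weight grows with |\<tau>|, so the endpoint t dominates.\<close>

lemma propagation_difference_bound:
  assumes V: "bounded_derivs (2 * n) B' V"
  obtains K where "0 < K" "\<And>s L x g f t. \<lbrakk>0 < s; s \<le> 1; decaying (n + DIM('a)) (2 * n + 2) L s x g; L2 f\<rbrakk> \<Longrightarrow>
    (norm (inner_L2 f (\<lambda>y. U t g y - g y)))\<^sup>2
      \<le> K * (L\<^sup>2 * s ^ DIM('a) * (1 / s) ^ (2 * n + 4)) * \<bar>t\<bar>\<^sup>2 * weight_int t n x f"
proof -
  let ?N = "n + DIM('a)"
  have "bounded_derivs (2 * n - 2) B' V" by (rule bounded_derivs_le[OF V]) simp
  then obtain K where K: "0 < K" "\<And>s L x g f t. \<lbrakk>0 < s; s \<le> 1; decaying ?N (2 * n) L s x g; L2 f\<rbrakk> \<Longrightarrow>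
    (norm (inner_L2 f (U t g)))\<^sup>2 \<le> K * (L\<^sup>2 * s ^ DIM('a) * (1 / s) ^ (2 * n)) * weight_int t n x f"
    using propagation_bound by metis
  have B'0: "0 \<le> B'" using bounded_derivs_bound[OF V, of 0] by linarith
  define C where "C = 1 + real DIM('a) + 2 ^ (2 * n) * B'"
  have C1: "1 \<le> C" using B'0 by (simp add: C_def)
  have bound: "(norm (inner_L2 f (\<lambda>y. U t g y - g y)))\<^sup>2
      \<le> (K * C\<^sup>2) * (L\<^sup>2 * s ^ DIM('a) * (1 / s) ^ (2 * n + 4)) * \<bar>t\<bar>\<^sup>2 * weight_int t n x f"
    if s: "0 < s" "s \<le> 1" and g: "decaying ?N (2 * n + 2) L s x g" and f: "L2 f" for s L x g f t
  proof -
    have N: "DIM('a) \<le> 2 * ?N" by simp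
    have g': "decaying ?N (Suc (Suc (2 * n))) L s x g" using g by simp
    have gH: "H2 g" by (rule decaying_H2[OF g' s N])
    note Lg = H2_L2[OF gH]
    let ?h = "schr_classical V g"
    have h: "decaying ?N (2 * n) (C * L * (1 / s)\<^sup>2) s x ?h"
      by (rule decaying_schr_classical[OF V g' s]) (simp add: C_def)
    have Lh: "L2 ?h" by (rule decaying_L2(1)[OF h s N])
    let ?W = "(K * C\<^sup>2) * (L\<^sup>2 * s ^ DIM('a) * (1 / s) ^ (2 * n + 4)) * weight_int t n x f"
    let ?F = "\<lambda>\<tau>. \<integral>y. U \<tau> g y * cnj (f y) \<partial>lebesgue"
    have W0: "0 \<le> ?W" using K(1) s by (intro mult_nonneg_nonneg weight_int_nonneg) auto
    have "norm (?F t - ?F 0) \<le> sqrt ?W * \<bar>t - 0\<bar>"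
    proof (rule has_vector_derivative_bound)
      fix \<tau> assume "\<tau> \<in> closed_segment 0 t"
      then have \<tau>: "\<bar>\<tau>\<bar> \<le> \<bar>t\<bar>" by (auto simp: closed_segment_eq_real_ivl split: if_splits)
      have LT: "L2 (\<lambda>y. - (\<i> * T (U \<tau> g) y))" by (intro L2_uminus L2_cmult L2_T U_H2 gH)
      show "(?F has_vector_derivative (\<integral>y. - (\<i> * T (U \<tau> g) y) * cnj (f y) \<partial>lebesgue)) (at \<tau>)"
        by (rule L2_deriv_pairing[OF U_L2[OF Lg] LT U_deriv[OF gH] L2_cnj[OF f]])
      have "(\<integral>y. - (\<i> * T (U \<tau> g) y) * cnj (f y) \<partial>lebesgue) = (\<integral>y. - \<i> * (cnj (f y) * U \<tau> ?h y) \<partial>lebesgue)"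
      proof (rule integral_cong_AE)
        show "AE y in lebesgue. - (\<i> * T (U \<tau> g) y) * cnj (f y) = - \<i> * (cnj (f y) * U \<tau> ?h y)"
          using U_commutes_T[OF gH, of \<tau>] U_cong[OF L2_T[OF gH] Lh schr_op_decaying[OF g' s N], of \<tau>]
          by eventually_elim simp
        show "(\<lambda>y. - (\<i> * T (U \<tau> g) y) * cnj (f y)) \<in> borel_measurable lebesgue"
          using L2_integrable_mult[OF LT L2_cnj[OF f]] by auto
        show "(\<lambda>y. - \<i> * (cnj (f y) * U \<tau> ?h y)) \<in> borel_measurable lebesgue"
          using L2_integrable_mult[OF L2_cnj[OF f] U_L2[OF Lh, of \<tau>]] by auto
      qed
      also have "\<dots> = - \<i> * inner_L2 f (U \<tau> ?h)" by (simp only: inner_L2_def integral_mult_right_zero)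
      finally have "(norm (\<integral>y. - (\<i> * T (U \<tau> g) y) * cnj (f y) \<partial>lebesgue))\<^sup>2 = (norm (inner_L2 f (U \<tau> ?h)))\<^sup>2"
        by (simp add: norm_mult)
      also have "\<dots> \<le> K * ((C * L * (1 / s)\<^sup>2)\<^sup>2 * s ^ DIM('a) * (1 / s) ^ (2 * n)) * weight_int \<tau> n x f"
        by (rule K(2)[OF s h f])
      also have "\<dots> \<le> K * ((C * L * (1 / s)\<^sup>2)\<^sup>2 * s ^ DIM('a) * (1 / s) ^ (2 * n)) * weight_int t n x f"
        using K(1) s by (intro mult_left_mono weight_int_mono[OF f \<tau>]) auto
      also have "\<dots> = ?W"
        by (simp add: power_mult_distrib power_add power_mult[symmetric] mult_ac)
      finally show "norm (\<integral>y. - (\<i> * T (U \<tau> g) y) * cnj (f y) \<partial>lebesgue) \<le> sqrt ?W"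
        by (rule real_le_rsqrt)
    qed
    moreover have "?F t - ?F 0 = inner_L2 f (\<lambda>y. U t g y - g y)"
    proof -
      have "?F 0 = (\<integral>y. g y * cnj (f y) \<partial>lebesgue)"
      proof (rule integral_cong_AE)
        show "AE y in lebesgue. U 0 g y * cnj (f y) = g y * cnj (f y)"
          using U_0[OF Lg] by eventually_elim simp
        show "(\<lambda>y. U 0 g y * cnj (f y)) \<in> borel_measurable lebesgue"
          using L2_integrable_mult[OF U_L2[OF Lg, of 0] L2_cnj[OF f]] by auto
        show "(\<lambda>y. g y * cnj (f y)) \<in> borel_measurable lebesgue"
          using L2_integrable_mult[OF Lg L2_cnj[OF f]] by auto
      qed
      then have "?F t - ?F 0 = (\<integral>y. U t g y * cnj (f y) - g y * cnj (f y) \<partial>lebesgue)"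
        using Bochner_Integration.integral_diff[OF L2_integrable_mult[OF U_L2[OF Lg, of t] L2_cnj[OF f]] L2_integrable_mult[OF Lg L2_cnj[OF f]]]
        by simp
      then show ?thesis by (simp add: inner_L2_def algebra_simps)
    qed
    ultimately have "(norm (inner_L2 f (\<lambda>y. U t g y - g y)))\<^sup>2 \<le> (sqrt ?W * \<bar>t\<bar>)\<^sup>2"
      by (intro power_mono) auto
    also have "\<dots> = ?W * \<bar>t\<bar>\<^sup>2" using W0 by (simp only: power_mult_distrib real_sqrt_pow2)
    finally show ?thesis by (simp add: mult_ac)
  qed
  have "0 < K * C\<^sup>2" using K(1) C1 by simp
  then show thesis by (rule that[OF _ bound])
qed

end

theorem mainTheorem1:
  fixes V :: "'a::euclidean_space \<Rightarrow> real"
    and nV n :: nat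
    and U :: "real \<Rightarrow> ('a \<Rightarrow> complex) \<Rightarrow> 'a \<Rightarrow> complex"
    and \<phi> :: "'a \<Rightarrow> complex"
    and \<delta> :: real
  assumes "V1 V" and "V2 V nV" and "2 \<le> nV"
    and "propagator V U"
    and "schwartz \<phi>" and "0 < \<delta>"
  shows "(2 * n \<le> nV \<longrightarrow> (\<exists>C0>0. \<forall>x t f. L2 f \<longrightarrow>
            (cmod (inner_L2 f (U t (transl \<phi> x))))\<^sup>2
              \<le> C0 * jbr t powr (1 + 2 * \<delta>) * weight_int t n x f))
       \<and> (2 * n + 2 \<le> nV \<longrightarrow> (\<exists>C1>0. \<forall>x t f. L2 f \<longrightarrow>
            (cmod (inner_L2 f (\<lambda>y. U t (transl \<phi> x) y - transl \<phi> x y)))\<^sup>2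
              \<le> C1 * \<bar>t\<bar>\<^sup>2 * jbr t powr (1 + 2 * \<delta>) * weight_int t n x f))
       \<and> (\<exists>K. \<forall>\<sigma>. 0 < \<sigma> \<and> \<sigma> \<le> 1 \<longrightarrow>
            (2 * n \<le> nV \<longrightarrow> (\<exists>C0>0.
               C0 \<le> K * \<sigma> powr (- real DIM('a)) * \<sigma> powr (- 4 * (n * (n + \<delta>) / (2 * \<delta>))) \<and>
               (\<forall>x t f. L2 f \<longrightarrow>
                 (cmod (inner_L2 f (U t (transl (gauss \<sigma>) x))))\<^sup>2
                   \<le> C0 * jbr t powr (1 + 2 * \<delta>) * weight_int t n x f)))
          \<and> (2 * n + 2 \<le> nV \<longrightarrow> (\<exists>C1>0.
               C1 \<le> K * \<sigma> powr (- real DIM('a)) * \<sigma> powr (- 4 * (n * (n + \<delta>) / (2 * \<delta>) + 1)) \<and>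
               (\<forall>x t f. L2 f \<longrightarrow>
                 (cmod (inner_L2 f (\<lambda>y. U t (transl (gauss \<sigma>) x) y - transl (gauss \<sigma>) x y)))\<^sup>2
                   \<le> C1 * \<bar>t\<bar>\<^sup>2 * jbr t powr (1 + 2 * \<delta>) * weight_int t n x f))))"
proof -
  note V1 = assms(1) and V2 = assms(2) and nV = assms(3) and propU = assms(4) and \<phi> = assms(5) and \<delta> = assms(6)
  obtain B where B: "\<And>x. \<bar>V x\<bar> \<le> B" using potential_bounded[OF V1 V2 nV] by blast
  interpret schroedinger V U B
    using V1 B propU by unfold_locales (auto simp: V1_def)
  have bd: "\<exists>B'. bounded_derivs j B' V" if "j < nV" for j
    using V2_bounded_derivs[OF V2, of "[]" j] that B by auto
  let ?N = "n + DIM('a)"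
  \<comment> \<open>The implication stands under the quantifier so that the constant exists even if
    the differentiability hypothesis fails; the Gaussian statement needs one K for both
    parts.\<close>
  have ex0: "\<exists>K>0. 2 * n \<le> nV \<longrightarrow> (\<forall>s L x g f t. 0 < s \<longrightarrow> s \<le> 1 \<longrightarrow> decaying ?N (2 * n) L s x g \<longrightarrow> L2 f \<longrightarrow>
    (cmod (inner_L2 f (U t g)))\<^sup>2 \<le> K * (L\<^sup>2 * s ^ DIM('a) * (1 / s) ^ (2 * n)) * weight_int t n x f)"
  proof (cases "2 * n \<le> nV")
    case True
    \<comment> \<open>Strict even when 2n = nV. For n = 0 the truncated difference is 0, and nV >= 2
      gives the claim.\<close>
    then have "2 * n - 2 < nV" using nV by linarith
    then obtain B' where "bounded_derivs (2 * n - 2) B' V" using bd by blast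
    then show ?thesis by (rule propagation_bound) blast
  qed (auto intro: exI[of _ 1])
  then obtain K0 where K0: "0 < K0" and K0':
    "2 * n \<le> nV \<longrightarrow> (\<forall>s L x g f t. 0 < s \<longrightarrow> s \<le> 1 \<longrightarrow> decaying ?N (2 * n) L s x g \<longrightarrow> L2 f \<longrightarrow>
    (cmod (inner_L2 f (U t g)))\<^sup>2 \<le> K0 * (L\<^sup>2 * s ^ DIM('a) * (1 / s) ^ (2 * n)) * weight_int t n x f)"
    by (elim exE conjE)
  have K0'': "\<And>s L x g f t. \<lbrakk>2 * n \<le> nV; 0 < s; s \<le> 1; decaying ?N (2 * n) L s x g; L2 f\<rbrakk> \<Longrightarrow>
    (cmod (inner_L2 f (U t g)))\<^sup>2 \<le> K0 * (L\<^sup>2 * s ^ DIM('a) * (1 / s) ^ (2 * n)) * weight_int t n x f"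
    using K0' by blast
  have ex1: "\<exists>K>0. 2 * n + 2 \<le> nV \<longrightarrow> (\<forall>s L x g f t. 0 < s \<longrightarrow> s \<le> 1 \<longrightarrow> decaying ?N (2 * n + 2) L s x g \<longrightarrow> L2 f \<longrightarrow>
    (cmod (inner_L2 f (\<lambda>y. U t g y - g y)))\<^sup>2
      \<le> K * (L\<^sup>2 * s ^ DIM('a) * (1 / s) ^ (2 * n + 4)) * \<bar>t\<bar>\<^sup>2 * weight_int t n x f)"
  proof (cases "2 * n + 2 \<le> nV")
    case True
    then have "2 * n < nV" by linarith
    then obtain B' where "bounded_derivs (2 * n) B' V" using bd by blast
    then show ?thesis by (rule propagation_difference_bound) blast
  qed (auto intro: exI[of _ 1])
  then obtain K1 where K1: "0 < K1" and K1':
    "2 * n + 2 \<le> nV \<longrightarrow> (\<forall>s L x g f t. 0 < s \<longrightarrow> s \<le> 1 \<longrightarrow> decaying ?N (2 * n + 2) L s x g \<longrightarrow> L2 f \<longrightarrow>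
    (cmod (inner_L2 f (\<lambda>y. U t g y - g y)))\<^sup>2
      \<le> K1 * (L\<^sup>2 * s ^ DIM('a) * (1 / s) ^ (2 * n + 4)) * \<bar>t\<bar>\<^sup>2 * weight_int t n x f)"
    by (elim exE conjE)
  have K1'': "\<And>s L x g f t. \<lbrakk>2 * n + 2 \<le> nV; 0 < s; s \<le> 1; decaying ?N (2 * n + 2) L s x g; L2 f\<rbrakk> \<Longrightarrow>
    (cmod (inner_L2 f (\<lambda>y. U t g y - g y)))\<^sup>2
      \<le> K1 * (L\<^sup>2 * s ^ DIM('a) * (1 / s) ^ (2 * n + 4)) * \<bar>t\<bar>\<^sup>2 * weight_int t n x f"
    using K1' by blast
  \<comment> \<open>The estimates obtained so far carry no such power of \<open>jbr t\<close>; being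
    at least 1, it is simply inserted.\<close>
  have loss: "a * w \<le> a * jbr t powr (1 + 2 * \<delta>) * w" if "0 \<le> a" "0 \<le> w" for a w t
  proof -
    have "1 \<le> jbr t powr (1 + 2 * \<delta>)" using \<delta> jbr_ge_1[of t] by (intro ge_one_powr_ge_zero) auto
    from mult_left_mono[OF this mult_nonneg_nonneg[OF that]] show ?thesis by (simp add: mult_ac)
  qed
  obtain L0 where L0: "0 < L0" "\<And>s x. 0 < s \<Longrightarrow> decaying ?N (2 * n) L0 s x (\<lambda>y. \<phi> ((y - x) /\<^sub>R s))"
    using schwartz_decaying[OF \<phi>] by metis
  obtain L1 where L1: "0 < L1" "\<And>s x. 0 < s \<Longrightarrow> decaying ?N (2 * n + 2) L1 s x (\<lambda>y. \<phi> ((y - x) /\<^sub>R s))"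
    using schwartz_decaying[OF \<phi>] by metis
  obtain G where G: "0 < G" "\<And>s x. 0 < s \<Longrightarrow> decaying ?N (2 * n + 2) G s x (\<lambda>y::'a. gauss 1 ((y - x) /\<^sub>R s))"
    using schwartz_decaying[OF schwartz_gauss] by metis
  have part0: "\<exists>C0>0. \<forall>x t f. L2 f \<longrightarrow> (cmod (inner_L2 f (U t (transl \<phi> x))))\<^sup>2
              \<le> C0 * jbr t powr (1 + 2 * \<delta>) * weight_int t n x f" if "2 * n \<le> nV"
  \<comment> \<open>A fixed Schwartz function is taken at scale 1, where all powers of s
    disappear.\<close>
  proof (intro exI[of _ "K0 * L0\<^sup>2"] conjI allI impI)
    fix x t and f :: "'a \<Rightarrow> complex" assume f: "L2 f"
    have "(cmod (inner_L2 f (U t (transl \<phi> x))))\<^sup>2 \<le> K0 * L0\<^sup>2 * weight_int t n x f"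
      using K0''[OF that _ _ L0(2) f, of 1 t x] by (simp add: transl_def)
    also have "\<dots> \<le> K0 * L0\<^sup>2 * jbr t powr (1 + 2 * \<delta>) * weight_int t n x f"
      using K0 by (intro loss weight_int_nonneg) simp
    finally show "(cmod (inner_L2 f (U t (transl \<phi> x))))\<^sup>2 \<le> K0 * L0\<^sup>2 * jbr t powr (1 + 2 * \<delta>) * weight_int t n x f" .
  qed (use K0 L0 in simp)
  have part1: "\<exists>C1>0. \<forall>x t f. L2 f \<longrightarrow> (cmod (inner_L2 f (\<lambda>y. U t (transl \<phi> x) y - transl \<phi> x y)))\<^sup>2
              \<le> C1 * \<bar>t\<bar>\<^sup>2 * jbr t powr (1 + 2 * \<delta>) * weight_int t n x f" if "2 * n + 2 \<le> nV"
  proof (intro exI[of _ "K1 * L1\<^sup>2"] conjI allI impI)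
    fix x t and f :: "'a \<Rightarrow> complex" assume f: "L2 f"
    have "(cmod (inner_L2 f (\<lambda>y. U t (transl \<phi> x) y - transl \<phi> x y)))\<^sup>2 \<le> K1 * L1\<^sup>2 * \<bar>t\<bar>\<^sup>2 * weight_int t n x f"
      using K1''[OF that _ _ L1(2) f, of 1 t x] by (simp add: transl_def)
    also have "\<dots> \<le> K1 * L1\<^sup>2 * \<bar>t\<bar>\<^sup>2 * jbr t powr (1 + 2 * \<delta>) * weight_int t n x f"
      using K1 by (intro loss weight_int_nonneg) simp
    finally show "(cmod (inner_L2 f (\<lambda>y. U t (transl \<phi> x) y - transl \<phi> x y)))\<^sup>2
      \<le> K1 * L1\<^sup>2 * \<bar>t\<bar>\<^sup>2 * jbr t powr (1 + 2 * \<delta>) * weight_int t n x f" .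
  qed (use K1 L1 in simp)
  have "\<exists>K. \<forall>\<sigma>. 0 < \<sigma> \<and> \<sigma> \<le> 1 \<longrightarrow>
            (2 * n \<le> nV \<longrightarrow> (\<exists>C0>0.
               C0 \<le> K * \<sigma> powr (- real DIM('a)) * \<sigma> powr (- 4 * (n * (n + \<delta>) / (2 * \<delta>))) \<and>
               (\<forall>x t f. L2 f \<longrightarrow>
                 (cmod (inner_L2 f (U t (transl (gauss \<sigma>) x))))\<^sup>2
                   \<le> C0 * jbr t powr (1 + 2 * \<delta>) * weight_int t n x f)))
          \<and> (2 * n + 2 \<le> nV \<longrightarrow> (\<exists>C1>0.
               C1 \<le> K * \<sigma> powr (- real DIM('a)) * \<sigma> powr (- 4 * (n * (n + \<delta>) / (2 * \<delta>) + 1)) \<and>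
               (\<forall>x t f. L2 f \<longrightarrow>
                 (cmod (inner_L2 f (\<lambda>y. U t (transl (gauss \<sigma>) x) y - transl (gauss \<sigma>) x y)))\<^sup>2
                   \<le> C1 * \<bar>t\<bar>\<^sup>2 * jbr t powr (1 + 2 * \<delta>) * weight_int t n x f)))"
  \<comment> \<open>\<open>G\<close> belongs to the unit Gaussian, so this constant is free of
    \<sigma>; the sum covers both parts.\<close>
  proof (intro exI[of _ "(K0 + K1) * G\<^sup>2"] allI impI, elim conjE)
    fix \<sigma> :: real assume \<sigma>: "0 < \<sigma>" "\<sigma> \<le> 1"
    let ?d = "real DIM('a)"
    let ?A = "\<sigma> powr (- ?d)"
    have A0: "?A > 0" using \<sigma> by simp
    have g: "decaying ?N (2 * n + 2) (?A * G) \<sigma> x (transl (gauss \<sigma>) x)" for x :: 'a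
    proof -
      have "transl (gauss \<sigma>) x = (\<lambda>y. complex_of_real ?A * gauss 1 ((y - x) /\<^sub>R \<sigma>))"
        using gauss_scale[OF \<sigma>(1)] by (auto simp: transl_def)
      then show ?thesis
        using decaying_cmult[OF G(2)[OF \<sigma>(1), of x], of "complex_of_real ?A"] by simp
    qed
    have g0: "decaying ?N (2 * n) (?A * G) \<sigma> x (transl (gauss \<sigma>) x)" for x :: 'a
      by (rule decaying_le[OF g]) simp
    \<comment> \<open>The squared amplitude \<sigma>^(-2d) and the volume factor \<sigma>^d combine
      to \<sigma>^(-d); since \<sigma> <= 1, the exponent k may be enlarged to any p.\<close>
    have amp: "(?A * G)\<^sup>2 * \<sigma> ^ DIM('a) * (1 / \<sigma>) ^ k \<le> G\<^sup>2 * ?A * \<sigma> powr (- p)" if "real k \<le> p" for k p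
    proof -
      have a: "?A\<^sup>2 * \<sigma> ^ DIM('a) = ?A"
        using \<sigma>(1) by (simp add: powr_realpow[symmetric] power2_eq_square powr_add[symmetric] del: powr_minus)
      have "(1 / \<sigma>) ^ k = \<sigma> powr (- real k)"
        using \<sigma>(1) by (simp add: powr_minus powr_realpow power_one_over inverse_eq_divide)
      also have "\<dots> \<le> \<sigma> powr (- p)" using \<sigma> that by (intro powr_mono') auto
      finally have b: "(1 / \<sigma>) ^ k \<le> \<sigma> powr (- p)" .
      have "(?A * G)\<^sup>2 * \<sigma> ^ DIM('a) * (1 / \<sigma>) ^ k = G\<^sup>2 * (?A\<^sup>2 * \<sigma> ^ DIM('a)) * (1 / \<sigma>) ^ k"
        by (simp add: power_mult_distrib mult_ac)
      also have "\<dots> \<le> G\<^sup>2 * ?A * \<sigma> powr (- p)"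
        unfolding a using A0 by (intro mult_left_mono b) auto
      finally show ?thesis .
    qed
    \<comment> \<open>The permitted exponent exceeds the 2n of the proved bound by 2 n^2 / \<delta>;
      in the second part both sides grow by 4.\<close>
    have q: "4 * (real n * (real n + \<delta>) / (2 * \<delta>)) = 2 * (real n)\<^sup>2 / \<delta> + 2 * real n"
      using \<delta> by (simp add: field_simps power2_eq_square)
    have q0: "real (2 * n) \<le> 4 * (real n * (real n + \<delta>) / (2 * \<delta>))"
      unfolding q using \<delta> by simp
    let ?P0 = "\<sigma> powr (- 4 * (n * (n + \<delta>) / (2 * \<delta>)))" and ?P1 = "\<sigma> powr (- 4 * (n * (n + \<delta>) / (2 * \<delta>) + 1))"
    have amp0: "(?A * G)\<^sup>2 * \<sigma> ^ DIM('a) * (1 / \<sigma>) ^ (2 * n) \<le> G\<^sup>2 * ?A * ?P0"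
      using amp[OF q0] by simp
    have amp1: "(?A * G)\<^sup>2 * \<sigma> ^ DIM('a) * (1 / \<sigma>) ^ (2 * n + 4) \<le> G\<^sup>2 * ?A * ?P1"
      using amp[of "2 * n + 4" "4 * (n * (n + \<delta>) / (2 * \<delta>) + 1)"] q0 by simp
    have P: "0 < ?P0" "0 < ?P1" using \<sigma> by auto
    show "(2 * n \<le> nV \<longrightarrow> (\<exists>C0>0.
               C0 \<le> (K0 + K1) * G\<^sup>2 * ?A * ?P0 \<and>
               (\<forall>x t f. L2 f \<longrightarrow>
                 (cmod (inner_L2 f (U t (transl (gauss \<sigma>) x))))\<^sup>2
                   \<le> C0 * jbr t powr (1 + 2 * \<delta>) * weight_int t n x f)))
          \<and> (2 * n + 2 \<le> nV \<longrightarrow> (\<exists>C1>0.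
               C1 \<le> (K0 + K1) * G\<^sup>2 * ?A * ?P1 \<and>
               (\<forall>x t f. L2 f \<longrightarrow>
                 (cmod (inner_L2 f (\<lambda>y. U t (transl (gauss \<sigma>) x) y - transl (gauss \<sigma>) x y)))\<^sup>2
                   \<le> C1 * \<bar>t\<bar>\<^sup>2 * jbr t powr (1 + 2 * \<delta>) * weight_int t n x f)))"
    proof (intro conjI impI)
      assume le: "2 * n \<le> nV"
      let ?C = "K0 * (G\<^sup>2 * ?A * ?P0)"
      have C0: "0 < ?C" using K0 G(1) A0 P by simp
      show "\<exists>C0>0. C0 \<le> (K0 + K1) * G\<^sup>2 * ?A * ?P0 \<and> (\<forall>x t f. L2 f \<longrightarrow>
                 (cmod (inner_L2 f (U t (transl (gauss \<sigma>) x))))\<^sup>2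
                   \<le> C0 * jbr t powr (1 + 2 * \<delta>) * weight_int t n x f)"
      proof (intro exI[of _ ?C] conjI allI impI C0)
        have "?C \<le> (K0 + K1) * (G\<^sup>2 * ?A * ?P0)" using K1 A0 P by (intro mult_right_mono) auto
        then show "?C \<le> (K0 + K1) * G\<^sup>2 * ?A * ?P0" by (simp only: mult.assoc)
        fix x t and f :: "'a \<Rightarrow> complex" assume f: "L2 f"
        have "(cmod (inner_L2 f (U t (transl (gauss \<sigma>) x))))\<^sup>2
            \<le> K0 * ((?A * G)\<^sup>2 * \<sigma> ^ DIM('a) * (1 / \<sigma>) ^ (2 * n)) * weight_int t n x f"
          by (rule K0''[OF le \<sigma> g0 f])
        also have "\<dots> \<le> ?C * weight_int t n x f"
          using K0 by (intro mult_right_mono mult_left_mono amp0 weight_int_nonneg) auto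
        also have "\<dots> \<le> ?C * jbr t powr (1 + 2 * \<delta>) * weight_int t n x f"
          using C0 by (intro loss weight_int_nonneg) simp
        finally show "(cmod (inner_L2 f (U t (transl (gauss \<sigma>) x))))\<^sup>2
          \<le> ?C * jbr t powr (1 + 2 * \<delta>) * weight_int t n x f" .
      qed
    next
      assume le: "2 * n + 2 \<le> nV"
      let ?C = "K1 * (G\<^sup>2 * ?A * ?P1)"
      have C0: "0 < ?C" using K1 G(1) A0 P by simp
      show "\<exists>C1>0. C1 \<le> (K0 + K1) * G\<^sup>2 * ?A * ?P1 \<and> (\<forall>x t f. L2 f \<longrightarrow>
                 (cmod (inner_L2 f (\<lambda>y. U t (transl (gauss \<sigma>) x) y - transl (gauss \<sigma>) x y)))\<^sup>2
                   \<le> C1 * \<bar>t\<bar>\<^sup>2 * jbr t powr (1 + 2 * \<delta>) * weight_int t n x f)"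
      proof (intro exI[of _ ?C] conjI allI impI C0)
        have "?C \<le> (K0 + K1) * (G\<^sup>2 * ?A * ?P1)" using K0 A0 P by (intro mult_right_mono) auto
        then show "?C \<le> (K0 + K1) * G\<^sup>2 * ?A * ?P1" by (simp only: mult.assoc)
        fix x t and f :: "'a \<Rightarrow> complex" assume f: "L2 f"
        have "(cmod (inner_L2 f (\<lambda>y. U t (transl (gauss \<sigma>) x) y - transl (gauss \<sigma>) x y)))\<^sup>2
            \<le> K1 * ((?A * G)\<^sup>2 * \<sigma> ^ DIM('a) * (1 / \<sigma>) ^ (2 * n + 4)) * \<bar>t\<bar>\<^sup>2 * weight_int t n x f"
          by (rule K1''[OF le \<sigma> g f])
        also have "\<dots> \<le> ?C * \<bar>t\<bar>\<^sup>2 * weight_int t n x f"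
          using K1 by (intro mult_right_mono mult_left_mono amp1 weight_int_nonneg) auto
        also have "\<dots> \<le> ?C * \<bar>t\<bar>\<^sup>2 * jbr t powr (1 + 2 * \<delta>) * weight_int t n x f"
          using C0 by (intro loss weight_int_nonneg) simp
        finally show "(cmod (inner_L2 f (\<lambda>y. U t (transl (gauss \<sigma>) x) y - transl (gauss \<sigma>) x y)))\<^sup>2
          \<le> ?C * \<bar>t\<bar>\<^sup>2 * jbr t powr (1 + 2 * \<delta>) * weight_int t n x f" .
      qed
    qed
  qed
  with part0 part1 show ?thesis by blast
qed

end
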